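(* Let $s\ge0$ be an integer, let $n=n_s=5(2^s-1)+42\cdot2^s$, and let $t=5$. Then: (a) For each $(l,\mathscr L)\in\mathcal N_5$ with $1\le r=\ell(\mathscr L)\le4$, if $x=\prod_{1\le j\le4}x_j^{a_j}\in\mathscr C_n^{\otimes4}$ and there exists $u$, $1\le u\le r$, satisfying condition $(\ast)$ of the context, then $\psi_{(l,\mathscr L)}(x)\in\mathscr C_n^{\otimes5}$. (b) For every weight vector $\omega$ of degree $n$, $\widetilde{\Phi_*}\big((\mathscr C_n^{\otimes4})^{\omega}\big)\subseteq(\mathscr C_n^{\otimes5})^{\omega}$.
   Context: $\mathbb Z_2$ is the field with two elements, $\mathcal A_2$ the mod 2 Steenrod algebra, and $P_t=\mathbb Z_2[x_1,\dots,x_t]$ with $\deg x_i=1$, a left $\mathcal A_2$-module via $Sq^i(x_j^a)=\binom{a}{i}x_j^{a+i}$ and the Cartan formula. $(P_t)_n$ is the space of homogeneous polynomials of degree $n$. Write $f\sim g$ for $f,g\in(P_t)_n$ if $f-g\in\sum_{i>0}\mathrm{Im}(Sq^i:(P_t)_{n-i}\to(P_t)_n)$. Let $\alpha_j(a)\in\{0,1\}$ be the $j$-th binary digit of $a$, so $a=\sum_{j\ge0}\alpha_j(a)2^j$. A weight vector is a sequence $\omega=(\omega_1,\omega_2,\dots)$ of non-negative integers with finitely many nonzero terms; its degree is $\sum_i2^{i-1}\omega_i$. The weight vector of a monomial $x=x_1^{a_1}\cdots x_t^{a_t}$ is $\omega(x)=(\omega_1(x),\omega_2(x),\dots)$ with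 $\omega_i(x)=\sum_{j=1}^t\alpha_{i-1}(a_j)$; its exponent vector is $(a_1,\dots,a_t)$. Weight vectors and exponent vectors are ordered left-lexicographically. For monomials $x,y\in(P_t)_n$: $x<y$ iff $\omega(x)<\omega(y)$, or $\omega(x)=\omega(y)$ and the exponent vector of $x$ is smaller than that of $y$. A monomial $x\in(P_t)_n$ is inadmissible if there are monomials $y_1,\dots,y_k\in(P_t)_n$ ($k\ge0$) with all $y_j<x$ and $x\sim y_1+\cdots+y_k$; otherwise it is admissible. $\mathscr C^{\otimes t}_n$ is the set of admissible monomials in $(P_t)_n$, and $(\mathscr C^{\otimes t}_n)^{\omega}$ the subset of those with weight vector $\omega$. For $1\le l\le t$, $\mathsf q_{(l,t)}:P_{t-1}\to P_t$ is the algebra homomorphism with $x_j\mapsto x_j$ for $j\le l-1$ and $x_j\mapsto x_{j+1}$ for $l\le j\le t-1$. Let $\mathcal N_t$ be the set of pairs $(l,\mathscr L)$ with $\mathscr L=(l_1,\dots,l_r)$, $1\le l<l_1<\cdots<l_r\le t$, $0\le r\le t-1$ ($\mathscr L=\emptyset$ if $r=0$); $r=\ell(\mathscr L)$ is the length. For $1\le u\le r$ put $x_{(\mathscr L,u)}=x_{l_u}^{2^{r-1}+2^{r-2}+\cdots+2^{r-u}}\prod_{u<d\le r}x_{l_d}^{2^{r-d}}$. Define the linear map $\psi_{(l,\mathscr L)}:P_{t-1}\to P_t$ as follows: $\psi_{(l,\emptyset)}=\mathsf q_{(l,t)}$; for $r\ge1$, $\psi_{(l,\mathscr L)}(\prod_jx_j^{a_j})=x_l^{2^r-1}\,\mathsf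 q_{(l,t)}(\prod_jx_j^{a_j})/x_{(\mathscr L,u)}$ if there is $u$, $1\le u\le r$, such that $(\ast)$ $a_{l_1-1}=\cdots=a_{l_{u-1}-1}=2^r-1$; $a_{l_u-1}>2^r-1$; $\alpha_{r-d}(a_{l_u-1})=1$ for $1\le d\le u$; and $\alpha_{r-d}(a_{l_d-1})=1$ for $u<d\le r$ (such $u$ is unique if it exists), and $\psi_{(l,\mathscr L)}(\prod_jx_j^{a_j})=0$ otherwise. Let $(P_t)_n^0$ be the span of monomials in $(P_t)_n$ with at least one exponent equal to zero. For $\mathscr C\subset(P_{t-1})_n$ put $\widetilde{\Phi^0}(\mathscr C)=\bigcup_{1\le l\le t}\mathsf q_{(l,t)}(\mathscr C)$, $\widetilde{\Phi^{>0}}(\mathscr C)=\bigcup_{(l,\mathscr L)\in\mathcal N_t,\,1\le\ell(\mathscr L)\le t-1}\big(\psi_{(l,\mathscr L)}(\mathscr C)\setminus(P_t)_n^0\big)$, and $\widetilde{\Phi_*}(\mathscr C)=\widetilde{\Phi^0}(\mathscr C)\cup\widetilde{\Phi^{>0}}(\mathscr C)$. *)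

theory Defs
  imports
    "HOL-Library.Poly_Mapping"
    "HOL-Library.Z2"
    "HOL-Computational_Algebra.Polynomial"
begin

section \<open>Polynomials over the field with two elements\<close>

text \<open>
  An exponent vector is a finitely supported function on variable indices. All polynomials live in
  one ring with variables \<open>X j\<close> for every natural number \<open>j\<close>; the algebra \<open>P\<^sub>t\<close> consists of
  those that only involve \<open>X 1, \<dots>, X t\<close>. This is why the maps below do not carry \<open>t\<close> as a
  parameter.
\<close>

type_synonym expo = "nat \<Rightarrow>\<^sub>0 nat"
type_synonym mpol = "expo \<Rightarrow>\<^sub>0 bit"

abbreviation mon :: "expo \<Rightarrow> mpol" where
  "mon m \<equiv> Poly_Mapping.single m 1"

abbreviation X :: "nat \<Rightarrow> mpol" where
  "X j \<equiv> mon (Poly_Mapping.single j 1)"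

definition edeg :: "expo \<Rightarrow> nat" where
  "edeg m = (\<Sum>j\<in>Poly_Mapping.keys m. Poly_Mapping.lookup m j)"

definition Exps :: "nat \<Rightarrow> nat \<Rightarrow> expo set" where
  "Exps t n = {m. Poly_Mapping.keys m \<subseteq> {1..t} \<and> edeg m = n}"

definition Pol :: "nat \<Rightarrow> nat \<Rightarrow> mpol set" where
  "Pol t n = {f. Poly_Mapping.keys f \<subseteq> Exps t n}"

definition Pol0 :: "nat \<Rightarrow> nat \<Rightarrow> mpol set" where
  "Pol0 t n = {f \<in> Pol t n. \<forall>m\<in>Poly_Mapping.keys f. \<exists>j\<in>{1..t}. Poly_Mapping.lookup m j = 0}"

text \<open>The linear map with prescribed values on monomials.\<close>

definition lin_ext :: "(expo \<Rightarrow> mpol) \<Rightarrow> mpol \<Rightarrow> mpol" where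
  "lin_ext \<phi> f =
     (\<Sum>m\<in>Poly_Mapping.keys f. Poly_Mapping.single 0 (Poly_Mapping.lookup f m) * \<phi> m)"

lemma lin_ext_superset:
  assumes "finite A" "Poly_Mapping.keys f \<subseteq> A"
  shows "lin_ext \<phi> f = (\<Sum>m\<in>A. Poly_Mapping.single 0 (Poly_Mapping.lookup f m) * \<phi> m)"
  unfolding lin_ext_def using assms
  by (intro sum.mono_neutral_left) (auto simp: in_keys_iff)

lemma lin_ext_mon [simp]: "lin_ext \<phi> (mon m) = \<phi> m"
  by (simp add: lin_ext_def)

lemma lin_ext_zero [simp]: "lin_ext \<phi> 0 = 0"
  by (simp add: lin_ext_def)

lemma lin_ext_add: "lin_ext \<phi> (f + g) = lin_ext \<phi> f + lin_ext \<phi> g"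
proof -
  let ?A = "Poly_Mapping.keys f \<union> Poly_Mapping.keys g"
  have "Poly_Mapping.keys (f + g) \<subseteq> ?A" by (rule Poly_Mapping.keys_add)
  then show ?thesis
    by (simp add: lin_ext_superset[of ?A] lookup_add single_add distrib_right sum.distrib
        del: add_bit_eq_xor)
qed

lemma mpol_induct [case_names zero add]:
  assumes "P 0" and "\<And>f m. P f \<Longrightarrow> P (f + mon m)"
  shows "P (f :: mpol)"
proof -
  have e: "f = (\<Sum>m\<in>Poly_Mapping.keys f. mon m)"
  proof (rule poly_mapping_eqI)
    fix k
    have "Poly_Mapping.lookup (\<Sum>m\<in>Poly_Mapping.keys f. mon m) k =
        (\<Sum>m\<in>Poly_Mapping.keys f. if m = k then 1 else 0)"
      unfolding lookup_sum by (intro sum.cong) (auto simp: lookup_single when_def)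
    also have "\<dots> = (if k \<in> Poly_Mapping.keys f then 1 else 0)"
      by (simp add: sum.delta')
    also have "\<dots> = Poly_Mapping.lookup f k"
      by (cases "Poly_Mapping.lookup f k") (auto simp: in_keys_iff)
    finally show "Poly_Mapping.lookup f k = Poly_Mapping.lookup (\<Sum>m\<in>Poly_Mapping.keys f. mon m) k"
      by simp
  qed
  have "P (\<Sum>m\<in>A. mon m)" if "finite A" for A
    using that
  proof (induction A rule: finite_induct)
    case (insert x F)
    then have "P ((\<Sum>m\<in>F. mon m) + mon x)" using assms(2) by blast
    then show ?case using insert by (simp add: add.commute)
  qed (simp add: assms)
  then show ?thesis using e by (metis finite_keys)
qed

section \<open>Steenrod squares\<close>

text \<open>
  On a monomial, iterating the Cartan formula gives the sum, over all ways of distributing the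
  total degree \<open>k\<close> as \<open>i\<^sub>j\<close> over the variables, of the products of
  \<open>Sq\<^sup>i(X j ^ a) = (a choose i) * X j ^ (a + i)\<close>. The lemmas \<open>Sq_X_power\<close> and \<open>Cartan\<close> below
  recover the two defining properties.
\<close>

definition Sq_mono :: "nat \<Rightarrow> expo \<Rightarrow> mpol" where
  "Sq_mono k m =
     (\<Sum>i\<in>{i. Poly_Mapping.keys i \<subseteq> Poly_Mapping.keys m \<and> edeg i = k}.
        \<Prod>j\<in>Poly_Mapping.keys m.
          of_nat (Poly_Mapping.lookup m j choose Poly_Mapping.lookup i j)
            * X j ^ (Poly_Mapping.lookup m j + Poly_Mapping.lookup i j))"

definition Sq :: "nat \<Rightarrow> mpol \<Rightarrow> mpol" where
  "Sq k = lin_ext (Sq_mono k)"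

lemma edeg_superset:
  "finite A \<Longrightarrow> Poly_Mapping.keys m \<subseteq> A \<Longrightarrow> edeg m = (\<Sum>j\<in>A. Poly_Mapping.lookup m j)"
  unfolding edeg_def by (intro sum.mono_neutral_left) (auto simp: in_keys_iff)

lemma coeff_prod_expand:
  fixes p :: "nat \<Rightarrow> 'a::comm_semiring_1 poly"
  assumes "finite A"
  shows "finite {i. Poly_Mapping.keys i \<subseteq> A \<and> edeg i = k} \<and> coeff (\<Prod>j\<in>A. p j) k =
    (\<Sum>i\<in>{i. Poly_Mapping.keys i \<subseteq> A \<and> edeg i = k}. \<Prod>j\<in>A. coeff (p j) (Poly_Mapping.lookup i j))"
  using assms
proof (induction A arbitrary: k rule: finite_induct)
  case empty
  have "{i. Poly_Mapping.keys i \<subseteq> {} \<and> edeg i = k} = (if k = 0 then {0} else {})"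
    by (auto simp: edeg_def)
  then show ?case by auto
next
  case (insert a A)
  let ?S = "\<lambda>B k. {i. Poly_Mapping.keys i \<subseteq> B \<and> edeg i = k}"
  let ?T = "SIGMA b:{..k}. ?S A (k - b)"
  let ?h = "\<lambda>(b, i). Poly_Mapping.single a b + i"
  have fin: "finite ?T" using insert.IH by auto
  have la: "Poly_Mapping.lookup i a = 0" if "Poly_Mapping.keys i \<subseteq> A" for i :: expo
    using that insert.hyps(2) by (auto simp: in_keys_iff)
  have bij: "bij_betw ?h ?T (?S (insert a A) k)"
  proof (rule bij_betwI')
    fix x y assume x: "x \<in> ?T" and y: "y \<in> ?T"
    obtain b i where xe: "x = (b, i)" by force
    obtain c j where ye: "y = (c, j)" by force
    have k: "Poly_Mapping.keys i \<subseteq> A" "Poly_Mapping.keys j \<subseteq> A" using x y xe ye by auto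
    show "(?h x = ?h y) = (x = y)"
    proof
      assume e: "?h x = ?h y"
      have "Poly_Mapping.lookup (?h x) a = Poly_Mapping.lookup (?h y) a" using e by simp
      then have "b = c" using la[OF k(1)] la[OF k(2)] xe ye by (simp add: lookup_add)
      then show "x = y" using e xe ye by simp
    qed simp
  next
    fix x assume x: "x \<in> ?T"
    obtain b i where xe: "x = (b, i)" by force
    have k: "Poly_Mapping.keys i \<subseteq> A" "edeg i = k - b" "b \<le> k" using x xe by auto
    have sub: "Poly_Mapping.keys (?h x) \<subseteq> insert a A"
      using k(1) Poly_Mapping.keys_add[of "Poly_Mapping.single a b" i] xe
      by (auto split: if_splits)
    have "edeg (?h x) = (\<Sum>j\<in>insert a A. Poly_Mapping.lookup (?h x) j)"
      using sub insert.hyps by (intro edeg_superset) auto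
    also have "\<dots> = b + (\<Sum>j\<in>A. Poly_Mapping.lookup i j)"
      using insert.hyps la[OF k(1)] xe
      by (auto simp: lookup_add lookup_single when_def intro!: sum.cong)
    also have "(\<Sum>j\<in>A. Poly_Mapping.lookup i j) = k - b"
      using edeg_superset[of A i] insert.hyps k by simp
    finally show "?h x \<in> ?S (insert a A) k" using sub k by simp
  next
    fix i assume i: "i \<in> ?S (insert a A) k"
    let ?b = "Poly_Mapping.lookup i a"
    let ?i = "i - Poly_Mapping.single a ?b"
    have e: "i = Poly_Mapping.single a ?b + ?i"
      by (rule poly_mapping_eqI) (auto simp: lookup_add lookup_minus lookup_single when_def)
    have k: "Poly_Mapping.keys ?i \<subseteq> A"
    proof
      fix x assume x: "x \<in> Poly_Mapping.keys ?i"
      then have "x \<noteq> a" by (auto simp: in_keys_iff lookup_minus)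
      moreover from x have "x \<in> Poly_Mapping.keys i"
        by (auto simp: in_keys_iff lookup_minus)
      ultimately show "x \<in> A" using i by auto
    qed
    have "edeg i = (\<Sum>j\<in>insert a A. Poly_Mapping.lookup i j)"
      using i insert.hyps by (intro edeg_superset) auto
    also have "\<dots> = ?b + (\<Sum>j\<in>A. Poly_Mapping.lookup ?i j)"
      using insert.hyps by (auto simp: lookup_minus lookup_single when_def intro!: sum.cong)
    also have "\<dots> = ?b + edeg ?i" using edeg_superset[OF insert.hyps(1) k] by simp
    finally have "?b + edeg ?i = k" using i by simp
    then have "(?b, ?i) \<in> ?T" using k by auto
    then show "\<exists>x\<in>?T. i = ?h x" using e by (intro bexI[of _ "(?b, ?i)"]) auto
  qed
  have "coeff (\<Prod>j\<in>insert a A. p j) k = (\<Sum>b\<le>k. coeff (p a) b * coeff (\<Prod>j\<in>A. p j) (k - b))"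
    using insert.hyps by (simp add: coeff_mult)
  also have "\<dots> = (\<Sum>b\<le>k. \<Sum>i\<in>?S A (k - b).
      coeff (p a) b * (\<Prod>j\<in>A. coeff (p j) (Poly_Mapping.lookup i j)))"
    using insert.IH by (simp add: sum_distrib_left)
  also have "\<dots> = (\<Sum>(b, i)\<in>?T. coeff (p a) b * (\<Prod>j\<in>A. coeff (p j) (Poly_Mapping.lookup i j)))"
    using insert.IH by (subst sum.Sigma) auto
  also have "\<dots> = (\<Sum>x\<in>?T. \<Prod>j\<in>insert a A. coeff (p j) (Poly_Mapping.lookup (?h x) j))"
  proof (rule sum.cong[OF refl])
    fix x assume x: "x \<in> ?T"
    obtain b i where xe: "x = (b, i)" by force
    have k: "Poly_Mapping.lookup i a = 0" using la x xe by auto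
    have "(\<Prod>j\<in>A. coeff (p j) (Poly_Mapping.lookup i j)) =
        (\<Prod>j\<in>A. coeff (p j) (Poly_Mapping.lookup (?h x) j))"
      using insert.hyps xe by (intro prod.cong) (auto simp: lookup_add lookup_single when_def)
    then show "(case x of (b, i) \<Rightarrow> coeff (p a) b * (\<Prod>j\<in>A. coeff (p j) (Poly_Mapping.lookup i j))) =
        (\<Prod>j\<in>insert a A. coeff (p j) (Poly_Mapping.lookup (?h x) j))"
      using insert.hyps xe k by (simp add: lookup_add)
  qed
  also have "\<dots> = (\<Sum>i\<in>?S (insert a A) k. \<Prod>j\<in>insert a A. coeff (p j) (Poly_Mapping.lookup i j))"
    by (rule sum.reindex_bij_betw[OF bij])
  finally show ?case using fin bij bij_betw_finite by blast
qed

definition Sq_total :: "expo \<Rightarrow> mpol poly" where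
  "Sq_total m = (\<Prod>j\<in>Poly_Mapping.keys m. [:X j, X j ^ 2:] ^ Poly_Mapping.lookup m j)"

lemma coeff_Sq_factor:
  fixes x y :: "'a::comm_ring_1"
  assumes "y = x ^ 2"
  shows "coeff ([:x, y:] ^ a) i = of_nat (a choose i) * x ^ (a + i)"
proof (induction a arbitrary: i)
  case 0
  then show ?case by (cases i) auto
next
  case (Suc a)
  have "[:x, y:] ^ Suc a = smult x ([:x, y:] ^ a) + pCons 0 (smult y ([:x, y:] ^ a))"
    by simp
  then show ?case
    by (cases i; simp add: Suc.IH; simp add: assms algebra_simps power2_eq_square)
qed

lemma Sq_mono_eq: "Sq k (mon m) = coeff (Sq_total m) k"
  unfolding Sq_def Sq_total_def
  using coeff_prod_expand[of "Poly_Mapping.keys m"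
      k "\<lambda>j. [:X j, X j ^ 2:] ^ Poly_Mapping.lookup m j"]
  by (simp add: Sq_mono_def coeff_Sq_factor[OF refl])

lemma Sq_total_add: "Sq_total (m + m') = Sq_total m * Sq_total m'"
proof -
  let ?A = "Poly_Mapping.keys m \<union> Poly_Mapping.keys m'"
  have *: "Sq_total i = (\<Prod>j\<in>?A. [:X j, X j ^ 2:] ^ Poly_Mapping.lookup i j)"
    if "Poly_Mapping.keys i \<subseteq> ?A" for i
    unfolding Sq_total_def using that
    by (intro prod.mono_neutral_left) (auto simp: in_keys_iff)
  show ?thesis
    using *[of m] *[of m'] *[of "m + m'"] Poly_Mapping.keys_add[of m m']
    by (simp add: lookup_add power_add prod.distrib)
qed

lemma Sq_zero [simp]: "Sq k 0 = 0"
  by (simp add: Sq_def)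

lemma Sq_add: "Sq k (f + g) = Sq k f + Sq k g"
  by (simp add: Sq_def lin_ext_add)

lemma X_power: "X j ^ a = mon (Poly_Mapping.single j a)"
  by (induction a) (simp_all add: mult_single single_add[symmetric])

lemma Sq_X_power: "Sq i (X j ^ a) = of_nat (a choose i) * X j ^ (a + i)"
proof -
  have "Sq_total (Poly_Mapping.single j a) = [:X j, X j ^ 2:] ^ a"
    by (simp add: Sq_total_def)
  then show ?thesis
    by (simp only: X_power[of j a] Sq_mono_eq coeff_Sq_factor[OF refl])
qed

lemma Cartan: "Sq k (f * g) = (\<Sum>i\<le>k. Sq i f * Sq (k - i) g)"
proof (induction f rule: mpol_induct)
  case (add f m)
  have "Sq k (mon m * g) = (\<Sum>i\<le>k. Sq i (mon m) * Sq (k - i) g)"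
  proof (induction g rule: mpol_induct)
    case (add g m')
    have "Sq k (mon m * mon m') = (\<Sum>i\<le>k. Sq i (mon m) * Sq (k - i) (mon m'))"
      by (simp add: mult_single Sq_mono_eq Sq_total_add coeff_mult)
    with add show ?case by (simp add: distrib_left Sq_add sum.distrib)
  qed simp
  with add show ?case by (simp add: distrib_right Sq_add sum.distrib)
qed simp

text \<open>
  The sum of the images of \<open>Sq\<^sup>i\<close>, \<open>i > 0\<close>, in degree \<open>n\<close>. There are no nonzero polynomials of
  degree \<open>n - i\<close> for \<open>i > n\<close>, so the range stops at \<open>n\<close> (natural-number subtraction truncates).
\<close>

definition hits :: "nat \<Rightarrow> nat \<Rightarrow> mpol set" where
  "hits t n = {\<Sum>i=1..n. Sq i (g i) | g. \<forall>i\<in>{1..n}. g i \<in> Pol t (n - i)}"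

definition sim :: "nat \<Rightarrow> nat \<Rightarrow> mpol \<Rightarrow> mpol \<Rightarrow> bool" where
  "sim t n f g \<longleftrightarrow> f \<in> Pol t n \<and> g \<in> Pol t n \<and> f - g \<in> hits t n"

section \<open>Weight vectors and admissible monomials\<close>

definition digit :: "nat \<Rightarrow> nat \<Rightarrow> nat" where
  "digit j a = a div 2 ^ j mod 2"

text \<open>
  Weight vectors are indexed from 0 here: the value at \<open>i\<close> is the entry \<open>\<omega>\<^sub>i\<^sub>+\<^sub>1\<close>, which accounts
  for the factor \<open>2 ^ i\<close> in the degree.
\<close>

type_synonym weight = "nat \<Rightarrow> nat"

definition weight_vector :: "weight \<Rightarrow> bool" where
  "weight_vector \<omega> \<longleftrightarrow> finite {i. \<omega> i \<noteq> 0}"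

definition wdeg :: "weight \<Rightarrow> nat" where
  "wdeg \<omega> = (\<Sum>i | \<omega> i \<noteq> 0. 2 ^ i * \<omega> i)"

definition weight_of :: "expo \<Rightarrow> weight" where
  "weight_of m i = (\<Sum>j\<in>Poly_Mapping.keys m. digit i (Poly_Mapping.lookup m j))"

text \<open>
  Both \<open>less_fun\<close> and the order on the type of exponent vectors are left-lexicographic.
\<close>

definition mless :: "expo \<Rightarrow> expo \<Rightarrow> bool" where
  "mless x y \<longleftrightarrow> less_fun (weight_of x) (weight_of y) \<or> (weight_of x = weight_of y \<and> x < y)"

definition inadmissible :: "nat \<Rightarrow> nat \<Rightarrow> expo \<Rightarrow> bool" where
  "inadmissible t n x \<longleftrightarrow>
     (\<exists>ys. (\<forall>y\<in>set ys. y \<in> Exps t n \<and> mless y x) \<and> sim t n (mon x) (\<Sum>y\<leftarrow>ys. mon y))"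

definition Adm :: "nat \<Rightarrow> nat \<Rightarrow> mpol set" where
  "Adm t n = {mon x | x. x \<in> Exps t n \<and> \<not> inadmissible t n x}"

definition Adm_weight :: "nat \<Rightarrow> nat \<Rightarrow> weight \<Rightarrow> mpol set" where
  "Adm_weight t n \<omega> = {mon x | x. mon x \<in> Adm t n \<and> weight_of x = \<omega>}"

section \<open>The maps q and psi\<close>

definition skip :: "nat \<Rightarrow> nat \<Rightarrow> nat" where
  "skip l j = (if j < l then j else j + 1)"

definition qmap :: "nat \<Rightarrow> mpol \<Rightarrow> mpol" where
  "qmap l = lin_ext (\<lambda>m. \<Prod>j\<in>Poly_Mapping.keys m. X (skip l j) ^ Poly_Mapping.lookup m j)"

definition qexp :: "nat \<Rightarrow> expo \<Rightarrow> expo" where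
  "qexp l m = (\<Sum>j\<in>Poly_Mapping.keys m. Poly_Mapping.single (skip l j) (Poly_Mapping.lookup m j))"

lemma mon_sum: "mon (\<Sum>j\<in>A. e j) = (\<Prod>j\<in>A. mon (e j))"
proof (induction A rule: infinite_finite_induct)
  case (insert x A)
  then show ?case by (simp add: mult_single flip: insert.IH)
qed simp_all

lemma qmap_mon: "qmap l (mon m) = mon (qexp l m)"
  by (simp only: qmap_def qexp_def mon_sum X_power lin_ext_mon)

lemma qmap_add: "qmap l (f + g) = qmap l f + qmap l g"
  by (simp add: qmap_def lin_ext_add)

lemma qexp_add: "qexp l (m + m') = qexp l m + qexp l m'"
proof -
  let ?A = "Poly_Mapping.keys m \<union> Poly_Mapping.keys m'"
  have *: "qexp l i = (\<Sum>j\<in>?A. Poly_Mapping.single (skip l j) (Poly_Mapping.lookup i j))"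
    if "Poly_Mapping.keys i \<subseteq> ?A" for i
    unfolding qexp_def using that
    by (intro sum.mono_neutral_left) (auto simp: in_keys_iff)
  show ?thesis
    using *[of m] *[of m'] *[of "m + m'"] Poly_Mapping.keys_add[of m m']
    by (simp add: lookup_add single_add sum.distrib)
qed

lemma qmap_mult: "qmap l (f * g) = qmap l f * qmap l g"
proof (induction f rule: mpol_induct)
  case (add f m)
  have "qmap l (mon m * g) = qmap l (mon m) * qmap l g"
  proof (induction g rule: mpol_induct)
    case (add g m')
    then show ?case
      by (simp add: distrib_left qmap_add qmap_mon mult_single qexp_add)
  qed (simp add: qmap_def)
  with add show ?case by (simp add: distrib_right qmap_add)
qed (simp add: qmap_def)

lemma qmap_X: "qmap l (X j) = X (skip l j)"
  by (simp add: qmap_mon qexp_def)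

lemma lookup_qexp_skip:
  "Poly_Mapping.lookup (qexp l m) (skip l j) = Poly_Mapping.lookup m j"
proof -
  have "Poly_Mapping.lookup (qexp l m) (skip l j) =
      (\<Sum>i\<in>Poly_Mapping.keys m. Poly_Mapping.lookup m i when i = j)"
    unfolding qexp_def lookup_sum
    by (intro sum.cong) (auto simp: lookup_single when_def skip_def split: if_splits)
  then show ?thesis by (simp add: when_def sum.delta in_keys_iff)
qed

definition NN :: "nat \<Rightarrow> (nat \<times> nat list) set" where
  "NN t = {(l, L). sorted_wrt (<) (l # L) \<and> set (l # L) \<subseteq> {1..t}}"

text \<open>The list \<open>L\<close> is indexed from 0, so \<open>l\<^sub>u\<close> is \<open>ell L u\<close>.\<close>

definition ell :: "nat list \<Rightarrow> nat \<Rightarrow> nat" where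
  "ell L u = L ! (u - 1)"

definition xLu :: "nat list \<Rightarrow> nat \<Rightarrow> expo" where
  "xLu L u = (let r = length L in
     Poly_Mapping.single (ell L u) (\<Sum>d=1..u. 2 ^ (r - d))
       + (\<Sum>d\<in>{u<..r}. Poly_Mapping.single (ell L d) (2 ^ (r - d))))"

definition star :: "nat list \<Rightarrow> nat \<Rightarrow> expo \<Rightarrow> bool" where
  "star L u m \<longleftrightarrow> (let r = length L; a = Poly_Mapping.lookup m in
     1 \<le> u \<and> u \<le> r
     \<and> (\<forall>d\<in>{1..<u}. a (ell L d - 1) = 2 ^ r - 1)
     \<and> a (ell L u - 1) > 2 ^ r - 1
     \<and> (\<forall>d\<in>{1..u}. digit (r - d) (a (ell L u - 1)) = 1)
     \<and> (\<forall>d\<in>{u<..r}. digit (r - d) (a (ell L d - 1)) = 1))"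

lemma star_unique: "star L u m \<Longrightarrow> star L v m \<Longrightarrow> u = v"
  by (rule ccontr, cases "u < v") (fastforce simp: star_def Let_def)+

text \<open>
  Division of monomials is subtraction of exponent vectors; by \<open>psi_exact\<close> below the truncating
  subtraction is exact.
\<close>

definition psi_mono :: "nat \<Rightarrow> nat list \<Rightarrow> expo \<Rightarrow> mpol" where
  "psi_mono l L m =
     (if L = [] then qmap l (mon m)
      else if \<exists>u. star L u m then
        mon (Poly_Mapping.single l (2 ^ length L - 1) + qexp l m - xLu L (THE u. star L u m))
      else 0)"

definition psi :: "nat \<Rightarrow> nat list \<Rightarrow> mpol \<Rightarrow> mpol" where
  "psi l L = lin_ext (psi_mono l L)"

lemma psi_exact:
  assumes NN: "(l, L) \<in> NN t" and st: "star L u m"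
  shows "psi l L (mon m) * mon (xLu L u) = X l ^ (2 ^ length L - 1) * qmap l (mon m)"
proof -
  let ?r = "length L"
  let ?e = "Poly_Mapping.single l (2 ^ ?r - 1) + qexp l m"
  have u: "1 \<le> u" "u \<le> ?r" using st by (auto simp: star_def Let_def)
  have srt: "sorted_wrt (<) L" and gt: "\<And>x. x \<in> set L \<Longrightarrow> l < x"
    using NN by (auto simp: NN_def)
  have mem: "ell L d \<in> set L" if "1 \<le> d" "d \<le> ?r" for d
    using that by (auto simp: ell_def)
  have inj: "d = d'" if "1 \<le> d" "d \<le> ?r" "1 \<le> d'" "d' \<le> ?r" "ell L d = ell L d'" for d d'
  proof -
    have "distinct L" using srt by (simp add: strict_sorted_iff)
    then have "d - 1 = d' - 1"
      using that nth_eq_iff_index_eq[of L "d - 1" "d' - 1"] by (simp add: ell_def)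
    then show ?thesis using that by simp
  qed
  have q: "Poly_Mapping.lookup (qexp l m) (ell L d) = Poly_Mapping.lookup m (ell L d - 1)"
    if "1 \<le> d" "d \<le> ?r" for d
  proof -
    have "l < ell L d" using gt mem that by auto
    then have "skip l (ell L d - 1) = ell L d" by (auto simp: skip_def)
    then show ?thesis using lookup_qexp_skip[of l m "ell L d - 1"] by simp
  qed
  have dig: "2 ^ k \<le> a" if "digit k a = 1" for k a :: nat
    using that by (cases "a < 2 ^ k") (auto simp: digit_def)
  have geo: "(\<Sum>d=1..u. 2 ^ (?r - d)) \<le> (2 ^ ?r - 1 :: nat)"
  proof -
    have "(\<Sum>d=1..u. 2 ^ (?r - d)) \<le> (\<Sum>d=1..?r. 2 ^ (?r - d) :: nat)"
      using u by (intro sum_mono2) auto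
    also have "\<dots> = (\<Sum>i<?r. 2 ^ i)"
      by (rule sum.reindex_bij_witness[of _ "\<lambda>i. ?r - i" "\<lambda>d. ?r - d"]) auto
    also have "\<dots> = 2 ^ ?r - 1" by (induction ?r) (auto simp: sum_power2 lessThan_atLeast0)
    finally show ?thesis .
  qed
  have le: "Poly_Mapping.lookup (xLu L u) j \<le> Poly_Mapping.lookup ?e j" for j
  proof (cases "\<exists>d\<in>{u..?r}. j = ell L d")
    case False
    then have "Poly_Mapping.lookup (xLu L u) j = 0"
      using u by (auto simp: xLu_def Let_def lookup_add lookup_sum lookup_single when_def)
    then show ?thesis by simp
  next
    case True
    then obtain d where d: "u \<le> d" "d \<le> ?r" and j: "j = ell L d" by auto
    have s: "(\<Sum>c\<in>{u<..?r}. Poly_Mapping.lookup (Poly_Mapping.single (ell L c) (2 ^ (?r - c) :: nat)) j)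
        = (\<Sum>c\<in>{u<..?r}. if c = d then 2 ^ (?r - c) else 0)"
      using d u j inj by (intro sum.cong) (auto simp: lookup_single when_def)
    have qd: "Poly_Mapping.lookup (qexp l m) j = Poly_Mapping.lookup m (j - 1)"
      using q[of d] d u j by simp
    show ?thesis
    proof (cases "d = u")
      case True
      have "Poly_Mapping.lookup (xLu L u) j = (\<Sum>d=1..u. 2 ^ (?r - d))"
        using s True j by (simp add: xLu_def Let_def lookup_add lookup_sum)
      moreover have "2 ^ ?r - 1 < Poly_Mapping.lookup m (j - 1)"
        using st True j by (auto simp: star_def Let_def)
      ultimately show ?thesis using geo qd by (simp add: lookup_add)
    next
      case False
      then have ud: "u < d" using d by simp
      then have "ell L u \<noteq> j" using inj[of u d] u d j by auto
      then have "Poly_Mapping.lookup (xLu L u) j = 2 ^ (?r - d)"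
        using s ud d by (simp add: xLu_def Let_def lookup_add lookup_sum lookup_single)
      moreover have "2 ^ (?r - d) \<le> Poly_Mapping.lookup m (j - 1)"
        using st ud d j by (intro dig) (auto simp: star_def Let_def)
      ultimately show ?thesis using qd by (simp add: lookup_add)
    qed
  qed
  have "(THE u. star L u m) = u" using st star_unique by blast
  moreover have "L \<noteq> []" using u by auto
  ultimately have "psi l L (mon m) = mon (?e - xLu L u)"
    using st by (auto simp: psi_def psi_mono_def)
  moreover have "?e - xLu L u + xLu L u = ?e"
    using le by (intro poly_mapping_eqI) (simp add: lookup_add lookup_minus)
  ultimately show ?thesis by (simp only: mult_single qmap_mon X_power mult_1_right)
qed

definition Phi0 :: "nat \<Rightarrow> mpol set \<Rightarrow> mpol set" where
  "Phi0 t C = (\<Union>l\<in>{1..t}. qmap l ` C)"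

definition Phi_pos :: "nat \<Rightarrow> nat \<Rightarrow> mpol set \<Rightarrow> mpol set" where
  "Phi_pos t n C =
     (\<Union>(l, L)\<in>{(l, L) \<in> NN t. 1 \<le> length L \<and> length L \<le> t - 1}. psi l L ` C - Pol0 t n)"

definition Phi_star :: "nat \<Rightarrow> nat \<Rightarrow> mpol set \<Rightarrow> mpol set" where
  "Phi_star t n C = Phi0 t C \<union> Phi_pos t n C"

end

(* Every map psi followed by a suitable sum of linear substitutions P_5 -> P_4 (which all commute
   with the Steenrod squares) returns the monomial it started from, up to smaller monomials.

   Let M be the list of the positions in P_4 that correspond to L. Summing the substitutions
   X l |-> sum of J over all subsets J of M leaves only the surjective distributions of the binary
   digits of the exponent of X l onto M. For u = 1 this sum maps psi(x) to x and everything below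
   psi(x) below x, so psi(x) is admissible if x is. For u = 2 one adds the substitutions that send
   X l to the first position of M and distribute the exponent of X l_1 over the rest; the terms
   that could exceed x then cancel, except for some in which the exponent at the first position is
   too small.

   By the chi-trick, u * v^2 is hit for squarefree u with e factors and v of degree d, unless d + e
   is a sum of e powers of two. Hence P_4 has no admissible monomials of degree n if s > 0, and if
   s = 0 all exponents of an admissible monomial are odd, so that one can pass to degree 19 by
   Kameko's map. There the exceptional terms are removed by further substitutions. *)

theory Submission
  imports Defs "HOL-Library.FuncSet"
begin


text \<open>A power of a sum of variables expands over the binary digits of its exponent, and digits
  that meet on one variable produce a carry, which lowers the weight vector. Hence no term of an
  image exceeds the weight of its source; equal weight leaves only distributions without collision,
  compared by exponents. The divisor in psi is exactly the lexicographically largest surjective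
  distribution of the digits of \<open>2 ^ r - 1\<close> onto the last \<open>r - u + 1\<close>
  positions of M: psi takes it away and the substitutions give it back. For \<open>u = 2\<close> the
  exponent of x at the first position A of M is already \<open>2 ^ r - 1\<close>, so every digit
  sent to A collides and the sum used for \<open>u = 1\<close> loses x; hence the second family. Its
  exceptional terms come from monomials whose first difference from psi(x) is at \<open>l\<close>,
  so that nothing is known between \<open>l\<close> and A. The degree 42 = 4 + 2 * 19 disposes of
  the rest: \<open>u = 2\<close> with \<open>r = 4\<close>, and \<open>u \<ge> 3\<close>, do not
  occur for admissible x, either because 42 is too small or because the halved monomial has
  exponents 3, 3, 3, 2 modulo 4 in some order, which \<open>Sq 1\<close> rewrites.\<close>

abbreviation "lookup \<equiv> Poly_Mapping.lookup"
abbreviation "keys \<equiv> Poly_Mapping.keys"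
abbreviation "single \<equiv> Poly_Mapping.single"

section \<open>Polynomials modulo two\<close>

lemma mpol_add_self [simp]: "(f::mpol) + f = 0"
proof (rule poly_mapping_eqI)
  fix k
  have "(b::bit) + b = 0" for b by (cases b) auto
  then show "lookup (f + f) k = lookup 0 k" unfolding lookup_add lookup_zero .
qed

lemma mpol_two [simp]: "(2::mpol) = 0"
  unfolding one_add_one[symmetric] by (rule mpol_add_self)

lemma mpol_add_self_left [simp]: "(f::mpol) + (f + g) = g"
  by (simp add: add.assoc[symmetric])

lemma mpol_diff_eq_add: "(f::mpol) - g = f + g"
proof -
  have "f - g = f - g + (g + g)" by simp
  then show ?thesis by (simp only: add.assoc[symmetric] diff_add_cancel)
qed

lemma mpol_eq_sum_mon: "(f::mpol) = (\<Sum>m\<in>keys f. mon m)"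
proof (rule poly_mapping_eqI)
  fix k
  have "lookup (\<Sum>m\<in>keys f. mon m) k = (\<Sum>m\<in>keys f. if m = k then 1 else 0)"
    unfolding lookup_sum by (intro sum.cong) (auto simp: lookup_single when_def)
  also have "\<dots> = (if k \<in> keys f then 1 else 0)"
    by (simp add: sum.delta')
  also have "\<dots> = lookup f k"
    by (cases "lookup f k") (auto simp: in_keys_iff)
  finally show "lookup f k = lookup (\<Sum>m\<in>keys f. mon m) k" by simp
qed

lemma mpol_square_sum: "(\<Sum>i\<in>I. f i :: mpol)\<^sup>2 = (\<Sum>i\<in>I. (f i)\<^sup>2)"
  by (induction I rule: infinite_finite_induct)
    (simp_all add: power2_sum mult_2 distrib_right)

lemma mpol_square_add: "(f + g :: mpol)\<^sup>2 = f\<^sup>2 + g\<^sup>2"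
  by (simp add: power2_sum mult_2 distrib_right)

lemma of_nat_mpol: "(of_nat c :: mpol) = (if even c then 0 else 1)"
  by (induction c) auto

lemma of_nat_mult_mon: "of_nat c * mon m = single m (of_nat c)"
  by (cases "even c") (auto simp: of_nat_mpol elim!: evenE oddE)

lemma lookup_of_nat_mult_mon: "lookup (of_nat c * mon m) y = (if m = y then of_nat c else 0)"
  by (simp add: of_nat_mult_mon lookup_single when_def)

section \<open>Degrees\<close>

lemma edeg_zero [simp]: "edeg 0 = 0"
  by (simp add: edeg_def)

lemma edeg_add: "edeg (m + m') = edeg m + edeg m'"
proof -
  let ?A = "keys m \<union> keys m'"
  have "keys (m + m') \<subseteq> ?A" by (rule Poly_Mapping.keys_add)
  then show ?thesis
    by (simp add: edeg_superset[of ?A] lookup_add sum.distrib)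
qed

lemma edeg_single [simp]: "edeg (single j a) = a"
  by (simp add: edeg_def)

lemma edeg_sum: "edeg (\<Sum>i\<in>I. m i) = (\<Sum>i\<in>I. edeg (m i))"
  by (induction I rule: infinite_finite_induct) (simp_all add: edeg_add)

lemma keys_add_expo: "keys (m + m' :: expo) = keys m \<union> keys m'"
  by (auto simp: in_keys_iff lookup_add)

lemma Exps_add: "m \<in> Exps t a \<Longrightarrow> m' \<in> Exps t b \<Longrightarrow> m + m' \<in> Exps t (a + b)"
  by (simp add: Exps_def edeg_add keys_add_expo)

lemma Pol_zero [simp]: "0 \<in> Pol t n"
  by (simp add: Pol_def)

lemma Pol_mon [simp]: "mon m \<in> Pol t n \<longleftrightarrow> m \<in> Exps t n"
  by (simp add: Pol_def)

lemma Pol_add: "f \<in> Pol t n \<Longrightarrow> g \<in> Pol t n \<Longrightarrow> f + g \<in> Pol t n"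
  using Poly_Mapping.keys_add[of f g] by (auto simp: Pol_def)

lemma Pol_sum: "(\<And>i. i \<in> I \<Longrightarrow> f i \<in> Pol t n) \<Longrightarrow> (\<Sum>i\<in>I. f i) \<in> Pol t n"
  by (induction I rule: infinite_finite_induct) (simp_all add: Pol_add)

lemma Pol_mult: "f \<in> Pol t a \<Longrightarrow> g \<in> Pol t b \<Longrightarrow> f * g \<in> Pol t (a + b)"
  using Poly_Mapping.keys_mult[of f g] by (fastforce simp: Pol_def intro: Exps_add)

lemma Pol_one: "1 \<in> Pol t 0"
  using Pol_mon[of 0 t 0] by (simp add: Exps_def)

lemma Pol_power: "f \<in> Pol t a \<Longrightarrow> f ^ k \<in> Pol t (k * a)"
  by (induction k) (simp_all add: Pol_one Pol_mult)

lemma Pol_prod: "(\<And>i. i \<in> I \<Longrightarrow> f i \<in> Pol t (a i)) \<Longrightarrow> (\<Prod>i\<in>I. f i) \<in> Pol t (\<Sum>i\<in>I. a i)"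
  by (induction I rule: infinite_finite_induct) (simp_all add: Pol_one Pol_mult)

section \<open>Coefficients of Steenrod squares\<close>

lemma finite_edeg: "finite A \<Longrightarrow> finite {i. keys i \<subseteq> A \<and> edeg i = k}"
  using coeff_prod_expand[of A k "\<lambda>_. 0 :: nat poly"] by blast

lemma mon_eq_prod:
  assumes "finite A" "keys m \<subseteq> A"
  shows "mon m = (\<Prod>j\<in>A. X j ^ lookup m j)"
proof -
  have "m = (\<Sum>j\<in>A. single j (lookup m j))"
  proof (rule poly_mapping_eqI)
    fix k
    show "lookup m k = lookup (\<Sum>j\<in>A. single j (lookup m j)) k"
      using assms by (auto simp: lookup_sum lookup_single when_def in_keys_iff)
  qed
  then show ?thesis by (metis (no_types, lifting) X_power mon_sum prod.cong)
qed

lemma Sq_mon: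
  "Sq k (mon m) = (\<Sum>i\<in>{i. keys i \<subseteq> keys m \<and> edeg i = k}.
     of_nat (\<Prod>j\<in>keys m. lookup m j choose lookup i j) * mon (m + i))"
proof -
  have "(\<Prod>j\<in>keys m. of_nat (lookup m j choose lookup i j) * X j ^ (lookup m j + lookup i j)) =
      of_nat (\<Prod>j\<in>keys m. lookup m j choose lookup i j) * mon (m + i)"
    if "keys i \<subseteq> keys m" for i
    using mon_eq_prod[of "keys m" "m + i"] that
    by (simp add: prod.distrib keys_add_expo lookup_add)
  then show ?thesis by (simp add: Sq_def Sq_mono_def)
qed

text \<open>Only the summand with \<open>i = y - m\<close> can produce \<open>y\<close>. The finite
  set \<open>A\<close> may be any common superset of the supports, so that products for monomials
  with different supports can be compared factor by factor.\<close>

lemma lookup_Sq_mon: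
  assumes A: "finite A" "keys m \<subseteq> A" "keys y \<subseteq> A"
  shows "lookup (Sq k (mon m)) y =
    (if (\<forall>j\<in>A. lookup m j \<le> lookup y j) \<and> edeg y = edeg m + k
     then of_nat (\<Prod>j\<in>A. lookup m j choose (lookup y j - lookup m j)) else 0)"
proof -
  let ?I = "{i. keys i \<subseteq> keys m \<and> edeg i = k}"
  let ?c = "\<lambda>i. of_nat (\<Prod>j\<in>keys m. lookup m j choose lookup i j) :: bit"
  have L: "lookup (Sq k (mon m)) y = (\<Sum>i\<in>?I. if m + i = y then ?c i else 0)"
    by (simp only: Sq_mon lookup_sum lookup_of_nat_mult_mon)
  have fin: "finite ?I" by (rule finite_edeg) simp
  show ?thesis
  proof (cases "(\<forall>j\<in>A. lookup m j \<le> lookup y j) \<and> edeg y = edeg m + k")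
    case False
    have "m + i \<noteq> y" if "i \<in> ?I" for i
      using False that by (auto simp: lookup_add edeg_add)
    then have "lookup (Sq k (mon m)) y = 0" unfolding L by (intro sum.neutral) auto
    then show ?thesis by (simp only: if_not_P[OF False])
  next
    case True
    define i where "i = y - m"
    have li: "lookup i j = lookup y j - lookup m j" for j by (simp add: i_def lookup_minus)
    have y: "m + i = y"
    proof (rule poly_mapping_eqI)
      fix j
      have "lookup m j = 0 \<and> lookup y j = 0" if "j \<notin> A"
        using A that by (meson in_keys_iff subsetD)
      then show "lookup (m + i) j = lookup y j"
        using True by (cases "j \<in> A") (auto simp: lookup_add li)
    qed
    have e: "edeg i = k" using True y edeg_add[of m i] by simp
    have uniq: "(m + i' = y) = (i' = i)" for i' using y by (metis add_left_cancel)
    show ?thesis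
    proof (cases "keys i \<subseteq> keys m")
      case True': True
      then have c: "lookup (Sq k (mon m)) y = ?c i"
        unfolding L uniq using fin e by (simp add: sum.delta)
      have "lookup i j = 0" if "lookup m j = 0" for j
        using True' that by (metis in_keys_iff subsetD)
      then have "(\<Prod>j\<in>keys m. lookup m j choose lookup i j) =
          (\<Prod>j\<in>A. lookup m j choose lookup i j)"
        using A by (intro prod.mono_neutral_left) (auto simp: in_keys_iff)
      then show ?thesis using True c by (simp add: li del: of_nat_prod)
    next
      case False
      then obtain j where j: "j \<in> keys i" "j \<notin> keys m" by auto
      then have "lookup m j = 0" "lookup i j > 0" by (auto simp: in_keys_iff)
      moreover have "j \<in> A" using j A(3) y keys_add_expo[of m i] by auto
      ultimately have "(\<Prod>j\<in>A. lookup m j choose lookup i j) = 0"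
        using A by (intro prod_zero) (auto intro!: bexI[of _ j])
      moreover have "lookup (Sq k (mon m)) y = 0" unfolding L uniq using False fin by (simp add: sum.delta)
      ultimately show ?thesis by (simp add: li)
    qed
  qed
qed

lemma keys_Sq_mon: "y \<in> keys (Sq k (mon m)) \<Longrightarrow> keys y = keys m \<and> edeg y = edeg m + k"
proof -
  assume "y \<in> keys (Sq k (mon m))"
  moreover have "keys (of_nat c * mon z :: mpol) \<subseteq> {z}" for c z
    by (auto simp: of_nat_mult_mon)
  ultimately show ?thesis
    unfolding Sq_mon using Poly_Mapping.keys_sum[of "\<lambda>i. of_nat (\<Prod>j\<in>keys m. lookup m j choose lookup i j) * mon (m + i)"
       "{i. keys i \<subseteq> keys m \<and> edeg i = k}"]
    by (fastforce simp: keys_add_expo edeg_add)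
qed

lemma Sq_sum: "Sq k (\<Sum>i\<in>I. f i) = (\<Sum>i\<in>I. Sq k (f i))"
  by (induction I rule: infinite_finite_induct) (simp_all add: Sq_add)

lemma Sq_Pol: "f \<in> Pol t n \<Longrightarrow> Sq k f \<in> Pol t (n + k)"
proof -
  assume f: "f \<in> Pol t n"
  have "Sq k (mon m) \<in> Pol t (n + k)" if "m \<in> keys f" for m
    using f that keys_Sq_mon[of _ k m] unfolding Pol_def Exps_def by blast
  then show ?thesis by (subst mpol_eq_sum_mon) (simp add: Sq_sum Pol_sum)
qed

text \<open>In the Cartan formula the terms for \<open>i\<close> and for its complement are equal
  and cancel modulo two; only the middle term survives, which exists in even degree alone.\<close>

lemma Sq_square_odd: "odd k \<Longrightarrow> Sq k (f\<^sup>2) = 0"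
  and Sq_square_even: "Sq (2 * k) (f\<^sup>2) = (Sq k f)\<^sup>2"
proof -
  have sym: "(\<Sum>i<m. Sq i f * Sq (k - i) f) + (\<Sum>i\<in>{k-m<..k}. Sq i f * Sq (k - i) f) = 0"
    if "m \<le> k" for k m
  proof -
    have "(\<Sum>i\<in>{k-m<..k}. Sq i f * Sq (k - i) f) = (\<Sum>i<m. Sq i f * Sq (k - i) f)"
      using that by (intro sum.reindex_bij_witness[of _ "\<lambda>i. k - i" "\<lambda>i. k - i"]) (auto simp: mult.commute)
    then show ?thesis by simp
  qed
  show "Sq k (f\<^sup>2) = 0" if "odd k"
  proof -
    obtain b where k: "k = 2 * b + 1" using \<open>odd k\<close> by (elim oddE)
    have "{..k} = {..<b+1} \<union> {k-(b+1)<..k}" using k by auto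
    then have "Sq k (f\<^sup>2) = (\<Sum>i<b+1. Sq i f * Sq (k - i) f) + (\<Sum>i\<in>{k-(b+1)<..k}. Sq i f * Sq (k - i) f)"
      using k by (simp add: power2_eq_square Cartan) (subst sum.union_disjoint, auto)
    then show ?thesis using sym[of "b+1" k] k by simp
  qed
  have "{..2*k} = insert k ({..<k} \<union> {2*k-k<..2*k})" by auto
  then have "Sq (2*k) (f\<^sup>2) = Sq k f * Sq k f + ((\<Sum>i<k. Sq i f * Sq (2*k - i) f) + (\<Sum>i\<in>{2*k-k<..2*k}. Sq i f * Sq (2*k - i) f))"
    by (simp add: power2_eq_square Cartan) (subst sum.union_disjoint, auto)
  then show "Sq (2 * k) (f\<^sup>2) = (Sq k f)\<^sup>2"
    using sym[of k "2*k"] by (simp add: power2_eq_square)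
qed

lemma Sq_X: "Sq k (X j) = (if k = 0 then X j else if k = 1 then (X j)\<^sup>2 else 0)"
  using Sq_X_power[of k j 1] by (auto simp: binomial_eq_0 power2_eq_square simp del: One_nat_def)

lemma Sq_one: "Sq k 1 = (if k = 0 then 1 else 0)"
proof -
  have "Sq k (mon 0) = coeff 1 k" by (simp only: Sq_mono_eq Sq_total_def) simp
  then show ?thesis by simp
qed

lemma Sq_0: "Sq 0 f = f"
proof -
  have "Sq 0 (mon m) = mon m" for m
  proof -
    have "{i::expo. keys i \<subseteq> keys m \<and> edeg i = 0} = {0}"
      by (auto simp: edeg_def in_keys_iff intro!: poly_mapping_eqI)
    then show ?thesis by (simp add: Sq_mon)
  qed
  then show ?thesis by (subst (1 2) mpol_eq_sum_mon) (simp add: Sq_sum)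
qed

text \<open>Since \<open>a choose i\<close> vanishes for \<open>i > a\<close>, a square at most
  doubles each exponent, and in degree \<open>d\<close> the total degree forces all of them to be
  doubled.\<close>

lemma Sq_top:
  assumes "m \<in> Exps t d" shows "Sq d (mon m) = (mon m)\<^sup>2"
proof (rule poly_mapping_eqI)
  fix y :: expo
  have sq: "(mon m)\<^sup>2 = mon (m + m)" by (simp add: power2_eq_square mult_single)
  let ?A = "keys m \<union> keys y"
  show "lookup (Sq d (mon m)) y = lookup ((mon m)\<^sup>2) y"
  proof (cases "y = m + m")
    case True
    then show ?thesis using assms
      by (subst lookup_Sq_mon[of ?A]) (auto simp: Exps_def sq lookup_add edeg_add)
  next
    case False
    have *: "(\<Prod>j\<in>?A. lookup m j choose (lookup y j - lookup m j)) = 0"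
      if le: "\<forall>j\<in>?A. lookup m j \<le> lookup y j" and e: "edeg y = edeg m + d"
    proof -
      have "\<exists>j\<in>?A. lookup y j > 2 * lookup m j"
      proof (rule ccontr)
        assume "\<not> ?thesis"
        then have le2: "\<And>j. j \<in> ?A \<Longrightarrow> lookup y j \<le> 2 * lookup m j" by force
        have "(\<Sum>j\<in>?A. lookup y j) = (\<Sum>j\<in>?A. 2 * lookup m j)"
          using e assms edeg_superset[of ?A y] edeg_superset[of ?A m]
          by (simp add: Exps_def sum_distrib_left[symmetric])
        then have "\<forall>j\<in>?A. lookup y j = 2 * lookup m j"
          using le2 by (metis (no_types, lifting) finite_Un finite_keys sum_mono_inv)
        then have "y = m + m"
          by (intro poly_mapping_eqI) (metis UnI1 UnI2 in_keys_iff lookup_add mult_2 mult_0_right)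
        then show False using False by simp
      qed
      then obtain j where "j \<in> ?A" "lookup y j > 2 * lookup m j" by auto
      then show ?thesis by (intro prod_zero) (auto intro!: bexI[of _ j] simp: binomial_eq_0)
    qed
    have "lookup (Sq d (mon m)) y = 0"
      using lookup_Sq_mon[of ?A m y d] * by (metis (no_types, lifting) Un_upper1 Un_upper2 finite_Un finite_keys of_nat_0)
    then show ?thesis using False by (simp add: sq lookup_single when_def)
  qed
qed

section \<open>Hit polynomials and admissibility\<close>

lemma hitsI: "1 \<le> i \<Longrightarrow> g \<in> Pol t m \<Longrightarrow> m + i = n \<Longrightarrow> Sq i g \<in> hits t n"
proof -
  assume a: "1 \<le> i" "g \<in> Pol t m" "m + i = n"
  have "(\<Sum>j=1..n. Sq j (if j = i then g else 0)) = (\<Sum>j=1..n. if j = i then Sq i g else 0)"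
    by (intro sum.cong) auto
  also have "\<dots> = Sq i g" using a by (simp add: sum.delta)
  finally show ?thesis using a unfolding hits_def
    by (intro CollectI exI[of _ "\<lambda>j. if j = i then g else 0"]) auto
qed

lemma hits_zero [simp]: "0 \<in> hits t n"
  unfolding hits_def by (intro CollectI exI[of _ "\<lambda>_. 0"]) simp

lemma hits_add: "f \<in> hits t n \<Longrightarrow> g \<in> hits t n \<Longrightarrow> f + g \<in> hits t n"
proof -
  assume "f \<in> hits t n" "g \<in> hits t n"
  then obtain a b where "f = (\<Sum>i=1..n. Sq i (a i))" "g = (\<Sum>i=1..n. Sq i (b i))"
    "\<forall>i\<in>{1..n}. a i \<in> Pol t (n - i)" "\<forall>i\<in>{1..n}. b i \<in> Pol t (n - i)"
    unfolding hits_def by auto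
  then show ?thesis unfolding hits_def
    by (intro CollectI exI[of _ "\<lambda>i. a i + b i"]) (simp add: Sq_add sum.distrib Pol_add)
qed

lemma hits_sum: "(\<And>i. i \<in> I \<Longrightarrow> f i \<in> hits t n) \<Longrightarrow> (\<Sum>i\<in>I. f i) \<in> hits t n"
  by (induction I rule: infinite_finite_induct) (simp_all add: hits_add)

text \<open>The error terms allowed in a relation that shows \<open>x\<close> inadmissible. As a
  subspace it replaces the lists of monomials in \<open>inadmissible\<close>.\<close>

definition low :: "nat \<Rightarrow> nat \<Rightarrow> expo \<Rightarrow> mpol set" where
  "low t n x = {f \<in> Pol t n. \<forall>y\<in>keys f. mless y x}"

lemma low_zero [simp]: "0 \<in> low t n x"
  by (simp add: low_def)

lemma low_mon [simp]: "mon y \<in> low t n x \<longleftrightarrow> y \<in> Exps t n \<and> mless y x"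
  by (auto simp: low_def)

lemma low_add: "f \<in> low t n x \<Longrightarrow> g \<in> low t n x \<Longrightarrow> f + g \<in> low t n x"
  using Poly_Mapping.keys_add[of f g] by (auto simp: low_def Pol_add)

lemma low_sum: "(\<And>i. i \<in> I \<Longrightarrow> f i \<in> low t n x) \<Longrightarrow> (\<Sum>i\<in>I. f i) \<in> low t n x"
  by (induction I rule: infinite_finite_induct) (simp_all add: low_add)

lemma inadmissible_iff:
  assumes "x \<in> Exps t n"
  shows "inadmissible t n x \<longleftrightarrow> (\<exists>f\<in>low t n x. mon x + f \<in> hits t n)"
proof
  assume "inadmissible t n x"
  then obtain ys where ys: "\<forall>y\<in>set ys. y \<in> Exps t n \<and> mless y x"
    "sim t n (mon x) (\<Sum>y\<leftarrow>ys. mon y)"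
    by (auto simp: inadmissible_def)
  from ys(1) have "(\<Sum>y\<leftarrow>ys. mon y) \<in> low t n x"
    by (induction ys) (auto intro!: low_add)
  then show "\<exists>f\<in>low t n x. mon x + f \<in> hits t n"
    using ys(2) by (auto simp: sim_def mpol_diff_eq_add)
next
  assume "\<exists>f\<in>low t n x. mon x + f \<in> hits t n"
  then obtain f where f: "f \<in> low t n x" "mon x + f \<in> hits t n" by auto
  obtain ys where ys: "set ys = keys f" "distinct ys"
    using finite_distinct_list[of "keys f"] by auto
  have "(\<Sum>y\<leftarrow>ys. mon y) = f"
    using ys by (subst (2) mpol_eq_sum_mon) (simp add: sum_list_distinct_conv_sum_set)
  then show "inadmissible t n x" unfolding inadmissible_def sim_def
    using f ys assms by (intro exI[of _ ys]) (auto simp: low_def Pol_def mpol_diff_eq_add)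
qed

text \<open>A relation that makes \<open>z\<close> inadmissible would be mapped by \<open>T\<close>
  to one that makes \<open>x\<close> inadmissible. \<open>T\<close> is merely additive because it
  will be a sum of substitutions, partly followed by Kameko's map.\<close>

lemma admissible_transfer:
  assumes add: "\<And>f g. T (f + g) = T f + (T g :: mpol)"
    and hits: "\<And>f. f \<in> hits t n \<Longrightarrow> T f \<in> hits t' n'"
    and z: "z \<in> Exps t n" and x: "x \<in> Exps t' n'" "\<not> inadmissible t' n' x"
    and lead: "T (mon z) + mon x \<in> low t' n' x"
    and less: "\<And>y. y \<in> Exps t n \<Longrightarrow> mless y z \<Longrightarrow> T (mon y) \<in> low t' n' x"
  shows "\<not> inadmissible t n z"
proof
  assume "inadmissible t n z"
  then obtain f where f: "f \<in> low t n z" "mon z + f \<in> hits t n"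
    using inadmissible_iff[OF z] by auto
  have T0: "T 0 = 0" using add[of 0 0] by simp
  have Tsum: "T (\<Sum>i\<in>I. g i) = (\<Sum>i\<in>I. T (g i))" for g :: "expo \<Rightarrow> mpol" and I
    by (induction I rule: infinite_finite_induct) (simp_all add: T0 add)
  have "T f = (\<Sum>m\<in>keys f. T (mon m))" by (subst mpol_eq_sum_mon) (simp add: Tsum)
  moreover have "T (mon m) \<in> low t' n' x" if "m \<in> keys f" for m
    using f(1) that less[of m] by (auto simp: low_def Pol_def)
  ultimately have "T f \<in> low t' n' x" by (simp add: low_sum)
  then have "T (mon z) + mon x + T f \<in> low t' n' x" using lead by (rule low_add[rotated])
  moreover have "mon x + (T (mon z) + mon x + T f) \<in> hits t' n'"
    using hits[OF f(2)] by (simp add: add ac_simps)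
  ultimately show False using x inadmissible_iff[OF x(1)] by blast
qed

section \<open>Homomorphisms commuting with the Steenrod squares\<close>

text \<open>Additive instead of multiplicative, so that the notion is closed under sums of
  substitutions.\<close>

definition steenrod_hom :: "nat \<Rightarrow> nat \<Rightarrow> (mpol \<Rightarrow> mpol) \<Rightarrow> bool" where
  "steenrod_hom t t' T \<longleftrightarrow> (\<forall>f g. T (f + g) = T f + T g) \<and> (\<forall>k f. T (Sq k f) = Sq k (T f)) \<and>
     (\<forall>n. \<forall>f\<in>Pol t n. T f \<in> Pol t' n)"

lemma steenrod_hom_add: "steenrod_hom t t' S \<Longrightarrow> steenrod_hom t t' T \<Longrightarrow> steenrod_hom t t' (\<lambda>f. S f + T f)"
  by (auto simp: steenrod_hom_def Sq_add Pol_add algebra_simps)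

lemma steenrod_hom_sum:
  "(\<And>i. i \<in> I \<Longrightarrow> steenrod_hom t t' (T i)) \<Longrightarrow> steenrod_hom t t' (\<lambda>f. \<Sum>i\<in>I. T i f)"
  by (auto simp: steenrod_hom_def Sq_sum Pol_sum sum.distrib)

lemma steenrod_hom_hits:
  assumes T: "steenrod_hom t t' T" and f: "f \<in> hits t n" shows "T f \<in> hits t' n"
proof -
  obtain g where g: "f = (\<Sum>i=1..n. Sq i (g i))" "\<forall>i\<in>{1..n}. g i \<in> Pol t (n - i)"
    using f by (auto simp: hits_def)
  have "T (h + h') = T h + T h'" for h h' using T by (simp add: steenrod_hom_def)
  moreover from this[of 0 0] have "T 0 = 0" by simp
  ultimately have "T (\<Sum>i\<in>I. h i) = (\<Sum>i\<in>I. T (h i))" for h :: "nat \<Rightarrow> mpol" and I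
    by (induction I rule: infinite_finite_induct) simp_all
  then show ?thesis using g T unfolding hits_def steenrod_hom_def
    by (intro CollectI exI[of _ "\<lambda>i. T (g i)"]) auto
qed

definition lsub :: "(nat \<Rightarrow> nat set) \<Rightarrow> mpol \<Rightarrow> mpol" where
  "lsub B = lin_ext (\<lambda>m. \<Prod>j\<in>keys m. (\<Sum>i\<in>B j. X i) ^ lookup m j)"

lemma lsub_add: "lsub B (f + g) = lsub B f + lsub B g"
  by (simp add: lsub_def lin_ext_add)

lemma lsub_mon:
  assumes "finite A" "keys m \<subseteq> A"
  shows "lsub B (mon m) = (\<Prod>j\<in>A. (\<Sum>i\<in>B j. X i) ^ lookup m j)"
  unfolding lsub_def lin_ext_mon using assms
  by (intro prod.mono_neutral_left) (auto simp: in_keys_iff)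

lemma lsub_mult: "lsub B (f * g) = lsub B f * lsub B g"
proof (induction f rule: mpol_induct)
  case (add f m)
  have "lsub B (mon m * g) = lsub B (mon m) * lsub B g"
  proof (induction g rule: mpol_induct)
    case (add g m')
    have "lsub B (mon (m + m')) = lsub B (mon m) * lsub B (mon m')"
      by (subst (1 2 3) lsub_mon[of "keys m \<union> keys m'"])
        (simp_all add: keys_add_expo lookup_add power_add prod.distrib)
    then show ?case using add by (simp add: distrib_left lsub_add mult_single)
  qed (simp add: lsub_def)
  with add show ?case by (simp add: distrib_right lsub_add)
qed (simp add: lsub_def)

lemma lsub_X: "lsub B (X j) = (\<Sum>i\<in>B j. X i)"
  by (simp add: lsub_def)

text \<open>The polynomials on which both sides agree for every \<open>k\<close> are closed under
  sums and, by the Cartan formula, under products. So it suffices to look at variables, where the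
  additivity of squaring modulo two gives the claim.\<close>

lemma lsub_Sq: "lsub B (Sq k f) = Sq k (lsub B f)"
proof -
  define C where "C f \<longleftrightarrow> (\<forall>k. lsub B (Sq k f) = Sq k (lsub B f))" for f
  have l0: "lsub B 0 = 0" by (simp add: lsub_def)
  have lsum: "lsub B (\<Sum>i\<in>I. g i) = (\<Sum>i\<in>I. lsub B (g i))" for g :: "nat \<Rightarrow> mpol" and I
    by (induction I rule: infinite_finite_induct) (simp_all add: l0 lsub_add)
  have l1: "lsub B 1 = 1" using lsub_mon[of "{}" 0] by simp
  have CX: "C (X j)" for j
  proof -
    have "Sq k (\<Sum>i\<in>B j. X i) = (if k = 0 then (\<Sum>i\<in>B j. X i) else if k = 1 then (\<Sum>i\<in>B j. X i)\<^sup>2 else 0)" for k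
      unfolding Sq_sum Sq_X mpol_square_sum by simp
    then show ?thesis
      by (simp only: C_def Sq_X lsub_X power2_eq_square lsub_mult l0 if_distrib[of "lsub B"] simp_thms)
  qed
  have Cmult: "C (f * g)" if "C f" "C g" for f g
    using that by (simp add: C_def Cartan lsum lsub_mult)
  have C1: "C 1" by (simp add: C_def Sq_one l0 l1)
  have Cpow: "C (f ^ a)" if "C f" for f a
    by (induction a) (simp_all add: C1 Cmult that)
  have Cprod: "C (\<Prod>i\<in>I. g i)" if "\<And>i. C (g i)" for g :: "nat \<Rightarrow> mpol" and I
    by (induction I rule: infinite_finite_induct) (simp_all add: C1 Cmult that)
  have "C (mon m)" for m
    unfolding mon_eq_prod[OF finite_keys order_refl, of m] by (intro Cprod Cpow CX)
  moreover have "C (f + g)" if "C f" "C g" for f g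
    using that by (simp add: C_def Sq_add lsub_add)
  moreover have "C 0" by (simp add: C_def l0)
  ultimately have "C f" by (induction f rule: mpol_induct) auto
  then show ?thesis by (simp add: C_def)
qed

lemma lsub_Pol:
  assumes B: "\<And>j. j \<in> {1..t} \<Longrightarrow> B j \<subseteq> {1..t'}" and f: "f \<in> Pol t n"
  shows "lsub B f \<in> Pol t' n"
proof -
  have X: "X i \<in> Pol t' 1" if "i \<in> {1..t'}" for i using that by (simp add: Exps_def)
  have m: "lsub B (mon m) \<in> Pol t' n" if "m \<in> keys f" for m
  proof -
    have k: "keys m \<subseteq> {1..t}" "edeg m = n" using f that by (auto simp: Pol_def Exps_def)
    have "(\<Prod>j\<in>keys m. (\<Sum>i\<in>B j. X i) ^ lookup m j) \<in> Pol t' (\<Sum>j\<in>keys m. lookup m j * 1)"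
      using k B by (intro Pol_prod Pol_power Pol_sum X) blast
    then show ?thesis using k by (simp add: lsub_mon[of "keys m"] edeg_def)
  qed
  have "lsub B (\<Sum>i\<in>I. g i) = (\<Sum>i\<in>I. lsub B (g i))" for g :: "expo \<Rightarrow> mpol" and I
    by (induction I rule: infinite_finite_induct) (simp_all add: lsub_def lin_ext_add)
  then have "lsub B f = (\<Sum>m\<in>keys f. lsub B (mon m))"
    by (subst mpol_eq_sum_mon) simp
  then show ?thesis using m by (simp add: Pol_sum)
qed

lemma steenrod_hom_lsub: "(\<And>j. j \<in> {1..t} \<Longrightarrow> B j \<subseteq> {1..t'}) \<Longrightarrow> steenrod_hom t t' (lsub B)"
  unfolding steenrod_hom_def using lsub_add lsub_Sq lsub_Pol by blast

section \<open>Binary digits and weights\<close>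

lemma digit_bit: "digit i a = of_bool (bit a i)"
  by (simp add: digit_def bit_iff_odd mod2_eq_if)

definition dig :: "nat \<Rightarrow> nat set" where
  "dig a = {i. bit a i}"

lemma finite_dig [simp]: "finite (dig a)"
proof (rule finite_subset)
  show "dig a \<subseteq> {..<a}"
  proof
    fix i assume "i \<in> dig a"
    then have "a div 2 ^ i \<noteq> 0" by (auto simp: dig_def bit_iff_odd intro: odd_pos)
    then have "2 ^ i \<le> a" by (simp add: div_eq_0_iff)
    then show "i \<in> {..<a}" by (metis less_exp less_le_trans lessThan_iff)
  qed
qed simp

lemma dig_zero [simp]: "dig 0 = {}"
  by (simp add: dig_def)

lemma dig_eq_iff: "dig a = dig b \<longleftrightarrow> a = b"
  unfolding dig_def set_eq_iff by (auto intro: bit_eqI)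

lemma dig_mask: "dig (2 ^ r - 1) = {..<r}"
  unfolding mask_eq_exp_minus_1[symmetric] by (auto simp: dig_def bit_mask_iff possible_bit_def)

lemma dig_add_disjoint:
  assumes "dig a \<inter> dig b = {}"
  shows "dig (a + b) = dig a \<union> dig b"
proof -
  have "and a b = 0" using assms by (intro bit_eqI) (auto simp: dig_def bit_and_iff)
  then show ?thesis by (auto simp: dig_def disjunctive_add_eq_or bit_or_iff)
qed

lemma dig_sum_power: "finite I \<Longrightarrow> dig (\<Sum>i\<in>I. 2 ^ i) = I"
proof (induction I rule: finite_induct)
  case (insert x I)
  have "dig (2 ^ x) = {x}" by (auto simp: dig_def bit_exp_iff possible_bit_def)
  then show ?case using insert by (simp add: dig_add_disjoint)
qed simp

lemma sum_dig: "(\<Sum>i\<in>dig a. 2 ^ i) = a"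
proof -
  have "dig (\<Sum>i\<in>dig a. 2 ^ i) = dig a" by (simp add: dig_sum_power)
  then show ?thesis by (simp add: dig_eq_iff)
qed

lemma dig_power: "dig (2 ^ i) = {i}"
  using dig_sum_power[of "{i}"] by simp

text \<open>The share of a single exponent in the weight vector. It is stored as a finitely
  supported function because that type has a lexicographic order compatible with addition, so that
  weights can be added and cancelled in inequalities.\<close>

definition dgv :: "nat \<Rightarrow> nat \<Rightarrow>\<^sub>0 nat" where
  "dgv a = (\<Sum>i\<in>dig a. single i 1)"

lemma lookup_dgv: "lookup (dgv a) i = digit i a"
  unfolding dgv_def lookup_sum
  using finite_dig[of a] by (simp add: lookup_single when_def digit_bit sum.delta) (simp add: dig_def)

definition wt :: "expo \<Rightarrow> nat \<Rightarrow>\<^sub>0 nat" where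
  "wt m = (\<Sum>j\<in>keys m. dgv (lookup m j))"

lemma dgv_zero [simp]: "dgv 0 = 0"
  by (simp add: dgv_def)

lemma wt_superset: "finite A \<Longrightarrow> keys m \<subseteq> A \<Longrightarrow> wt m = (\<Sum>j\<in>A. dgv (lookup m j))"
  unfolding wt_def by (intro sum.mono_neutral_left) (auto simp: in_keys_iff)

lemma lookup_wt: "lookup (wt m) i = weight_of m i"
  by (simp add: wt_def weight_of_def lookup_sum lookup_dgv)

lemma weight_of_eq_iff: "weight_of m = weight_of m' \<longleftrightarrow> wt m = wt m'"
  by (metis (no_types, lifting) ext lookup_wt poly_mapping_eqI)

lemma mless_iff: "mless x y \<longleftrightarrow> wt x < wt y \<or> wt x = wt y \<and> x < y"
proof -
  have "lookup (wt m) = weight_of m" for m by (simp add: fun_eq_iff lookup_wt)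
  then show ?thesis unfolding mless_def less_poly_mapping.rep_eq weight_of_eq_iff by simp
qed

lemma less_expoI: "lookup x k < lookup y k \<Longrightarrow> (\<And>j. j < k \<Longrightarrow> lookup x j = lookup y j) \<Longrightarrow> (x::nat \<Rightarrow>\<^sub>0 nat) < y"
  by (auto simp: less_poly_mapping.rep_eq less_fun_def)

lemma less_expoE:
  assumes "(x::nat \<Rightarrow>\<^sub>0 nat) < y"
  obtains k where "lookup x k < lookup y k" "\<And>j. j < k \<Longrightarrow> lookup x j = lookup y j"
  using assms by (auto simp: less_poly_mapping.rep_eq less_fun_def)

lemma dgv_add_disjoint: "dig a \<inter> dig b = {} \<Longrightarrow> dgv (a + b) = dgv a + dgv b"
  by (simp add: dgv_def dig_add_disjoint sum.union_disjoint)

text \<open>At the lowest common digit the count drops from 2 to 0, while the lower digits of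
  \<open>a + b\<close> are just those of \<open>a\<close> and \<open>b\<close>; the lexicographic
  order sees this position first.\<close>

lemma dgv_add_overlap:
  assumes "dig a \<inter> dig b \<noteq> {}"
  shows "dgv (a + b) < dgv a + dgv b"
proof -
  define i where "i = (LEAST i. i \<in> dig a \<inter> dig b)"
  have i: "i \<in> dig a \<inter> dig b" unfolding i_def using assms by (metis LeastI ex_in_conv)
  have low: "\<not> (bit a j \<and> bit b j)" if "j < i" for j
    using that not_less_Least[of j "\<lambda>i. i \<in> dig a \<inter> dig b"] by (auto simp: i_def dig_def)
  \<comment> \<open>Below \<open>i\<close> the two numbers share no digit, so their low parts add
    without carry and stay below \<open>2 ^ i\<close>.\<close>
  let ?a = "take_bit i a" and ?b = "take_bit i b"
  have d: "dig ?a \<inter> dig ?b = {}" using low by (auto simp: dig_def bit_take_bit_iff)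
  have "and ?a ?b = 0" using d by (intro bit_eqI) (auto simp: dig_def bit_and_iff)
  then have "?a + ?b = take_bit i (or a b)"
    by (simp only: disjunctive_add_eq_or take_bit_or)
  then have lt: "?a + ?b < 2 ^ i" by (simp only: take_bit_eq_mod) simp
  have tk: "take_bit i (a + b) = ?a + ?b"
    using lt take_bit_nat_eq_self[OF lt] by (simp add: take_bit_add)
  show ?thesis
  proof (rule less_expoI)
    have a: "a = 2 ^ i * drop_bit i a + ?a" and b: "b = 2 ^ i * drop_bit i b + ?b"
      by (simp_all add: take_bit_eq_mod drop_bit_eq_div)
    have "a + b = 2 ^ i * (drop_bit i a + drop_bit i b) + (?a + ?b)"
      using a b by (metis (no_types, lifting) ab_semigroup_add_class.add_ac(1) add.left_commute distrib_left)
    then have "(a + b) div 2 ^ i = drop_bit i a + drop_bit i b"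
      using lt by simp
    moreover have "odd (drop_bit i a)" "odd (drop_bit i b)"
      using i by (auto simp: dig_def bit_iff_odd_drop_bit)
    ultimately have "digit i (a + b) = 0" by (simp add: digit_def)
    moreover have "digit i a = 1" "digit i b = 1" using i by (auto simp: digit_bit dig_def)
    ultimately show "lookup (dgv (a + b)) i < lookup (dgv a + dgv b) i"
      by (simp add: lookup_dgv lookup_add)
  next
    fix j assume j: "j < i"
    have "digit j (a + b) = digit j (take_bit i (a + b))"
      using j by (simp add: digit_bit bit_take_bit_iff)
    also have "\<dots> = digit j ?a + digit j ?b"
      unfolding tk using dgv_add_disjoint[OF d] by (metis lookup_add lookup_dgv)
    also have "\<dots> = digit j a + digit j b"
      using j by (simp add: digit_bit bit_take_bit_iff)
    finally show "lookup (dgv (a + b)) j = lookup (dgv a + dgv b) j"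
      by (simp add: lookup_dgv lookup_add)
  qed
qed

lemma dgv_add_le: "dgv (a + b) \<le> dgv a + dgv b"
  using dgv_add_disjoint dgv_add_overlap by (metis less_imp_le order_refl)

lemma wt_zero [simp]: "wt 0 = 0"
  by (simp add: wt_def)

lemma wt_single [simp]: "wt (single j a) = dgv a"
  by (simp add: wt_def)

lemma wt_add_expand:
  "wt (m + m') = (\<Sum>j\<in>keys m \<union> keys m'. dgv (lookup m j + lookup m' j))"
  "wt m + wt m' = (\<Sum>j\<in>keys m \<union> keys m'. dgv (lookup m j) + dgv (lookup m' j))"
  by (simp_all add: wt_def[of "m + m'"] keys_add_expo lookup_add sum.distrib
      wt_superset[of "keys m \<union> keys m'" m] wt_superset[of "keys m \<union> keys m'" m'])

lemma wt_add_le: "wt (m + m') \<le> wt m + wt m'"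
  unfolding wt_add_expand by (intro sum_mono dgv_add_le)

lemma wt_add_disjoint:
  "(\<And>j. dig (lookup m j) \<inter> dig (lookup m' j) = {}) \<Longrightarrow> wt (m + m') = wt m + wt m'"
  unfolding wt_add_expand by (intro sum.cong dgv_add_disjoint) auto

lemma wt_add_overlap:
  assumes "dig (lookup m j) \<inter> dig (lookup m' j) \<noteq> {}"
  shows "wt (m + m') < wt m + wt m'"
proof -
  have j: "j \<in> keys m \<union> keys m'" using assms by (auto simp: in_keys_iff)
  show ?thesis unfolding wt_add_expand
    using j assms by (subst (1 2) sum.remove[of _ j])
      (auto intro!: add_less_le_mono dgv_add_overlap sum_mono dgv_add_le)
qed

lemma wt_sum_le: "wt (\<Sum>i\<in>I. m i) \<le> (\<Sum>i\<in>I. wt (m i))"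
proof (induction I rule: infinite_finite_induct)
  case (insert x F)
  then show ?case using wt_add_le[of "m x" "sum m F"] by (simp add: add_left_mono order_trans)
qed simp_all

lemma dgv_power: "dgv (2 ^ i) = single i 1"
  by (simp add: dgv_def dig_power)

declare One_nat_def [simp del]

section \<open>Kameko's maps\<close>

text \<open>\<open>dbl U v\<close> is the exponent vector of \<open>(\<Prod>j\<in>U. X j) * v\<^sup>2\<close>.\<close>

definition dbl :: "nat set \<Rightarrow> expo \<Rightarrow> expo" where
  "dbl U v = (\<Sum>j\<in>U. single j 1) + v + v"

lemma lookup_dbl: "finite U \<Longrightarrow> lookup (dbl U v) j = of_bool (j \<in> U) + 2 * lookup v j"
  by (simp add: dbl_def lookup_add lookup_sum lookup_single when_def)

lemma edeg_dbl: "edeg (dbl U v) = card U + 2 * edeg v"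
  by (simp add: dbl_def edeg_add edeg_sum)

lemma keys_dbl: "finite U \<Longrightarrow> keys (dbl U v) = U \<union> keys v"
  by (auto simp: in_keys_iff lookup_dbl)

lemma dbl_Exps: "U \<subseteq> {1..t} \<Longrightarrow> v \<in> Exps t d \<Longrightarrow> dbl U v \<in> Exps t (card U + 2 * d)"
  using finite_subset[of U "{1..t}"] by (auto simp: Exps_def edeg_dbl keys_dbl)

lemma dbl_eqI:
  assumes "finite U" "\<And>j. odd (lookup m j) \<longleftrightarrow> j \<in> U"
  obtains v where "m = dbl U v"
proof -
  define v where "v = Abs_poly_mapping (\<lambda>j. lookup m j div 2)"
  have "finite {j. lookup m j div 2 \<noteq> 0}"
    by (rule finite_subset[OF _ finite_keys[of m]]) (auto simp: in_keys_iff)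
  then have lv: "lookup v j = lookup m j div 2" for j by (simp add: v_def)
  have "m = dbl U v"
  proof (rule poly_mapping_eqI)
    fix j
    have "lookup m j = of_bool (odd (lookup m j)) + 2 * (lookup m j div 2)"
      by (cases "odd (lookup m j)") (simp_all, presburger)
    then show "lookup m j = lookup (dbl U v) j"
      using assms by (simp add: lookup_dbl lv)
  qed
  then show ?thesis using that by blast
qed

lemma dbl_inj: "finite U \<Longrightarrow> dbl U v = dbl U v' \<longleftrightarrow> v = v'"
proof
  assume U: "finite U" and e: "dbl U v = dbl U v'"
  show "v = v'"
  proof (rule poly_mapping_eqI)
    fix j show "lookup v j = lookup v' j"
      using arg_cong[OF e, of "\<lambda>m. lookup m j"] U by (simp add: lookup_dbl)
  qed
qed simp

lemma digit_Suc: "digit (Suc i) (of_bool b + 2 * a) = digit i a"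
  by (auto simp: digit_def div_mult2_eq)

lemma weight_of_superset:
  "finite A \<Longrightarrow> keys m \<subseteq> A \<Longrightarrow> weight_of m i = (\<Sum>j\<in>A. digit i (lookup m j))"
  unfolding weight_of_def
  by (intro sum.mono_neutral_left) (auto simp: in_keys_iff digit_def)

lemma weight_of_dbl:
  assumes "finite U"
  shows "weight_of (dbl U v) 0 = card U" "weight_of (dbl U v) (Suc i) = weight_of v i"
proof -
  have "weight_of (dbl U v) 0 = (\<Sum>j\<in>U \<union> keys v. of_bool (j \<in> U))"
    unfolding weight_of_def using assms by (intro sum.cong) (auto simp: keys_dbl lookup_dbl digit_def)
  then show "weight_of (dbl U v) 0 = card U"
    using assms by (simp add: of_bool_def sum.If_cases Int_absorb1)
  have "weight_of (dbl U v) (Suc i) = (\<Sum>j\<in>U \<union> keys v. digit i (lookup v j))"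
    unfolding weight_of_def using assms by (intro sum.cong) (auto simp: keys_dbl lookup_dbl digit_Suc)
  then show "weight_of (dbl U v) (Suc i) = weight_of v i"
    using assms by (simp add: weight_of_superset[of "U \<union> keys v"])
qed

text \<open>Passing from \<open>v\<close> to \<open>dbl U v\<close> prepends \<open>card U\<close>
  to the weight vector; this strips the equal first entries again.\<close>

lemma less_fun_Suc:
  assumes "f 0 = g (0::nat)"
  shows "less_fun f g \<longleftrightarrow> less_fun (\<lambda>i. f (Suc i)) (\<lambda>i. g (Suc i))"
proof
  assume "less_fun f g"
  then obtain k where k: "f k < g k" "\<And>j. j < k \<Longrightarrow> f j = g j" by (auto elim!: less_funE)
  then obtain k' where "k = Suc k'" using assms by (cases k) auto
  then show "less_fun (\<lambda>i. f (Suc i)) (\<lambda>i. g (Suc i))" using k by (intro less_funI exI[of _ k']) auto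
next
  assume "less_fun (\<lambda>i. f (Suc i)) (\<lambda>i. g (Suc i))"
  then obtain k where "f (Suc k) < g (Suc k)" "\<And>j. j < k \<Longrightarrow> f (Suc j) = g (Suc j)"
    by (auto elim!: less_funE)
  then show "less_fun f g" using assms
    by (intro less_funI exI[of _ "Suc k"]) (auto simp: less_Suc_eq_0_disj)
qed

lemma wt_less_iff: "wt m < wt m' \<longleftrightarrow> less_fun (weight_of m) (weight_of m')"
proof -
  have "lookup (wt m) = weight_of m" for m by (simp add: fun_eq_iff lookup_wt)
  then show ?thesis by (simp add: less_poly_mapping.rep_eq)
qed

lemma wt_dbl_less: "finite U \<Longrightarrow> wt (dbl U v) < wt (dbl U v') \<longleftrightarrow> wt v < wt v'"
  unfolding wt_less_iff by (subst less_fun_Suc) (simp_all add: weight_of_dbl)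

lemma wt_dbl_eq: "finite U \<Longrightarrow> wt (dbl U v) = wt (dbl U v') \<longleftrightarrow> wt v = wt v'"
  using wt_dbl_less[of U v v'] wt_dbl_less[of U v' v] by (metis linorder_neq_iff)

lemma dbl_less: "finite U \<Longrightarrow> dbl U v < dbl U v' \<longleftrightarrow> v < v'"
  by (auto simp: less_poly_mapping.rep_eq less_fun_def lookup_dbl)

lemma mless_dbl: "finite U \<Longrightarrow> mless (dbl U v) (dbl U v') \<longleftrightarrow> mless v v'"
  by (simp add: mless_iff wt_dbl_less wt_dbl_eq dbl_less)

lemma mon_dbl: "mon (dbl U v) = mon (\<Sum>j\<in>U. single j 1) * (mon v)\<^sup>2"
  by (simp add: dbl_def mult_single power2_eq_square add.assoc)

text \<open>Both parities are read off from Steenrod squares: \<open>a choose b\<close> is the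
  coefficient of \<open>Sq b (X 0 ^ a)\<close>, and \<open>X 0 ^ (2 * c)\<close> is the square of a
  polynomial.\<close>

lemma binomial_even_odd: "even a \<Longrightarrow> odd b \<Longrightarrow> even (a choose b)"
  and binomial_double: "even (2 * c choose (2 * d)) \<longleftrightarrow> even (c choose d)"
proof -
  have pw: "X 0 ^ a \<noteq> 0" for a
    by (metis X_power lookup_single_eq lookup_zero zero_neq_one)
  have nz: "of_nat c * X 0 ^ a = 0 \<longleftrightarrow> even c" for c a
    using pw[of a] by (auto simp: of_nat_mpol)
  show "even (a choose b)" if "even a" "odd b"
  proof -
    obtain c where "a = 2 * c" using \<open>even a\<close> by blast
    then have "Sq b (X 0 ^ a) = 0" using Sq_square_odd[OF \<open>odd b\<close>, of "X 0 ^ c"] by (simp add: power_mult mult.commute)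
    then show ?thesis using nz by (simp only: Sq_X_power)
  qed
  have "X 0 ^ (2 * c) = (X 0 ^ c)\<^sup>2" by (simp only: power_mult mult.commute)
  then have "Sq (2 * d) (X 0 ^ (2 * c)) = (Sq d (X 0 ^ c))\<^sup>2" by (simp only: Sq_square_even)
  then have "of_nat (2 * c choose (2 * d)) * X 0 ^ (2 * c + 2 * d) = (of_nat (c choose d) * X 0 ^ (c + d))\<^sup>2"
    by (simp only: Sq_X_power)
  then have "of_nat (2 * c choose (2 * d)) * X 0 ^ (2 * c + 2 * d) = 0 \<longleftrightarrow> of_nat (c choose d) * X 0 ^ (c + d) = 0"
    by (simp only: zero_eq_power2)
  then show "even (2 * c choose (2 * d)) \<longleftrightarrow> even (c choose d)" by (simp only: nz)
qed

lemma binomial_double': "even ((of_bool b + 2 * c) choose (2 * d)) \<longleftrightarrow> even (c choose d)"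
proof (cases b)
  case True
  show ?thesis
  proof (cases d)
    case (Suc e)
    have "(Suc (2 * c)) choose (2 * d) = (2 * c choose (2 * d)) + (2 * c choose Suc (2 * e))"
      using Suc by simp
    then show ?thesis using True binomial_even_odd[of "2 * c" "Suc (2 * e)"] binomial_double[of c d] by (simp add: One_nat_def)
  qed simp
qed (simp add: binomial_double)

text \<open>Kameko's map, \<open>X 1 * \<dots> * X t * v\<^sup>2 \<mapsto> v\<close> and all other monomials to 0.\<close>

definition kdown :: "nat \<Rightarrow> mpol \<Rightarrow> mpol" where
  "kdown t = Poly_Mapping.map_key (dbl {1..t})"

lemma inj_dbl: "finite U \<Longrightarrow> inj (dbl U)"
  by (simp add: inj_def dbl_inj)

lemma lookup_kdown: "lookup (kdown t f) b = lookup f (dbl {1..t} b)"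
  unfolding kdown_def by (simp add: map_key.rep_eq inj_dbl)

lemma kdown_add: "kdown t (f + g) = kdown t f + kdown t g"
  by (rule poly_mapping_eqI) (simp add: lookup_kdown lookup_add)

lemma kdown_zero [simp]: "kdown t 0 = 0"
  by (rule poly_mapping_eqI) (simp add: lookup_kdown)

lemma kdown_sum: "kdown t (\<Sum>i\<in>I. f i) = (\<Sum>i\<in>I. kdown t (f i))"
  by (induction I rule: infinite_finite_induct) (simp_all add: kdown_add)

lemma kdown_dbl [simp]: "kdown t (mon (dbl {1..t} b)) = mon b"
  by (rule poly_mapping_eqI) (simp add: lookup_kdown lookup_single dbl_inj)

lemma kdown_not_dbl: "(\<And>b. m \<noteq> dbl {1..t} b) \<Longrightarrow> kdown t (mon m) = 0"
  by (rule poly_mapping_eqI) (simp add: lookup_kdown lookup_single)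

lemma kdown_Pol: "f \<in> Pol t (t + 2 * d) \<Longrightarrow> kdown t f \<in> Pol t d"
proof -
  assume "f \<in> Pol t (t + 2 * d)"
  moreover have "dbl {1..t} b \<in> keys f" if "b \<in> keys (kdown t f)" for b
    using that by (simp add: in_keys_iff lookup_kdown)
  ultimately show ?thesis by (fastforce simp: Pol_def Exps_def edeg_dbl keys_dbl)
qed

lemma kdown_small: "f \<in> Pol t m \<Longrightarrow> m < t \<Longrightarrow> kdown t f = 0"
proof (rule ccontr)
  assume f: "f \<in> Pol t m" "m < t" "kdown t f \<noteq> 0"
  then obtain b where "b \<in> keys (kdown t f)" using keys_eq_empty by blast
  then have "dbl {1..t} b \<in> keys f" by (simp add: in_keys_iff lookup_kdown)
  then show False using f by (auto simp: Pol_def Exps_def edeg_dbl)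
qed

lemma of_nat_bit_cong: "even a = even b \<Longrightarrow> (of_nat a :: bit) = of_nat b"
  by (cases "even a") (auto elim!: evenE oddE)

text \<open>If one of the first \<open>t\<close> exponents of \<open>m\<close> is even, an all-odd
  monomial is reached only by an odd increment there, and an even number choose an odd one is even.
  Otherwise \<open>m\<close> is itself of the form \<open>dbl {1..t} c\<close>, all increments are
  even, and the binomial coefficients have the parity of the halved ones.\<close>

lemma kdown_Sq_mon:
  assumes m: "keys m \<subseteq> {1..t}"
  shows "kdown t (Sq k (mon m)) = (if even k then Sq (k div 2) (kdown t (mon m)) else 0)"
proof (rule poly_mapping_eqI)
  fix b :: expo
  let ?A = "{1..t} \<union> keys b"
  let ?y = "dbl {1..t} b"
  have L: "lookup (kdown t (Sq k (mon m))) b =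
    (if (\<forall>j\<in>?A. lookup m j \<le> lookup ?y j) \<and> edeg ?y = edeg m + k
     then of_nat (\<Prod>j\<in>?A. lookup m j choose (lookup ?y j - lookup m j)) else 0)"
    unfolding lookup_kdown using m by (intro lookup_Sq_mon) (auto simp: keys_dbl)
  show "lookup (kdown t (Sq k (mon m))) b =
      lookup (if even k then Sq (k div 2) (kdown t (mon m)) else 0) b"
  proof (cases "\<forall>j\<in>{1..t}. odd (lookup m j)")
    case False
    then obtain j where j: "j \<in> {1..t}" "even (lookup m j)" by auto
    have "m \<noteq> dbl {1..t} c" for c using j by (auto simp: lookup_dbl)
    then have R: "kdown t (mon m) = 0" by (rule kdown_not_dbl)
    have "even (\<Prod>j\<in>?A. lookup m j choose (lookup ?y j - lookup m j))"
      if "\<forall>j\<in>?A. lookup m j \<le> lookup ?y j"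
    proof -
      have "lookup m j \<le> lookup ?y j" using j that by blast
      moreover have "odd (lookup ?y j)" using j by (simp add: lookup_dbl)
      ultimately have "odd (lookup ?y j - lookup m j)" using j by simp
      then have "even (lookup m j choose (lookup ?y j - lookup m j))"
        using j binomial_even_odd by blast
      then show ?thesis using j by (auto simp: even_prod_iff)
    qed
    moreover have "(of_nat N :: bit) = 0" if "even N" for N using that by (auto elim!: evenE)
    ultimately have "lookup (kdown t (Sq k (mon m))) b = 0" unfolding L
      by (simp del: of_nat_prod)
    then show ?thesis using R by simp
  next
    case True
    have "lookup m j = 0" if "j \<notin> {1..t}" for j
      using m that by (meson in_keys_iff subsetD)
    then have "odd (lookup m j) \<longleftrightarrow> j \<in> {1..t}" for j
      using True by (cases "j \<in> {1..t}") auto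
    then obtain c where c: "m = dbl {1..t} c" using dbl_eqI[of "{1..t}" m] by blast
    have kc: "keys c \<subseteq> ?A" using m c by (auto simp: keys_dbl)
    have "2 * p = 2 * q + k \<longleftrightarrow> even k \<and> p = q + k div 2" for p q by presburger
    then have e1: "(edeg ?y = edeg m + k) = (even k \<and> edeg b = edeg c + k div 2)"
      by (simp add: c edeg_dbl)
    have e2: "(\<forall>j\<in>?A. lookup m j \<le> lookup ?y j) = (\<forall>j\<in>?A. lookup c j \<le> lookup b j)"
      by (simp add: c lookup_dbl)
    have "lookup ?y j - lookup m j = 2 * (lookup b j - lookup c j)" for j
      by (simp add: c lookup_dbl)
    then have "even (lookup m j choose (lookup ?y j - lookup m j)) =
        even (lookup c j choose (lookup b j - lookup c j))" for j
      using binomial_double'[of "j \<in> {1..t}" "lookup c j" "lookup b j - lookup c j"]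
      by (simp only: c lookup_dbl finite_atLeastAtMost)
    then have "even (\<Prod>j\<in>?A. lookup m j choose (lookup ?y j - lookup m j)) =
        even (\<Prod>j\<in>?A. lookup c j choose (lookup b j - lookup c j))"
      by (simp only: even_prod_iff finite_Un finite_atLeastAtMost finite_keys)
    then have e3: "(of_nat (\<Prod>j\<in>?A. lookup m j choose (lookup ?y j - lookup m j)) :: bit) =
        of_nat (\<Prod>j\<in>?A. lookup c j choose (lookup b j - lookup c j))"
      by (rule of_nat_bit_cong)
    show ?thesis
    proof (cases "even k")
      case True
      have "lookup (Sq (k div 2) (mon c)) b = (if (\<forall>j\<in>?A. lookup c j \<le> lookup b j) \<and> edeg b = edeg c + k div 2
        then of_nat (\<Prod>j\<in>?A. lookup c j choose (lookup b j - lookup c j)) else 0)"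
        using kc by (intro lookup_Sq_mon) auto
      then show ?thesis unfolding L e1 e2 e3 using True by (simp add: c)
    next
      case False
      then show ?thesis unfolding L e1 by simp
    qed
  qed
qed

lemma kdown_Sq:
  assumes "f \<in> Pol t n"
  shows "kdown t (Sq k f) = (if even k then Sq (k div 2) (kdown t f) else 0)"
proof -
  have "kdown t (Sq k (mon m)) = (if even k then Sq (k div 2) (kdown t (mon m)) else 0)" if "m \<in> keys f" for m
    using assms that by (intro kdown_Sq_mon) (auto simp: Pol_def Exps_def)
  then have "kdown t (Sq k (\<Sum>m\<in>keys f. mon m)) = (if even k then Sq (k div 2) (kdown t (\<Sum>m\<in>keys f. mon m)) else 0)"
    unfolding Sq_sum kdown_sum by (cases "even k") simp_all
  then show ?thesis unfolding mpol_eq_sum_mon[of f, symmetric] .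
qed

lemma kdown_hits:
  assumes "f \<in> hits t (t + 2 * d)" shows "kdown t f \<in> hits t d"
proof -
  obtain g where g: "f = (\<Sum>i=1..t + 2 * d. Sq i (g i))" "\<forall>i\<in>{1..t + 2 * d}. g i \<in> Pol t (t + 2 * d - i)"
    using assms by (auto simp: hits_def)
  have "kdown t (Sq i (g i)) \<in> hits t d" if i: "i \<in> {1..t + 2 * d}" for i
  proof (cases "even i")
    case True
    then obtain i' where i': "i = 2 * i'" by blast
    have gi: "g i \<in> Pol t (t + 2 * d - i)" using g i by blast
    then have e: "kdown t (Sq i (g i)) = Sq i' (kdown t (g i))" using kdown_Sq i' by auto
    show ?thesis
    proof (cases "i' \<le> d")
      case True
      then have "kdown t (g i) \<in> Pol t (d - i')" using gi i' by (intro kdown_Pol) (simp add: diff_mult_distrib2)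
      then show ?thesis unfolding e using i i' True by (intro hitsI) auto
    next
      \<comment> \<open>The degree \<open>t + 2 * d - i\<close> of \<open>g i\<close> is below
        \<open>t\<close>, too small for a multiple of all \<open>t\<close> variables.\<close>
      case False
      then have "kdown t (g i) = 0" using gi i i' by (intro kdown_small) auto
      then show ?thesis by (simp add: e)
    qed
  next
    case False
    moreover have "g i \<in> Pol t (t + 2 * d - i)" using g i by blast
    ultimately show ?thesis by (simp add: kdown_Sq)
  qed
  then show ?thesis unfolding g(1) kdown_sum by (intro hits_sum) auto
qed

section \<open>Squaring a relation and multiplying it by a squarefree monomial\<close>

lemma if_of_nat_bit_nonzero: "x \<noteq> 0 \<Longrightarrow> x = (if P then of_nat c else 0 :: bit) \<Longrightarrow> P \<and> c \<noteq> 0"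
  by (cases P; cases "c = 0") simp_all

lemma mpol_add_cancel: "a + b + a = (b::mpol)"
  by (simp only: add.commute[of "a + b"] mpol_add_self_left)

text \<open>A positive square turns some exponent 1 of the squarefree factor into 2, and multiplying
  by \<open>f\<^sup>2\<close> changes no parity; so fewer than \<open>card U\<close> exponents of
  \<open>y\<close> are odd.\<close>

lemma weight_0_Sq_squarefree:
  assumes U: "finite U" and a: "a > 0" and y: "y \<in> keys (Sq a (mon (\<Sum>j\<in>U. single j 1)) * f\<^sup>2)"
  shows "weight_of y 0 < card U"
proof -
  let ?u = "\<Sum>j\<in>U. single j (1::nat)"
  have lu: "lookup ?u j = of_bool (j \<in> U)" for j
    using U by (simp add: lookup_sum lookup_single when_def)
  have ku: "keys ?u = U" by (auto simp: in_keys_iff lu)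
  obtain z w where y': "y = z + w" and z: "z \<in> keys (Sq a (mon ?u))" and w: "w \<in> keys (f\<^sup>2)"
    using y Poly_Mapping.keys_mult[of "Sq a (mon ?u)" "f\<^sup>2"] by auto
  have "(\<Sum>m\<in>keys f. mon m)\<^sup>2 = (\<Sum>m\<in>keys f. mon (m + m))"
    unfolding mpol_square_sum by (simp add: power2_eq_square mult_single)
  then have "f\<^sup>2 = (\<Sum>m\<in>keys f. mon (m + m))"
    unfolding mpol_eq_sum_mon[of f, symmetric] .
  then have "\<exists>m. w = m + m" using w Poly_Mapping.keys_sum[of "\<lambda>m. mon (m + m)" "keys f"] by auto
  then have ew: "even (lookup w j)" for j by (auto simp: lookup_add)
  have kz: "keys z = U" "edeg z = card U + a" using keys_Sq_mon[OF z] by (auto simp: ku edeg_sum)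
  have "\<not> (\<forall>j\<in>U. lookup z j = 1)"
  proof
    assume "\<forall>j\<in>U. lookup z j = 1"
    then have "edeg z = card U" unfolding edeg_def kz(1) by simp
    then show False using kz(2) a by simp
  qed
  \<comment> \<open>\<open>1 choose i\<close> vanishes for \<open>i > 1\<close>, so an exponent 1
    can only stay or be doubled.\<close>
  moreover have zj: "lookup z j \<in> {1, 2}" if "j \<in> U" for j
  proof (rule ccontr)
    assume *: "\<not> ?thesis"
    have "lookup (Sq a (mon ?u)) z \<noteq> 0" using z by (simp add: in_keys_iff)
    moreover have "lookup (Sq a (mon ?u)) z = (if (\<forall>j\<in>U. lookup ?u j \<le> lookup z j) \<and> edeg z = edeg ?u + a
        then of_nat (\<Prod>j\<in>U. lookup ?u j choose (lookup z j - lookup ?u j)) else 0)"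
      by (rule lookup_Sq_mon[OF U]) (simp_all only: ku kz order_refl)
    ultimately have C: "((\<forall>j\<in>U. lookup ?u j \<le> lookup z j) \<and> edeg z = edeg ?u + a) \<and>
        (\<Prod>j\<in>U. lookup ?u j choose (lookup z j - lookup ?u j)) \<noteq> 0"
      by (rule if_of_nat_bit_nonzero)
    note nz = conjunct1[OF conjunct1[OF C]] conjunct2[OF C]
    have le: "lookup ?u j \<le> lookup z j" using that nz(1) by blast
    have u1: "lookup ?u j = 1" using that by (simp only: lu) simp
    have ch: "lookup ?u j choose (lookup z j - lookup ?u j) \<noteq> 0"
    proof
      assume e: "lookup ?u j choose (lookup z j - lookup ?u j) = 0"
      have ex: "\<exists>j\<in>U. lookup ?u j choose (lookup z j - lookup ?u j) = 0"
        using e that by (rule bexI)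
      show False by (rule notE[OF nz(2)[unfolded prod_zero_iff[OF U]] ex])
    qed
    have "1 choose (lookup z j - 1) \<noteq> 0" using ch unfolding u1 .
    moreover have "1 \<le> lookup z j" using le unfolding u1 .
    ultimately show False using * binomial_eq_0[of 1 "lookup z j - 1"] by force
  qed
  ultimately obtain i where i: "i \<in> U" "lookup z i = 2" by blast
  have "weight_of y 0 = (\<Sum>j\<in>U \<union> keys w. digit 0 (lookup y j))"
    using U kz by (intro weight_of_superset) (auto simp: y' keys_add_expo)
  also have "\<dots> = (\<Sum>j\<in>U \<union> keys w. digit 0 (lookup z j))"
  proof -
    have "(b + lookup w j) mod 2 = b mod 2" for b j using ew[of j] by presburger
    then show ?thesis by (intro sum.cong) (auto simp: y' lookup_add digit_def)
  qed
  also have "\<dots> = (\<Sum>j\<in>U. digit 0 (lookup z j))"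
    using U kz by (intro sum.mono_neutral_right) (auto simp: in_keys_iff digit_def)
  also have "\<dots> \<le> (\<Sum>j\<in>U - {i}. 1)"
  proof -
    have "(\<Sum>j\<in>U. digit 0 (lookup z j)) = (\<Sum>j\<in>U - {i}. digit 0 (lookup z j))"
      using i U by (simp add: sum.remove[of U i] digit_def)
    also have "\<dots> \<le> (\<Sum>j\<in>U - {i}. 1)" by (rule sum_mono) (simp add: digit_def)
    finally show ?thesis .
  qed
  also have "\<dots> < card U" using card_Diff1_less[OF U i(1)] by simp
  finally show ?thesis .
qed

text \<open>By the Cartan formula, \<open>Sq (2 * i) (u * g\<^sup>2)\<close> is
  \<open>u * (Sq i g)\<^sup>2\<close> plus terms with a positive square on the squarefree
  \<open>u\<close>, whose first weight entry is below \<open>card U\<close>. So the squared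
  relation, times \<open>u\<close>, is hit modulo smaller monomials.\<close>

lemma inadmissible_dbl:
  assumes v: "inadmissible t d v" "v \<in> Exps t d" and U: "U \<subseteq> {1..t}"
  shows "inadmissible t (card U + 2 * d) (dbl U v)"
proof -
  let ?n = "card U + 2 * d"
  let ?u = "mon (\<Sum>j\<in>U. single j 1)"
  have fU: "finite U" using U finite_subset by blast
  obtain f where f: "f \<in> low t d v" "mon v + f \<in> hits t d"
    using v inadmissible_iff by blast
  then obtain g where g: "mon v + f = (\<Sum>i=1..d. Sq i (g i))" "\<forall>i\<in>{1..d}. g i \<in> Pol t (d - i)"
    by (auto simp: hits_def)
  have uP: "?u \<in> Pol t (card U)"
  proof -
    have "(\<Sum>j\<in>U. single j (1::nat)) = dbl U 0" by (simp add: dbl_def)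
    then show ?thesis using dbl_Exps[OF U, of 0 0] by (simp add: Exps_def)
  qed
  define r where "r i = Sq (2 * i) (?u * (g i)\<^sup>2) + ?u * (Sq i (g i))\<^sup>2" for i
  have rlow: "r i \<in> low t ?n (dbl U v)" if i: "i \<in> {1..d}" for i
  proof -
    have gi: "g i \<in> Pol t (d - i)" using g i by blast
    have P1: "?u * (g i)\<^sup>2 \<in> Pol t (card U + 2 * (d - i))"
      using Pol_mult[OF uP Pol_power[OF gi, of 2]] by simp
    have P2: "?u * (Sq i (g i))\<^sup>2 \<in> Pol t (card U + 2 * d)"
      using Pol_mult[OF uP Pol_power[OF Sq_Pol[OF gi, of i], of 2]] i by (simp add: algebra_simps)
    have "card U + 2 * (d - i) + 2 * i = ?n" using i by auto
    then have P: "r i \<in> Pol t ?n" unfolding r_def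
      using Sq_Pol[OF P1, of "2 * i"] P2 by (simp only: Pol_add)
    have "Sq (2 * i) (?u * (g i)\<^sup>2) = (\<Sum>a\<le>2 * i. Sq a ?u * Sq (2 * i - a) ((g i)\<^sup>2))"
      by (rule Cartan)
    also have "\<dots> = ?u * (Sq i (g i))\<^sup>2 + (\<Sum>a\<in>{1..2 * i}. Sq a ?u * Sq (2 * i - a) ((g i)\<^sup>2))"
    proof -
      have "{..2 * i} = insert 0 {1..2 * i}" by auto
      then show ?thesis by (simp add: Sq_0 Sq_square_even)
    qed
    finally have re: "r i = (\<Sum>a\<in>{1..2 * i}. Sq a ?u * Sq (2 * i - a) ((g i)\<^sup>2))"
      unfolding r_def by (simp only: mpol_add_cancel)
    have "mless y (dbl U v)" if yr: "y \<in> keys (r i)" for y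
    proof -
      obtain a where a: "a \<in> {1..2 * i}" "y \<in> keys (Sq a ?u * Sq (2 * i - a) ((g i)\<^sup>2))"
        using subsetD[OF Poly_Mapping.keys_sum yr[unfolded re]] by (rule UN_E)
      have "even (2 * i - a)"
      proof (rule ccontr)
        assume "odd (2 * i - a)"
        then show False using a(2) Sq_square_odd[of "2 * i - a" "g i"] by simp
      qed
      then obtain b where "2 * i - a = 2 * b" by blast
      then have "weight_of y 0 < card U"
        using a weight_0_Sq_squarefree[OF fU, of a y "Sq b (g i)"] by (simp add: Sq_square_even)
      then show ?thesis unfolding mless_iff wt_less_iff less_fun_def
        by (intro disjI1 exI[of _ 0]) (simp add: weight_of_dbl fU)
    qed
    then show ?thesis using P by (simp add: low_def)
  qed
  have flow: "?u * f\<^sup>2 \<in> low t ?n (dbl U v)"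
  proof -
    have "?u * (\<Sum>m\<in>keys f. mon m)\<^sup>2 = (\<Sum>m\<in>keys f. mon (dbl U m))"
      by (simp add: mpol_square_sum mon_dbl sum_distrib_left)
    then have "?u * f\<^sup>2 = (\<Sum>m\<in>keys f. mon (dbl U m))"
      unfolding mpol_eq_sum_mon[of f, symmetric] .
    also have "\<dots> \<in> low t ?n (dbl U v)"
    proof (rule low_sum)
      fix m assume "m \<in> keys f"
      then have "m \<in> Exps t d" "mless m v" using f(1) by (auto simp: low_def Pol_def)
      then show "mon (dbl U m) \<in> low t ?n (dbl U v)"
        using U fU by (simp only: low_mon dbl_Exps mless_dbl)
    qed
    finally show ?thesis .
  qed
  have "mon (dbl U v) + ?u * f\<^sup>2 = ?u * (mon v + f)\<^sup>2"
    by (simp add: mon_dbl mpol_square_add distrib_left)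
  also have "\<dots> = (\<Sum>i=1..d. ?u * (Sq i (g i))\<^sup>2)"
    unfolding g(1) mpol_square_sum by (simp only: sum_distrib_left)
  also have "\<dots> = (\<Sum>i=1..d. Sq (2 * i) (?u * (g i)\<^sup>2)) + (\<Sum>i=1..d. r i)"
    unfolding r_def sum.distrib by (simp only: mpol_add_self_left)
  finally have "mon (dbl U v) + (?u * f\<^sup>2 + (\<Sum>i=1..d. r i)) = (\<Sum>i=1..d. Sq (2 * i) (?u * (g i)\<^sup>2))"
    by (simp only: add.assoc[symmetric]) (simp only: add.assoc mpol_add_self add_0_right)
  also have "\<dots> \<in> hits t ?n"
  proof (rule hits_sum)
    fix i assume i: "i \<in> {1..d}"
    then have gi: "g i \<in> Pol t (d - i)" using g by blast
    have P1: "?u * (g i)\<^sup>2 \<in> Pol t (card U + 2 * (d - i))"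
      using Pol_mult[OF uP Pol_power[OF gi, of 2]] by simp
    then show "Sq (2 * i) (?u * (g i)\<^sup>2) \<in> hits t ?n" using i by (intro hitsI[OF _ P1]) auto
  qed
  finally have "mon (dbl U v) + (?u * f\<^sup>2 + (\<Sum>i=1..d. r i)) \<in> hits t ?n" .
  moreover have "?u * f\<^sup>2 + (\<Sum>i=1..d. r i) \<in> low t ?n (dbl U v)"
    using flow rlow by (intro low_add low_sum)
  moreover have "dbl U v \<in> Exps t ?n" using U v by (intro dbl_Exps)
  ultimately show ?thesis using inadmissible_iff by blast
qed

section \<open>The chi-trick\<close>

text \<open>These \<open>n\<close> are the only degrees in which a conjugate square of a product of
  \<open>e\<close> variables can be nonzero: every variable contributes one power of two.\<close>

fun psum :: "nat \<Rightarrow> nat \<Rightarrow> bool" where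
  "psum 0 n \<longleftrightarrow> n = 0"
| "psum (Suc e) n \<longleftrightarrow> (\<exists>p. 2 ^ p \<le> n \<and> psum e (n - 2 ^ p))"

lemma even_binomial_power2: "0 < j \<Longrightarrow> j < 2 ^ p \<Longrightarrow> even (2 ^ p choose j)"
proof (induction p arbitrary: j)
  case (Suc p)
  show ?case
  proof (cases "even j")
    case True
    then obtain i where "j = 2 * i" by blast
    then show ?thesis using Suc binomial_double[of "2 ^ p" i] by simp
  next
    case False
    then show ?thesis by (intro binomial_even_odd) auto
  qed
qed simp

text \<open>Multiplicativity of the total square in total degree \<open>m\<close>, for two graded
  sequences: on the left the square of their product, on the right the product of their
  squares.\<close>

lemma Sq_convolution:
  fixes c d :: "nat \<Rightarrow> mpol"
  shows "(\<Sum>j\<le>m. Sq j (\<Sum>i\<le>m - j. c i * d (m - j - i))) =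
    (\<Sum>q\<le>m. (\<Sum>p\<le>q. Sq p (c (q - p))) * (\<Sum>r\<le>m - q. Sq r (d (m - q - r))))"
proof -
  have "(\<Sum>j\<le>m. Sq j (\<Sum>i\<le>m - j. c i * d (m - j - i))) =
      (\<Sum>j\<le>m. \<Sum>(i, p)\<in>{..m - j} \<times> {..j}. Sq p (c i) * Sq (j - p) (d (m - j - i)))"
    by (simp add: Sq_sum Cartan sum.cartesian_product)
  also have "\<dots> = (\<Sum>(j, i, p)\<in>(SIGMA j:{..m}. {..m - j} \<times> {..j}). Sq p (c i) * Sq (j - p) (d (m - j - i)))"
    by (subst sum.Sigma) auto
  \<comment> \<open>\<open>q = p + i\<close> is the degree absorbed by the first factor.\<close>
  also have "\<dots> = (\<Sum>(q, p, r)\<in>(SIGMA q:{..m}. {..q} \<times> {..m - q}). Sq p (c (q - p)) * Sq r (d (m - q - r)))"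
    by (rule sum.reindex_bij_witness[of _ "\<lambda>(q, p, r). (p + r, q - p, p)" "\<lambda>(j, i, p). (p + i, p, j - p)"])
      (auto simp: diff_diff_eq add.commute)
  also have "\<dots> = (\<Sum>q\<le>m. \<Sum>(p, r)\<in>{..q} \<times> {..m - q}. Sq p (c (q - p)) * Sq r (d (m - q - r)))"
    by (subst sum.Sigma) auto
  also have "\<dots> = (\<Sum>q\<le>m. (\<Sum>p\<le>q. Sq p (c (q - p))) * (\<Sum>r\<le>m - q. Sq r (d (m - q - r))))"
    by (simp add: sum_product sum.cartesian_product)
  finally show ?thesis .
qed

text \<open>\<open>chiX a k\<close> is the conjugate square of degree \<open>k\<close> of \<open>X a\<close>.\<close>

definition chiX :: "nat \<Rightarrow> nat \<Rightarrow> mpol" where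
  "chiX a k = (if \<exists>p. k + 1 = 2 ^ p then X a ^ (k + 1) else 0)"

lemma Sq_X_power2: "Sq j (X a ^ (2 ^ p)) = (if j = 0 \<or> j = 2 ^ p then X a ^ (2 ^ p + j) else 0)"
proof -
  have "of_nat (2 ^ p choose j) = (if j = 0 \<or> j = 2 ^ p then 1 else (0 :: mpol))"
    using even_binomial_power2[of j p] by (cases "j < 2 ^ p") (auto simp: of_nat_mpol binomial_eq_0)
  then show ?thesis unfolding Sq_X_power by simp
qed

text \<open>For \<open>m > 0\<close> there are nonzero terms only if \<open>m + 1\<close> is a power
  of two, and then exactly two, \<open>j = 0\<close> and \<open>j = (m + 1) div 2\<close>. Both
  equal \<open>X a ^ (m + 1)\<close> and cancel.\<close>

lemma chiX_inverse: "(\<Sum>j\<le>m. Sq j (chiX a (m - j))) = (if m = 0 then X a else 0)"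
proof -
  have t: "Sq j (chiX a (m - j)) =
      (if (\<exists>q. m + 1 = 2 ^ q \<and> (j = 0 \<or> q > 0 \<and> j = 2 ^ (q - 1))) then X a ^ (m + 1) else 0)"
    if "j \<le> m" for j
  proof (cases "\<exists>p. m - j + 1 = 2 ^ p")
    case True
    then obtain p where p: "m - j + 1 = 2 ^ p" by blast
    then have m: "m + 1 = 2 ^ p + j" using that by simp
    have "j = 0 \<or> j = 2 ^ p \<longleftrightarrow> (\<exists>q. m + 1 = 2 ^ q \<and> (j = 0 \<or> q > 0 \<and> j = 2 ^ (q - 1)))"
    proof
      assume "j = 0 \<or> j = 2 ^ p"
      then show "\<exists>q. m + 1 = 2 ^ q \<and> (j = 0 \<or> q > 0 \<and> j = 2 ^ (q - 1))"
        using m by (elim disjE) (auto intro: exI[of _ p] exI[of _ "Suc p"])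
    next
      assume "\<exists>q. m + 1 = 2 ^ q \<and> (j = 0 \<or> q > 0 \<and> j = 2 ^ (q - 1))"
      then obtain q where q: "m + 1 = 2 ^ q" "j = 0 \<or> q > 0 \<and> j = 2 ^ (q - 1)" by blast
      show "j = 0 \<or> j = 2 ^ p"
      proof (cases "j = 0")
        case False
        then obtain q' where "q = Suc q'" "j = 2 ^ q'" using q by (cases q) auto
        then show ?thesis using m q by simp
      qed simp
    qed
    moreover have "chiX a (m - j) = X a ^ (2 ^ p)" using p by (auto simp: chiX_def)
    ultimately show ?thesis by (simp only: Sq_X_power2 m)
  next
    case False
    have "\<not> (\<exists>q. m + 1 = 2 ^ q \<and> (j = 0 \<or> q > 0 \<and> j = 2 ^ (q - 1)))"
    proof
      assume "\<exists>q. m + 1 = 2 ^ q \<and> (j = 0 \<or> q > 0 \<and> j = 2 ^ (q - 1))"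
      then obtain q where q: "m + 1 = 2 ^ q" "j = 0 \<or> q > 0 \<and> j = 2 ^ (q - 1)" by blast
      have "m - j + 1 = 2 ^ q \<or> m - j + 1 = 2 ^ (q - 1)"
      proof (cases "j = 0")
        case False
        then obtain q' where "q = Suc q'" "j = 2 ^ q'" using q by (cases q) auto
        then show ?thesis using q by auto
      qed (use q in simp)
      then show False using False by blast
    qed
    moreover have "chiX a (m - j) = 0" using False by (simp add: chiX_def)
    ultimately show ?thesis by (simp only: if_False Sq_zero)
  qed
  show ?thesis
  proof (cases "\<exists>q. m + 1 = 2 ^ q")
    case False
    then have "(\<Sum>j\<le>m. Sq j (chiX a (m - j))) = 0" using t by (intro sum.neutral) auto
    moreover have "m \<noteq> 0" using False by (metis add_0 power_0)
    ultimately show ?thesis by simp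
  next
    case True
    then obtain q where q: "m + 1 = 2 ^ q" by blast
    have qu: "q' = q" if "m + 1 = 2 ^ q'" for q' using q that by simp
    have "(\<Sum>j\<le>m. Sq j (chiX a (m - j))) =
        (\<Sum>j\<le>m. if j \<in> {0} \<union> (if q > 0 then {2 ^ (q - 1)} else {}) then X a ^ (m + 1) else 0)"
      using q qu by (intro sum.cong) (auto simp: t)
    also have "\<dots> = (\<Sum>j\<in>{0::nat} \<union> (if q > 0 then {2 ^ (q - 1)} else {}). X a ^ (m + 1))"
    proof -
      have "2 ^ (q - 1) \<le> m" if pos: "q > 0"
      proof -
        obtain q' where "q = Suc q'" using gr0_implies_Suc[OF pos] by blast
        then have "m + 1 = 2 * 2 ^ (q - 1)" using q by simp
        moreover have "(1::nat) \<le> 2 ^ (q - 1)" by simp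
        ultimately show ?thesis by linarith
      qed
      then show ?thesis by (intro sum.mono_neutral_cong_right) auto
    qed
    also have "\<dots> = (if m = 0 then X a else 0)"
      using q by (cases q) auto
    finally show ?thesis .
  qed
qed

text \<open>Conjugation respects products, so \<open>c\<close> is obtained by convolving the
  sequences \<open>chiX\<close> of the variables. A nonzero term picks a power of two for each
  variable, which gives \<open>psum\<close>.\<close>

lemma chi_exists:
  assumes "finite U"
  shows "\<exists>c. (\<forall>m. (\<Sum>j\<le>m. Sq j (c (m - j))) = (if m = 0 then \<Prod>j\<in>U. X j else 0)) \<and>
    (\<forall>t k. U \<subseteq> {1..t} \<longrightarrow> c k \<in> Pol t (k + card U)) \<and>
    (\<forall>k. c k \<noteq> 0 \<longrightarrow> psum (card U) (k + card U))"
  using assms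
proof (induction U rule: finite_induct)
  case empty
  have "(\<Sum>j\<le>m. Sq j (if m - j = 0 then 1 else 0)) = (if m = 0 then 1 else (0::mpol))" for m
  proof -
    have "(\<Sum>j\<le>m. Sq j (if m - j = 0 then 1 else 0)) = (\<Sum>j\<le>m. if j = m then Sq m 1 else 0)"
      by (intro sum.cong) auto
    then show ?thesis by (simp add: Sq_one)
  qed
  then show ?case
    by (intro exI[of _ "\<lambda>k. if k = 0 then 1 else 0"]) (auto simp: Pol_one)
next
  case (insert a U)
  then obtain c where c: "\<And>m. (\<Sum>j\<le>m. Sq j (c (m - j))) = (if m = 0 then \<Prod>j\<in>U. X j else 0)"
    "\<And>t k. U \<subseteq> {1..t} \<Longrightarrow> c k \<in> Pol t (k + card U)"
    "\<And>k. c k \<noteq> 0 \<Longrightarrow> psum (card U) (k + card U)"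
    by blast
  define c' where "c' k = (\<Sum>i\<le>k. chiX a i * c (k - i))" for k
  have cd: "card (insert a U) = Suc (card U)" using insert by simp
  have 1: "(\<Sum>j\<le>m. Sq j (c' (m - j))) = (if m = 0 then \<Prod>j\<in>insert a U. X j else 0)" for m
  proof -
    have "(\<Sum>j\<le>m. Sq j (c' (m - j))) = (\<Sum>q\<le>m. (if q = 0 then X a else 0) * (if m - q = 0 then \<Prod>j\<in>U. X j else 0))"
      unfolding c'_def Sq_convolution chiX_inverse c(1) ..
    also have "\<dots> = (\<Sum>q\<in>{0::nat}. X a * (if m = 0 then \<Prod>j\<in>U. X j else 0))"
      by (rule sum.mono_neutral_cong_right) auto
    finally show ?thesis using insert by simp
  qed
  have 2: "c' k \<in> Pol t (k + card (insert a U))" if "insert a U \<subseteq> {1..t}" for t k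
    unfolding c'_def
  proof (rule Pol_sum)
    fix i assume i: "i \<in> {..k}"
    have "X a \<in> Pol t 1" using that by (simp add: Exps_def)
    then have "X a ^ (i + 1) \<in> Pol t ((i + 1) * 1)" by (rule Pol_power)
    then have "chiX a i \<in> Pol t (i + 1)" by (simp add: chiX_def)
    moreover have "c (k - i) \<in> Pol t (k - i + card U)" using that by (intro c) auto
    ultimately have "chiX a i * c (k - i) \<in> Pol t (i + 1 + (k - i + card U))" by (rule Pol_mult)
    moreover have "i + 1 + (k - i + card U) = k + card (insert a U)" using i cd by simp
    ultimately show "chiX a i * c (k - i) \<in> Pol t (k + card (insert a U))" by simp
  qed
  have 3: "psum (card (insert a U)) (k + card (insert a U))" if nz: "c' k \<noteq> 0" for k
  proof -
    obtain i where i: "i \<le> k" "chiX a i * c (k - i) \<noteq> 0"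
      using nz unfolding c'_def by (metis (no_types, lifting) atMost_iff sum.neutral)
    then obtain p where p: "i + 1 = 2 ^ p" by (auto simp: chiX_def split: if_splits)
    have "psum (card U) (k - i + card U)" using i by (intro c) auto
    moreover have "k + Suc (card U) - 2 ^ p = k - i + card U" "2 ^ p \<le> k + Suc (card U)"
      using i p by auto
    ultimately show ?thesis unfolding cd psum.simps by (intro exI[of _ p]) simp
  qed
  show ?case using 1 2 3 by blast
qed

text \<open>\<open>Sq d\<close> is moved from \<open>v\<close> to the squarefree factor
  \<open>u\<close>: the sum over \<open>j\<close> of \<open>Sq j (c (d - j) * v)\<close> is
  \<open>u * Sq d v = u * v\<^sup>2\<close>. All terms with \<open>j > 0\<close> are hit, and for
  \<open>j = 0\<close> the factor \<open>c d\<close> vanishes in this degree.\<close>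

lemma hit_if_not_psum:
  assumes U: "U \<subseteq> {1..t}" and v: "v \<in> Exps t d" and n: "\<not> psum (card U) (d + card U)"
  shows "mon (dbl U v) \<in> hits t (card U + 2 * d)"
proof -
  have fU: "finite U" using U finite_subset by blast
  obtain c where c: "\<And>m. (\<Sum>j\<le>m. Sq j (c (m - j))) = (if m = 0 then \<Prod>j\<in>U. X j else 0)"
    "\<And>k. c k \<in> Pol t (k + card U)" "\<And>k. c k \<noteq> 0 \<Longrightarrow> psum (card U) (k + card U)"
    using chi_exists[OF fU] U by blast
  \<comment> \<open>The sequence concentrated in degree 0, whose total square is that of
    \<open>v\<close>.\<close>
  let ?e = "\<lambda>k. if k = 0 then mon v else 0"
  have e: "(\<Sum>r\<le>m. Sq r (?e (m - r))) = Sq m (mon v)" for m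
  proof -
    have "(\<Sum>r\<le>m. Sq r (?e (m - r))) = (\<Sum>r\<in>{m}. Sq m (mon v))"
      by (rule sum.mono_neutral_cong_right) auto
    then show ?thesis by simp
  qed
  have conv: "(\<Sum>i\<le>k. c i * ?e (k - i)) = c k * mon v" for k
  proof -
    have "(\<Sum>i\<le>k. c i * ?e (k - i)) = (\<Sum>i\<in>{k}. c k * mon v)"
      by (rule sum.mono_neutral_cong_right) auto
    then show ?thesis by simp
  qed
  have "(\<Sum>j\<le>d. Sq j (c (d - j) * mon v)) = (\<Sum>q\<le>d. (if q = 0 then \<Prod>j\<in>U. X j else 0) * Sq (d - q) (mon v))"
    using Sq_convolution[of c ?e d] unfolding conv e c(1) .
  also have "\<dots> = (\<Sum>q\<in>{0::nat}. (\<Prod>j\<in>U. X j) * Sq d (mon v))"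
    by (rule sum.mono_neutral_cong_right) auto
  also have "\<dots> = mon (dbl U v)"
    by (simp add: Sq_top[OF v] mon_dbl mon_sum)
  finally have "mon (dbl U v) = (\<Sum>j\<le>d. Sq j (c (d - j) * mon v))" ..
  also have "\<dots> \<in> hits t (card U + 2 * d)"
  proof (rule hits_sum)
    fix j assume j: "j \<in> {..d}"
    show "Sq j (c (d - j) * mon v) \<in> hits t (card U + 2 * d)"
    proof (cases "j = 0")
      case True
      have "c d = 0" using c(3) n by blast
      then show ?thesis using True by simp
    next
      case False
      have "c (d - j) * mon v \<in> Pol t (d - j + card U + d)"
        using c(2) v by (intro Pol_mult) auto
      then show ?thesis using False j by (intro hitsI) auto
    qed
  qed
  finally show ?thesis .
qed

lemma inadmissible_hit: "x \<in> Exps t n \<Longrightarrow> mon x \<in> hits t n \<Longrightarrow> inadmissible t n x"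
  by (subst inadmissible_iff) (auto intro!: bexI[of _ 0])

declare One_nat_def [simp]

section \<open>Sums of substitutions over subsets\<close>

text \<open>Extensional functions, so that a sum over this set counts each distribution of the
  digits once.\<close>

definition surj_maps :: "nat set \<Rightarrow> nat set \<Rightarrow> (nat \<Rightarrow> nat) set" where
  "surj_maps D L = {f \<in> D \<rightarrow>\<^sub>E L. f ` D = L}"

definition contrib :: "nat set \<Rightarrow> (nat \<Rightarrow> nat) \<Rightarrow> expo" where
  "contrib D f = (\<Sum>i\<in>D. single (f i) (2 ^ i))"

lemma finite_surj_maps [simp]: "finite D \<Longrightarrow> finite L \<Longrightarrow> finite (surj_maps D L)"
  by (simp add: surj_maps_def finite_PiE)

lemma surj_maps_card: "finite D \<Longrightarrow> f \<in> surj_maps D L \<Longrightarrow> card L \<le> card D"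
  using card_image_le by (auto simp: surj_maps_def)

lemma X_sum_power2: "(\<Sum>j\<in>J. X j) ^ (2 ^ i) = (\<Sum>j\<in>J. mon (single j (2 ^ i)))"
proof (induction i)
  case (Suc i)
  have "(\<Sum>j\<in>J. X j) ^ (2 ^ Suc i) = ((\<Sum>j\<in>J. X j) ^ (2 ^ i))\<^sup>2"
    by (simp only: power_Suc power_mult mult.commute[of 2])
  also have "\<dots> = (\<Sum>j\<in>J. mon (single j (2 ^ Suc i)))"
    unfolding Suc mpol_square_sum
    by (simp add: power2_eq_square mult_single single_add[symmetric] mult_2)
  finally show ?case .
qed simp

text \<open>Raising to a power of two is additive modulo two, so the left side is a product over the
  binary digits of \<open>a\<close>, and expanding it chooses a variable for every digit.\<close>

lemma X_sum_power:
  assumes "finite J"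
  shows "(\<Sum>j\<in>J. X j) ^ a = (\<Sum>f\<in>dig a \<rightarrow>\<^sub>E J. mon (contrib (dig a) f))"
proof -
  have "(\<Sum>j\<in>J. X j) ^ a = (\<Sum>j\<in>J. X j) ^ (\<Sum>i\<in>dig a. 2 ^ i)" by (simp only: sum_dig)
  also have "\<dots> = (\<Prod>i\<in>dig a. \<Sum>j\<in>J. mon (single j (2 ^ i)))"
    by (simp only: power_sum X_sum_power2)
  also have "\<dots> = (\<Sum>f\<in>dig a \<rightarrow>\<^sub>E J. \<Prod>i\<in>dig a. mon (single (f i) (2 ^ i)))"
    using assms by (intro prod_sum_PiE) auto
  finally show ?thesis by (simp only: contrib_def mon_sum)
qed

text \<open>Summing over all subsets kills the non-surjective maps: \<open>f\<close> is counted once for every set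
  between its range and \<open>L\<close>.\<close>

lemma sum_Pow_X_sum_power:
  assumes L: "finite L"
  shows "(\<Sum>J\<in>Pow L. (\<Sum>j\<in>J. X j) ^ a) = (\<Sum>f\<in>surj_maps (dig a) L. mon (contrib (dig a) f))"
proof -
  let ?D = "dig a"
  let ?m = "\<lambda>f. mon (contrib ?D f)"
  have fin: "finite (?D \<rightarrow>\<^sub>E L)" using L by (simp add: finite_PiE)
  have "(\<Sum>J\<in>Pow L. (\<Sum>j\<in>J. X j) ^ a) = (\<Sum>J\<in>Pow L. \<Sum>f\<in>?D \<rightarrow>\<^sub>E J. ?m f)"
    using L finite_subset by (intro sum.cong X_sum_power) auto
  also have "\<dots> = (\<Sum>J\<in>Pow L. \<Sum>f\<in>?D \<rightarrow>\<^sub>E L. if f ` ?D \<subseteq> J then ?m f else 0)"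
  proof (rule sum.cong[OF refl])
    fix J assume "J \<in> Pow L"
    then have "(?D \<rightarrow>\<^sub>E J) = {f \<in> ?D \<rightarrow>\<^sub>E L. f ` ?D \<subseteq> J}" by (fastforce simp: PiE_iff)
    then show "(\<Sum>f\<in>?D \<rightarrow>\<^sub>E J. ?m f) = (\<Sum>f\<in>?D \<rightarrow>\<^sub>E L. if f ` ?D \<subseteq> J then ?m f else 0)"
      using fin by (simp add: sum.inter_filter)
  qed
  also have "\<dots> = (\<Sum>f\<in>?D \<rightarrow>\<^sub>E L. \<Sum>J\<in>Pow L. if f ` ?D \<subseteq> J then ?m f else 0)"
    by (rule sum.swap)
  also have "\<dots> = (\<Sum>f\<in>?D \<rightarrow>\<^sub>E L. if f ` ?D = L then ?m f else 0)"
  proof (rule sum.cong[OF refl])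
    fix f assume f: "f \<in> ?D \<rightarrow>\<^sub>E L"
    then have sub: "f ` ?D \<subseteq> L" by auto
    have "(\<Sum>J\<in>Pow L. if f ` ?D \<subseteq> J then ?m f else 0) = (\<Sum>J\<in>{J \<in> Pow L. f ` ?D \<subseteq> J}. ?m f)"
      using L by (intro sum.inter_filter[symmetric]) simp
    also have "\<dots> = of_nat (card {J \<in> Pow L. f ` ?D \<subseteq> J}) * ?m f"
      by simp
    also have "card {J \<in> Pow L. f ` ?D \<subseteq> J} = card (Pow (L - f ` ?D))"
      by (rule bij_betw_same_card[of "\<lambda>J. J - f ` ?D"],
          rule bij_betw_byWitness[where f' = "\<lambda>J. J \<union> f ` ?D"]) (use sub in auto)
    also have "\<dots> = 2 ^ card (L - f ` ?D)" using L by (simp add: card_Pow)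
    finally have s: "(\<Sum>J\<in>Pow L. if f ` ?D \<subseteq> J then ?m f else 0) = of_nat (2 ^ card (L - f ` ?D)) * ?m f" .
    show "(\<Sum>J\<in>Pow L. if f ` ?D \<subseteq> J then ?m f else 0) = (if f ` ?D = L then ?m f else 0)"
    proof (cases "f ` ?D = L")
      case False
      then have "card (L - f ` ?D) \<noteq> 0" using L sub by auto
      then show ?thesis unfolding s using False by (simp add: of_nat_mpol)
    next
      case True
      then show ?thesis unfolding s by simp
    qed
  qed
  also have "\<dots> = (\<Sum>f\<in>surj_maps ?D L. ?m f)"
    using fin by (simp add: surj_maps_def sum.inter_filter)
  finally show ?thesis .
qed

section \<open>Exponents and weights of the terms of a subset sum\<close>

definition subsum :: "(nat \<Rightarrow> nat) \<Rightarrow> nat \<Rightarrow> nat set \<Rightarrow> mpol \<Rightarrow> mpol" where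
  "subsum \<tau> src L f = (\<Sum>J\<in>Pow L. lsub (\<lambda>k. if k = src then J else {\<tau> k}) f)"

definition relabel :: "(nat \<Rightarrow> nat) \<Rightarrow> nat \<Rightarrow> expo \<Rightarrow> expo" where
  "relabel \<tau> src z = (\<Sum>k\<in>keys z - {src}. single (\<tau> k) (lookup z k))"

lemma subsum_mon:
  assumes "finite L"
  shows "subsum \<tau> src L (mon z) =
    (\<Sum>f\<in>surj_maps (dig (lookup z src)) L. mon (relabel \<tau> src z + contrib (dig (lookup z src)) f))"
proof -
  have l: "lsub (\<lambda>k. if k = src then J else {\<tau> k}) (mon z) =
      mon (relabel \<tau> src z) * (\<Sum>j\<in>J. X j) ^ lookup z src" for J
  proof -
    have "lsub (\<lambda>k. if k = src then J else {\<tau> k}) (mon z) =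
        (\<Prod>k\<in>insert src (keys z). (\<Sum>i\<in>(if k = src then J else {\<tau> k}). X i) ^ lookup z k)"
      by (rule lsub_mon) auto
    also have "\<dots> = (\<Sum>j\<in>J. X j) ^ lookup z src * (\<Prod>k\<in>keys z - {src}. X (\<tau> k) ^ lookup z k)"
      by (subst prod.insert_remove) simp_all
    also have "(\<Prod>k\<in>keys z - {src}. X (\<tau> k) ^ lookup z k) = mon (relabel \<tau> src z)"
      by (simp only: X_power relabel_def mon_sum)
    finally show ?thesis by (simp only: mult.commute)
  qed
  have "subsum \<tau> src L (mon z) = mon (relabel \<tau> src z) * (\<Sum>J\<in>Pow L. (\<Sum>j\<in>J. X j) ^ lookup z src)"
    unfolding subsum_def l sum_distrib_left ..
  also have "\<dots> = (\<Sum>f\<in>surj_maps (dig (lookup z src)) L. mon (relabel \<tau> src z + contrib (dig (lookup z src)) f))"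
    unfolding sum_Pow_X_sum_power[OF assms] by (simp add: sum_distrib_left mult_single)
  finally show ?thesis .
qed

lemma steenrod_hom_subsum:
  assumes "L \<subseteq> {1..t'}" "\<And>k. k \<in> {1..t} \<Longrightarrow> k \<noteq> src \<Longrightarrow> \<tau> k \<in> {1..t'}"
  shows "steenrod_hom t t' (subsum \<tau> src L)"
  unfolding subsum_def[abs_def] using assms
  by (intro steenrod_hom_sum steenrod_hom_lsub) auto

lemma subsum_add: "subsum \<tau> src L (f + g) = subsum \<tau> src L f + subsum \<tau> src L g"
  by (simp add: subsum_def lsub_add sum.distrib)

lemma edeg_relabel: "edeg (relabel \<tau> src z) + lookup z src = edeg z"
proof -
  have "edeg z = (\<Sum>k\<in>insert src (keys z). lookup z k)" by (rule edeg_superset) auto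
  also have "\<dots> = lookup z src + (\<Sum>k\<in>keys z - {src}. lookup z k)"
    by (subst sum.insert_remove) simp_all
  finally show ?thesis by (simp add: relabel_def edeg_sum)
qed

lemma wt_remove: "wt z = (\<Sum>k\<in>keys z - {l}. dgv (lookup z k)) + dgv (lookup z l)"
proof -
  have "wt z = (\<Sum>k\<in>insert l (keys z). dgv (lookup z k))" by (rule wt_superset) auto
  also have "\<dots> = dgv (lookup z l) + (\<Sum>k\<in>keys z - {l}. dgv (lookup z k))"
    by (subst sum.insert_remove) simp_all
  finally show ?thesis by (simp only: add.commute)
qed

lemma wt_relabel_le: "wt (relabel \<tau> src z) + dgv (lookup z src) \<le> wt z"
proof -
  have "wt (relabel \<tau> src z) \<le> (\<Sum>k\<in>keys z - {src}. dgv (lookup z k))"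
    using wt_sum_le[of "\<lambda>k. single (\<tau> k) (lookup z k)" "keys z - {src}"]
    by (simp add: relabel_def)
  then show ?thesis unfolding wt_remove[of z src] by (rule add_right_mono)
qed

lemma wt_contrib_le: "wt (contrib (dig a) f) \<le> dgv a"
  using wt_sum_le[of "\<lambda>i. single (f i) (2 ^ i)" "dig a"]
  by (simp add: contrib_def dgv_power dgv_def[of a])

text \<open>A substitution only moves digits between variables, and any collision of digits lowers
  the weight.\<close>

lemma wt_relabel_contrib:
  "wt (relabel \<tau> src z + contrib (dig (lookup z src)) f) \<le> wt z"
proof -
  have "wt (relabel \<tau> src z + contrib (dig (lookup z src)) f) \<le>
      wt (relabel \<tau> src z) + wt (contrib (dig (lookup z src)) f)" by (rule wt_add_le)
  also have "\<dots> \<le> wt (relabel \<tau> src z) + dgv (lookup z src)"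
    by (intro add_left_mono wt_contrib_le)
  also have "\<dots> \<le> wt z" by (rule wt_relabel_le)
  finally show ?thesis .
qed

lemma wt_relabel_contrib_overlap:
  assumes "dig (lookup (relabel \<tau> src z) j) \<inter> dig (lookup (contrib (dig (lookup z src)) f) j) \<noteq> {}"
  shows "wt (relabel \<tau> src z + contrib (dig (lookup z src)) f) < wt z"
proof -
  have "wt (relabel \<tau> src z + contrib (dig (lookup z src)) f) <
      wt (relabel \<tau> src z) + wt (contrib (dig (lookup z src)) f)"
    using assms by (rule wt_add_overlap)
  also have "\<dots> \<le> wt (relabel \<tau> src z) + dgv (lookup z src)"
    by (intro add_left_mono wt_contrib_le)
  also have "\<dots> \<le> wt z" by (rule wt_relabel_le)
  finally show ?thesis .
qed

lemma lookup_contrib: "finite D \<Longrightarrow> lookup (contrib D f) j = (\<Sum>i\<in>{i \<in> D. f i = j}. 2 ^ i)"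
  by (simp add: contrib_def lookup_sum lookup_single when_def sum.inter_filter)

lemma dig_contrib: "finite D \<Longrightarrow> dig (lookup (contrib D f) j) = {i \<in> D. f i = j}"
  by (simp add: lookup_contrib dig_sum_power)

lemma lookup_relabel_inj:
  assumes "inj_on \<tau> (insert k (keys z) - {src})" "k \<noteq> src"
  shows "lookup (relabel \<tau> src z) (\<tau> k) = lookup z k"
proof -
  have "lookup (relabel \<tau> src z) (\<tau> k) = (\<Sum>i\<in>keys z - {src}. if i = k then lookup z k else 0)"
    unfolding relabel_def lookup_sum
  proof (rule sum.cong[OF refl])
    fix i assume "i \<in> keys z - {src}"
    then have "\<tau> i = \<tau> k \<longleftrightarrow> i = k"
      using inj_on_eq_iff[OF assms(1), of i k] assms(2) by blast
    then show "lookup (single (\<tau> i) (lookup z i)) (\<tau> k) = (if i = k then lookup z k else 0)"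
      by (simp add: lookup_single when_def)
  qed
  also have "\<dots> = (if k \<in> keys z - {src} then lookup z k else 0)" by (simp add: sum.delta)
  also have "\<dots> = lookup z k" using assms(2) by (simp add: in_keys_iff)
  finally show ?thesis .
qed

section \<open>Lexicographically maximal surjections\<close>

text \<open>The contribution of the map sending the \<open>e + 1\<close> top digits to the first element of the
  list and the remaining digits, in decreasing order, to the remaining elements.\<close>

fun wvec :: "nat \<Rightarrow> nat \<Rightarrow> nat list \<Rightarrow> expo" where
  "wvec e r [] = 0"
| "wvec e r (a # L) = single a (\<Sum>i\<in>{r - Suc e..<r}. 2 ^ i) + wvec 0 (r - Suc e) L"

lemma wvec_lookup_zero: "j \<notin> set L \<Longrightarrow> lookup (wvec e r L) j = 0"
  by (induction e r L rule: wvec.induct) (auto simp: lookup_add lookup_single when_def)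

text \<open>Without the digit \<open>r - 1\<close> the sum stays below \<open>2 ^ (r - 1)\<close>;
  with it, that digit is removed on both sides and induction applies.\<close>

lemma sum_power2_top:
  assumes S: "S \<subseteq> {..<r}" "card S \<le> k" "k \<le> r" "S \<noteq> {r - k..<r}"
  shows "(\<Sum>i\<in>S. 2 ^ i) < (\<Sum>i\<in>{r - k..<r}. 2 ^ i :: nat)"
  using assms
proof (induction k arbitrary: r S)
  case (Suc k)
  have fS: "finite S" using Suc.prems(1) finite_subset by blast
  obtain r' where r: "r = Suc r'" using Suc.prems by (cases r) auto
  have top: "{r - Suc k..<r} = insert r' {r' - k..<r'}" using r Suc.prems by auto
  show ?case
  proof (cases "r' \<in> S")
    case True
    have "S - {r'} \<subseteq> {..<r'}" using Suc.prems(1) r by (auto simp: less_Suc_eq)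
    moreover have "card (S - {r'}) \<le> k" using Suc.prems(2) True fS by simp
    moreover have "S - {r'} \<noteq> {r' - k..<r'}" using Suc.prems(4) top True by auto
    ultimately have "(\<Sum>i\<in>S - {r'}. 2 ^ i) < (\<Sum>i\<in>{r' - k..<r'}. 2 ^ i :: nat)"
      using Suc.prems(3) r by (intro Suc.IH) auto
    then show ?thesis unfolding top using True fS by (simp add: sum.remove[of S r'])
  next
    case False
    then have "S \<subseteq> {..<r'}" using Suc.prems(1) r by (auto simp: less_Suc_eq)
    then have "(\<Sum>i\<in>S. 2 ^ i) \<le> (\<Sum>i<r'. 2 ^ i :: nat)" by (intro sum_mono2) auto
    also have "\<dots> < 2 ^ r'" by (induction r') auto
    also have "\<dots> \<le> (\<Sum>i\<in>{r - Suc k..<r}. 2 ^ i)" unfolding top by simp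
    finally show ?thesis .
  qed
next
  case 0
  then have "S = {}" using finite_subset[of S "{..<r}"] by auto
  then show ?case using 0 by simp
qed

text \<open>Surjectivity reserves a digit for each later element, so the first one receives at most
  \<open>e + 1\<close> digits. The lexicographic order gives it the top ones and then decides on the
  tail, where no surplus is left. The premise on the empty list excludes digits without a
  target.\<close>

lemma contrib_le_wvec:
  assumes "sorted_wrt (<) L" "length L + e = r" "L = [] \<longrightarrow> e = 0"
  shows "\<exists>f0\<in>surj_maps {..<r} (set L). contrib {..<r} f0 = wvec e r L \<and>
    (\<forall>f\<in>surj_maps {..<r} (set L). f \<noteq> f0 \<longrightarrow> contrib {..<r} f < wvec e r L)"
  using assms
proof (induction L arbitrary: e r)
  case Nil
  then show ?case by (auto simp: surj_maps_def contrib_def)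
next
  case (Cons a L)
  define k where "k = r - Suc e"
  have r: "r = k + Suc e" "length L = k" using Cons.prems by (auto simp: k_def)
  have aL: "a < b" if "b \<in> set L" for b using that Cons.prems by simp
  then have anL: "a \<notin> set L" by blast
  obtain g0 where g0: "g0 \<in> surj_maps {..<k} (set L)" "contrib {..<k} g0 = wvec 0 k L"
    "\<And>g. g \<in> surj_maps {..<k} (set L) \<Longrightarrow> g \<noteq> g0 \<Longrightarrow> contrib {..<k} g < wvec 0 k L"
    using Cons.IH[of 0 k] Cons.prems r by auto
  let ?top = "{k..<r}"
  have un: "{..<r} = ?top \<union> {..<k}" "?top \<inter> {..<k} = {}" using r by auto
  have split: "contrib {..<r} f = contrib ?top f + contrib {..<k} f" for f
    unfolding contrib_def un(1) using un(2) by (simp add: sum.union_disjoint)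
  have w: "wvec e r (a # L) = single a (\<Sum>i\<in>?top. 2 ^ i) + wvec 0 k L"
    by (simp add: k_def)
  have ctop: "contrib ?top f = single a (\<Sum>i\<in>?top. 2 ^ i)" if "\<And>i. i \<in> ?top \<Longrightarrow> f i = a" for f
  proof -
    have "contrib ?top f = (\<Sum>i\<in>?top. single a (2 ^ i))"
      unfolding contrib_def using that by (intro sum.cong) auto
    also have "\<dots> = single a (\<Sum>i\<in>?top. 2 ^ i)"
      by (rule poly_mapping_eqI) (simp add: lookup_sum lookup_single when_def)
    finally show ?thesis .
  qed
  define f0 where "f0 i = (if i \<in> ?top then a else g0 i)" for i
  have g0': "g0 ` {..<k} = set L" "\<And>i. i < k \<Longrightarrow> g0 i \<in> set L" "\<And>i. \<not> i < k \<Longrightarrow> g0 i = undefined"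
    using g0(1) by (auto simp: surj_maps_def PiE_iff extensional_def)
  have "f0 ` {..<r} = insert a (set L)"
  proof -
    have "f0 ` ?top = {a}" using r by (auto simp: f0_def image_constant_conv)
    moreover have "f0 ` {..<k} = g0 ` {..<k}" by (intro image_cong) (auto simp: f0_def)
    ultimately show ?thesis unfolding un(1) image_Un g0' by simp
  qed
  then have f0: "f0 \<in> surj_maps {..<r} (set (a # L))"
    using g0' r by (auto simp: surj_maps_def PiE_iff extensional_def f0_def)
  have "contrib {..<k} f0 = contrib {..<k} g0"
    unfolding contrib_def by (intro sum.cong) (auto simp: f0_def)
  then have cf0: "contrib {..<r} f0 = wvec e r (a # L)"
    unfolding split w using ctop[of f0] g0(2) by (simp add: f0_def)
  moreover have "contrib {..<r} f < wvec e r (a # L)"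
    if f: "f \<in> surj_maps {..<r} (set (a # L))" "f \<noteq> f0" for f
  proof -
    let ?S = "{i \<in> {..<r}. f i = a}"
    have fi: "f ` {..<r} = insert a (set L)" "\<And>i. \<not> i < r \<Longrightarrow> f i = undefined"
      using f(1) by (auto simp: surj_maps_def PiE_iff extensional_def)
    have sub: "set L \<subseteq> f ` ({..<r} - ?S)"
    proof
      fix b assume b: "b \<in> set L"
      then have "b \<in> f ` {..<r}" unfolding fi(1) by blast
      then obtain i where "i < r" "b = f i" by blast
      then show "b \<in> f ` ({..<r} - ?S)" using b anL by blast
    qed
    have dL: "card (set L) = k" using Cons.prems r by (simp add: distinct_card strict_sorted_iff)
    have "k \<le> card ({..<r} - ?S)"
      using surj_card_le[OF _ sub] dL by simp
    also have "card ({..<r} - ?S) = r - card ?S" by (subst card_Diff_subset) auto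
    finally have "k \<le> r - card ?S" .
    moreover have "card ?S \<le> card {..<r}" by (rule card_mono) auto
    ultimately have cS: "card ?S \<le> Suc e" using r(1) by simp
    show ?thesis
    proof (cases "?S = ?top")
      case False
      moreover have "{r - Suc e..<r} = ?top" using r by simp
      ultimately have lt: "(\<Sum>i\<in>?S. 2 ^ i) < (\<Sum>i\<in>?top. 2 ^ i :: nat)"
        using sum_power2_top[of ?S r "Suc e"] cS r by auto
      have wa: "lookup (wvec e r (a # L)) a = (\<Sum>i\<in>?top. 2 ^ i)"
        unfolding w lookup_add using anL by (simp add: wvec_lookup_zero)
      show ?thesis
      proof (rule less_expoI[of _ a])
        show "lookup (contrib {..<r} f) a < lookup (wvec e r (a # L)) a"
          unfolding wa using lt by (simp only: lookup_contrib finite_lessThan)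
      next
        fix j assume j: "j < a"
        have "f i \<noteq> j" if "i < r" for i
        proof -
          have "f i \<in> f ` {..<r}" using that by blast
          then have "f i = a \<or> a < f i" unfolding fi(1) using aL by blast
          then show ?thesis using j by auto
        qed
        then have "{i \<in> {..<r}. f i = j} = {}" by blast
        then have "lookup (contrib {..<r} f) j = 0"
          by (simp only: lookup_contrib finite_lessThan sum.empty)
        moreover have "lookup (wvec e r (a # L)) j = 0"
        proof (rule wvec_lookup_zero)
          show "j \<notin> set (a # L)" using j aL[of j] by auto
        qed
        ultimately show "lookup (contrib {..<r} f) j = lookup (wvec e r (a # L)) j" by simp
      qed
    next
      case True
      have ft: "f i = a" if "i \<in> ?top" for i
        using that unfolding True[symmetric] by blast
      have nt: "f i \<noteq> a" if "i < k" for i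
      proof
        assume "f i = a"
        then have "i \<in> ?S" using that r(1) by simp
        then show False unfolding True using that by simp
      qed
      define g where "g = restrict f {..<k}"
      have gi: "g ` {..<k} = set L"
      proof -
        have "f i \<in> set L" if "i < k" for i
        proof -
          have "f i \<in> f ` {..<r}" using that r by simp
          then show ?thesis unfolding fi(1) using nt[OF that] by blast
        qed
        then have "f ` {..<k} \<subseteq> set L" by blast
        moreover have "{..<r} - ?S = {..<k}" unfolding True using r by auto
        then have "set L \<subseteq> f ` {..<k}" using sub by (simp only:)
        ultimately show ?thesis by (simp add: g_def image_restrict_eq)
      qed
      then have gs: "g \<in> surj_maps {..<k} (set L)"
        unfolding surj_maps_def g_def by (auto simp: PiE_iff)
      have "g \<noteq> g0"
      proof
        assume "g = g0"
        have "f i = f0 i" for i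
        proof (cases "i < r")
          case True
          then show ?thesis using ft \<open>g = g0\<close> by (cases "i < k") (auto simp: f0_def g_def)
        next
          case False
          then show ?thesis using fi(2) g0'(3) r by (simp add: f0_def)
        qed
        then show False using f(2) by blast
      qed
      then have "contrib {..<k} g < wvec 0 k L" using g0(3) gs by blast
      moreover have "contrib {..<k} g = contrib {..<k} f"
        unfolding contrib_def g_def by (intro sum.cong) auto
      ultimately show ?thesis unfolding split w using ctop[of f] ft by simp
    qed
  qed
  ultimately show ?case using f0 by blast
qed

section \<open>The maps psi\<close>

definition unskip :: "nat \<Rightarrow> nat \<Rightarrow> nat" where
  "unskip l k = (if k < l then k else k - 1)"

text \<open>Relabelling along the left inverse of \<open>skip l\<close>: an exponent vector of the
  larger algebra loses \<open>X l\<close> and becomes one of the smaller algebra.\<close>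

abbreviation del :: "nat \<Rightarrow> expo \<Rightarrow> expo" where
  "del l \<equiv> relabel (unskip l) l"

lemma unskip_skip [simp]: "unskip l (skip l j) = j"
  by (simp add: unskip_def skip_def)

lemma skip_neq [simp]: "skip l j \<noteq> l"
  by (simp add: skip_def)

lemma inj_unskip: "l \<notin> A \<Longrightarrow> inj_on (unskip l) A"
proof (rule inj_onI)
  fix x y assume "l \<notin> A" "x \<in> A" "y \<in> A" and e: "unskip l x = unskip l y"
  then have "x \<noteq> l" "y \<noteq> l" by blast+
  then show "x = y" using e by (simp add: unskip_def split: if_splits)
qed

lemma lookup_del: "lookup (del l z) j = lookup z (skip l j)"
  using lookup_relabel_inj[of "unskip l" "skip l j" z l] by (simp add: inj_unskip)

lemma wt_sum_inj:
  assumes "finite A" "inj_on \<tau> A"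
  shows "wt (\<Sum>k\<in>A. single (\<tau> k) (g k)) = (\<Sum>k\<in>A. dgv (g k))"
  using assms
proof (induction A rule: finite_induct)
  case (insert x F)
  have "lookup (\<Sum>k\<in>F. single (\<tau> k) (g k)) (\<tau> x) = 0"
    unfolding lookup_sum
  proof (intro sum.neutral ballI)
    fix k assume k: "k \<in> F"
    have "\<tau> k \<noteq> \<tau> x" using inj_on_eq_iff[OF insert.prems, of k x] k insert.hyps(2) by blast
    then show "lookup (single (\<tau> k) (g k)) (\<tau> x) = 0" by (simp add: lookup_single)
  qed
  then have "wt (single (\<tau> x) (g x) + (\<Sum>k\<in>F. single (\<tau> k) (g k))) =
      wt (single (\<tau> x) (g x)) + wt (\<Sum>k\<in>F. single (\<tau> k) (g k))"
    by (intro wt_add_disjoint) (auto simp: lookup_single when_def)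
  then show ?case using insert by simp
qed simp

lemma wt_del: "wt (del l z) + dgv (lookup z l) = wt z"
proof -
  have "wt (del l z) = (\<Sum>k\<in>keys z - {l}. dgv (lookup z k))"
    unfolding relabel_def by (rule wt_sum_inj) (auto intro: inj_unskip)
  then show ?thesis by (simp only: wt_remove[of z l])
qed

lemma wt_contrib: "finite D \<Longrightarrow> wt (contrib D f) = (\<Sum>i\<in>D. single i 1)"
proof (induction D rule: finite_induct)
  case (insert x D)
  have c: "contrib (insert x D) f = single (f x) (2 ^ x) + contrib D f"
    using insert by (simp add: contrib_def)
  have "wt (single (f x) (2 ^ x) + contrib D f) =
      wt (single (f x) (2 ^ x)) + wt (contrib D f)"
  proof (rule wt_add_disjoint)
    fix j
    have "dig (lookup (single (f x) (2 ^ x)) j) \<subseteq> {x}"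
      by (simp add: lookup_single when_def dig_power)
    moreover have "x \<notin> dig (lookup (contrib D f) j)"
      using insert by (simp add: dig_contrib)
    ultimately show "dig (lookup (single (f x) (2 ^ x)) j) \<inter> dig (lookup (contrib D f) j) = {}"
      by blast
  qed
  then show ?case unfolding c using insert by (simp add: dgv_power)
qed (simp add: contrib_def)

section \<open>The divisor \<open>xLu\<close> and the exponents of psi\<close>

lemma dgv_mask: "dgv (2 ^ r - 1) = (\<Sum>i<r. single i 1)"
  by (simp only: dgv_def dig_mask)

lemma dig_subset: "a < 2 ^ r \<Longrightarrow> dig a \<subseteq> {..<r}"
proof
  fix i assume a: "a < 2 ^ r" and i: "i \<in> dig a"
  have "(2::nat) ^ i \<le> (\<Sum>i\<in>dig a. 2 ^ i)" using i by (intro member_le_sum) auto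
  then have "(2::nat) ^ i < 2 ^ r" using a unfolding sum_dig by (rule le_less_trans)
  then show "i \<in> {..<r}" by simp
qed

lemma dig_diff: "dig b \<subseteq> dig a \<Longrightarrow> b \<le> a \<and> dig (a - b) = dig a - dig b"
proof -
  assume ba: "dig b \<subseteq> dig a"
  define c :: nat where "c = (\<Sum>i\<in>dig a - dig b. 2 ^ i)"
  have dc: "dig c = dig a - dig b" by (simp add: c_def dig_sum_power)
  then have "dig (c + b) = dig c \<union> dig b" by (intro dig_add_disjoint) blast
  then have "dig (c + b) = dig a" using dc ba by blast
  then have "a = c + b" by (simp only: dig_eq_iff)
  then show ?thesis using dc by simp
qed

text \<open>Digit \<open>r - d\<close> of \<open>2 ^ r - 1\<close>, with \<open>r\<close> the length
  of \<open>M\<close>, goes to position \<open>d\<close>, except that the top \<open>u\<close>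
  digits all go to position \<open>u\<close>; hence the \<open>max\<close>.\<close>

lemma xLu_contrib:
  assumes "1 \<le> u" "u \<le> length M"
  shows "xLu M u = contrib {..<length M} (\<lambda>i. ell M (max u (length M - i)))"
proof -
  let ?r = "length M"
  have "contrib {..<?r} (\<lambda>i. ell M (max u (?r - i))) =
      (\<Sum>d\<in>{1..?r}. single (ell M (max u d)) (2 ^ (?r - d)))"
    unfolding contrib_def
    by (rule sum.reindex_bij_witness[of _ "\<lambda>d. ?r - d" "\<lambda>i. ?r - i"]) auto
  also have "{1..?r} = {1..u} \<union> {u<..?r}" using assms by auto
  also have "(\<Sum>d\<in>{1..u} \<union> {u<..?r}. single (ell M (max u d)) (2 ^ (?r - d))) =
      (\<Sum>d\<in>{1..u}. single (ell M (max u d)) (2 ^ (?r - d))) +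
      (\<Sum>d\<in>{u<..?r}. single (ell M (max u d)) (2 ^ (?r - d)))"
    by (rule sum.union_disjoint) auto
  also have "(\<Sum>d\<in>{1..u}. single (ell M (max u d)) (2 ^ (?r - d))) =
      (\<Sum>d\<in>{1..u}. single (ell M u) (2 ^ (?r - d) :: nat))"
    by (intro sum.cong) (auto simp: max_def)
  also have "\<dots> = single (ell M u) (\<Sum>d\<in>{1..u}. 2 ^ (?r - d))"
    by (rule poly_mapping_eqI) (simp add: lookup_sum lookup_single when_def)
  also have "(\<Sum>d\<in>{u<..?r}. single (ell M (max u d)) (2 ^ (?r - d))) =
      (\<Sum>d\<in>{u<..?r}. single (ell M d) (2 ^ (?r - d) :: nat))"
    by (intro sum.cong) (auto simp: max_def)
  finally show ?thesis by (simp add: xLu_def Let_def)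
qed

lemma wvec_sum: "wvec 0 (length K) K = (\<Sum>d<length K. single (K ! d) (2 ^ (length K - Suc d)))"
proof (induction K)
  case (Cons a K)
  have "{length (a # K) - Suc 0..<length (a # K)} = {length K}" by auto
  then have "wvec 0 (length (a # K)) (a # K) = single a (2 ^ length K) + wvec 0 (length K) K"
    by simp
  also have "\<dots> = (\<Sum>d<length (a # K). single ((a # K) ! d) (2 ^ (length (a # K) - Suc d)))"
    unfolding Cons length_Cons sum.lessThan_Suc_shift by simp
  finally show ?case .
qed simp

text \<open>So the divisor in psi is the largest contribution of \<open>contrib_le_wvec\<close>,
  with surplus \<open>u - 1\<close>, for the positions from the \<open>u\<close>-th on. This is what
  makes psi reversible by substitutions.\<close>

lemma xLu_wvec:
  assumes u: "1 \<le> u" "u \<le> length M"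
  shows "xLu M u = wvec (u - 1) (length M) (drop (u - 1) M)"
proof -
  let ?r = "length M"
  have d: "drop (u - 1) M = M ! (u - 1) # drop u M"
    using u Cons_nth_drop_Suc[of "u - 1" M] by simp
  have s: "(\<Sum>d=1..u. 2 ^ (?r - d)) = (\<Sum>i\<in>{?r - Suc (u - 1)..<?r}. 2 ^ i :: nat)"
    using u by (intro sum.reindex_bij_witness[of _ "\<lambda>i. ?r - i" "\<lambda>d. ?r - d"]) auto
  have "wvec 0 (?r - Suc (u - 1)) (drop u M) =
      (\<Sum>d<?r - u. single (M ! (u + d)) (2 ^ (?r - u - Suc d)))"
    using wvec_sum[of "drop u M"] u by simp
  also have "\<dots> = (\<Sum>d\<in>{u<..?r}. single (ell M d) (2 ^ (?r - d)))"
    by (rule sum.reindex_bij_witness[of _ "\<lambda>d. d - Suc u" "\<lambda>d. d + Suc u"]) (auto simp: ell_def add.commute)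
  finally show ?thesis unfolding d wvec.simps xLu_def Let_def s by (simp add: ell_def)
qed

text \<open>All entries of \<open>L\<close> exceed \<open>l\<close>, so the corresponding positions
  in the smaller algebra are one less. By \<open>star\<close> every digit of the divisor is a digit
  of \<open>m\<close>; the subtraction has no borrow, and the removed digits reappear in the
  exponent of \<open>X l\<close>.\<close>

lemma psi_exponent:
  assumes NN: "(l, L) \<in> NN t" and st: "star L u m"
  defines "r \<equiv> length L" and "M \<equiv> map (\<lambda>j. j - 1) L"
  obtains p where "psi l L (mon m) = mon p" "lookup p l = 2 ^ r - 1"
    "del l p + wvec (u - 1) r (drop (u - 1) M) = m" "wt p = wt m" "edeg p = edeg m"
proof -
  have u: "1 \<le> u" "u \<le> r" using st by (auto simp: star_def Let_def r_def)
  have gt: "l < b" if "b \<in> set L" for b using NN that by (simp add: NN_def)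
  have gte: "l < ell L d" if "1 \<le> d" "d \<le> r" for d
    using that by (intro gt) (auto simp: ell_def r_def)
  define p where "p = single l (2 ^ r - 1) + qexp l m - xLu L u"
  have "(THE u. star L u m) = u" using st star_unique by blast
  moreover have "L \<noteq> []" using u by (auto simp: r_def)
  ultimately have ps: "psi l L (mon m) = mon p"
    using st by (auto simp: psi_def psi_mono_def p_def r_def)
  have "mon (p + xLu L u) = mon (single l (2 ^ r - 1) + qexp l m)"
    using psi_exact[OF NN st] unfolding ps by (simp only: mult_single qmap_mon X_power mult_1_right r_def)
  then have "keys (mon (p + xLu L u)) = keys (mon (single l (2 ^ r - 1) + qexp l m))"
    by (rule arg_cong)
  then have E: "p + xLu L u = single l (2 ^ r - 1) + qexp l m" by simp
  have lM: "length M = r" by (simp add: M_def r_def)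
  have eM: "ell M d = ell L d - 1" if "1 \<le> d" "d \<le> r" for d
    using that by (simp add: ell_def M_def r_def)
  have mx: "1 \<le> max u (r - i)" "max u (r - i) \<le> r" for i using u by auto
  have cL: "xLu L u = contrib {..<r} (\<lambda>i. ell L (max u (r - i)))"
    using xLu_contrib[of u L] u by (simp add: r_def)
  have cM: "xLu M u = contrib {..<r} (\<lambda>i. ell M (max u (r - i)))"
    using xLu_contrib[of u M] u lM by simp
  have xl: "lookup (xLu L u) l = 0"
  proof -
    have "{i \<in> {..<r}. ell L (max u (r - i)) = l} = {}" using gte[OF mx] by force
    then show ?thesis unfolding cL by (simp only: lookup_contrib finite_lessThan sum.empty)
  qed
  have xs: "lookup (xLu L u) (skip l j) = lookup (xLu M u) j" for j
  proof -
    have "ell L (max u (r - i)) = skip l j \<longleftrightarrow> ell M (max u (r - i)) = j" for i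
      using gte[OF mx, of i] unfolding eM[OF mx] by (auto simp: skip_def split: if_splits)
    then show ?thesis unfolding cL cM by (simp only: lookup_contrib finite_lessThan)
  qed
  have "lookup (qexp l m) l = 0"
    unfolding qexp_def lookup_sum by (intro sum.neutral) (simp add: lookup_single)
  then have pl: "lookup p l = 2 ^ r - 1"
    using arg_cong[OF E, of "\<lambda>e. lookup e l"] xl by (simp add: lookup_add)
  have pm: "del l p + xLu M u = m"
  proof (rule poly_mapping_eqI)
    fix j
    have "lookup p (skip l j) + lookup (xLu L u) (skip l j) = lookup m j"
      using arg_cong[OF E, of "\<lambda>e. lookup e (skip l j)"]
      by (simp add: lookup_add lookup_qexp_skip lookup_single skip_neq[THEN not_sym])
    then show "lookup (del l p + xLu M u) j = lookup m j"
      by (simp add: lookup_add lookup_del xs)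
  qed
  have sub: "dig (lookup (xLu M u) j) \<subseteq> dig (lookup m j)" for j
  proof
    fix i assume "i \<in> dig (lookup (xLu M u) j)"
    then have i: "i < r" "ell M (max u (r - i)) = j" unfolding cM by (simp_all add: dig_contrib)
    have j: "j = ell L (max u (r - i)) - 1" using i(2) eM[OF mx] by simp
    have "digit i (lookup m j) = 1"
    proof (cases "r - i \<le> u")
      case True
      then have "r - i \<in> {1..u}" using i by simp
      then have "digit (r - (r - i)) (lookup m (ell L u - 1)) = 1"
        using st unfolding star_def Let_def r_def by blast
      then show ?thesis using i j True by (simp add: max_def)
    next
      case False
      then have "r - i \<in> {u<..r}" by simp
      then have "digit (r - (r - i)) (lookup m (ell L (r - i) - 1)) = 1"
        using st unfolding star_def Let_def r_def by blast
      then show ?thesis using i j False by (simp add: max_def)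
    qed
    then show "i \<in> dig (lookup m j)"
      by (cases "bit (lookup m j) i") (simp_all add: digit_bit dig_def)
  qed
  have dj: "dig (lookup (del l p) j) \<inter> dig (lookup (xLu M u) j) = {}" for j
  proof -
    have "lookup (del l p) j = lookup m j - lookup (xLu M u) j"
      using arg_cong[OF pm, of "\<lambda>e. lookup e j"] by (simp add: lookup_add)
    then show ?thesis using dig_diff[OF sub] by (metis Diff_disjoint inf_commute)
  qed
  have "wt m = wt (del l p) + wt (xLu M u)"
    using wt_add_disjoint[OF dj] unfolding pm .
  also have "wt (xLu M u) = dgv (lookup p l)"
    unfolding pl dgv_mask cM by (rule wt_contrib) simp
  also have "wt (del l p) + dgv (lookup p l) = wt p" by (rule wt_del)
  finally have w: "wt p = wt m" ..
  have "edeg (xLu M u) = lookup p l"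
  proof -
    have "edeg (xLu M u) = (\<Sum>i<r. 2 ^ i)" unfolding cM by (simp add: contrib_def edeg_sum)
    also have "\<dots> = (\<Sum>i\<in>dig (2 ^ r - 1). 2 ^ i)" by (simp only: dig_mask)
    finally show ?thesis unfolding pl by (simp only: sum_dig)
  qed
  then have "edeg p = edeg (del l p + xLu M u)"
    using edeg_relabel[of "unskip l" l p] by (simp add: edeg_add)
  then have "edeg p = edeg m" unfolding pm .
  then show ?thesis using that[OF ps pl _ w] pm xLu_wvec[of u M] u lM by simp
qed

lemma keys_del: "keys (del l p) \<subseteq> {1..t} \<Longrightarrow> l \<in> {1..Suc t} \<Longrightarrow> keys p \<subseteq> {1..Suc t}"
proof
  fix k assume d: "keys (del l p) \<subseteq> {1..t}" and l: "l \<in> {1..Suc t}" and k: "k \<in> keys p"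
  show "k \<in> {1..Suc t}"
  proof (cases "k = l")
    case False
    then have "skip l (unskip l k) = k" by (auto simp: skip_def unskip_def)
    then have "unskip l k \<in> keys (del l p)" using k by (simp add: in_keys_iff lookup_del)
    then have "unskip l k \<in> {1..t}" using d by blast
    then show ?thesis using False by (auto simp: unskip_def split: if_splits)
  qed (use l in simp)
qed

lemma Exps_of_del:
  assumes "l \<in> {1..Suc t}" "x \<in> Exps t n" "del l p + w = x" "edeg p = n"
  shows "p \<in> Exps (Suc t) n"
proof -
  have "keys (del l p) \<subseteq> keys x" unfolding assms(3)[symmetric] by (simp add: keys_add_expo)
  then have "keys (del l p) \<subseteq> {1..t}" using assms(2) by (auto simp: Exps_def)
  then show ?thesis using keys_del assms(1,4) by (simp add: Exps_def)
qed

section \<open>Admissibility of psi(x) in the case \<open>u = 1\<close>\<close>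

lemma low_sum_mon:
  assumes "(\<Sum>i\<in>I. mon (y i)) \<in> Pol t n" "\<And>i. i \<in> I \<Longrightarrow> mless (y i) x"
  shows "(\<Sum>i\<in>I. mon (y i)) \<in> low t n x"
proof -
  have "mless z x" if z: "z \<in> keys (\<Sum>i\<in>I. mon (y i))" for z
    using subsetD[OF Poly_Mapping.keys_sum z] assms(2) by auto
  then show ?thesis using assms(1) by (simp add: low_def)
qed

lemma sorted_dec: "sorted_wrt (<) ((l::nat) # L) \<Longrightarrow> sorted_wrt (<) (map (\<lambda>j. j - 1) L)"
proof -
  assume a: "sorted_wrt (<) (l # L)"
  then have gt: "l < b" if "b \<in> set L" for b using that by simp
  have "x - 1 < y - 1" if "x \<in> set L" "y \<in> set L" "x < y" for x y
    using gt[OF that(1)] that(3) by linarith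
  moreover have "sorted_wrt (<) L" using a by simp
  ultimately have "sorted_wrt (\<lambda>x y. x - 1 < y - 1) L" by (rule sorted_wrt_mono_rel)
  then show ?thesis by (simp add: sorted_wrt_map)
qed

text \<open>For \<open>y\<close> below \<open>p\<close>, a surjection of the digits of \<open>y\<^sub>l\<close> onto \<open>M\<close> exists only if
  \<open>y\<^sub>l \<ge> 2 ^ r - 1\<close>, and the largest possible contribution is the one that leads from \<open>p\<close> to \<open>x\<close>.\<close>

lemma psi_admissible_first:
  assumes l: "l \<in> {1..Suc t}" and M: "sorted_wrt (<) M" "set M \<subseteq> {l..t}" "length M = r"
    and x: "x \<in> Exps t n" "\<not> inadmissible t n x"
    and p: "lookup p l = 2 ^ r - 1" "del l p + wvec 0 r M = x" "wt p = wt x" "edeg p = n"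
  shows "\<not> inadmissible (Suc t) n p"
proof -
  let ?T = "subsum (unskip l) l (set M)"
  let ?y = "\<lambda>z f. del l z + contrib (dig (lookup z l)) f"
  have hom: "steenrod_hom (Suc t) t ?T"
  proof (rule steenrod_hom_subsum)
    show "set M \<subseteq> {1..t}" using M(2) l by auto
    show "unskip l k \<in> {1..t}" if "k \<in> {1..Suc t}" "k \<noteq> l" for k
      using that l by (auto simp: unskip_def)
  qed
  have Tm: "?T (mon z) = (\<Sum>f\<in>surj_maps (dig (lookup z l)) (set M). mon (?y z f))" for z
    by (rule subsum_mon) simp
  have pE: "p \<in> Exps (Suc t) n" using l x(1) p(2,4) by (rule Exps_of_del)
  have TP: "?T (mon z) \<in> Pol t n" if "z \<in> Exps (Suc t) n" for z
    using hom that unfolding steenrod_hom_def by (metis Pol_mon)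
  have wy: "wt (?y z f) \<le> wt z" for z f by (rule wt_relabel_contrib)
  have dM: "distinct M" using M(1) by (simp add: strict_sorted_iff)
  have dp: "dig (lookup p l) = {..<r}" unfolding p(1) by (rule dig_mask)
  \<comment> \<open>There are \<open>r\<close> digits for \<open>r\<close> positions, so the surplus
    is 0; \<open>f0\<close> is the distribution that leads back to \<open>x\<close>.\<close>
  obtain f0 where f0: "f0 \<in> surj_maps {..<r} (set M)" "contrib {..<r} f0 = wvec 0 r M"
    "\<And>f. f \<in> surj_maps {..<r} (set M) \<Longrightarrow> f \<noteq> f0 \<Longrightarrow> contrib {..<r} f < wvec 0 r M"
    using contrib_le_wvec[OF M(1), of 0 r] M(3) by auto
  have cle: "contrib {..<r} f \<le> wvec 0 r M" if "f \<in> surj_maps {..<r} (set M)" for f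
    using f0 that by (cases "f = f0") (auto intro: less_imp_le)
  show ?thesis
  proof (rule admissible_transfer[where T = ?T, OF subsum_add _ pE x])
    show "?T f \<in> hits t n" if "f \<in> hits (Suc t) n" for f
      using steenrod_hom_hits[OF hom that] .
    let ?S = "surj_maps {..<r} (set M)"
    have "?T (mon p) = mon (?y p f0) + (\<Sum>f\<in>?S - {f0}. mon (?y p f))"
      unfolding Tm dp using f0(1) by (intro sum.remove) auto
    also have "?y p f0 = x" unfolding dp f0(2) by (rule p(2))
    finally have e: "?T (mon p) + mon x = (\<Sum>f\<in>?S - {f0}. mon (?y p f))"
      by (simp only: mpol_add_cancel)
    have "?T (mon p) + mon x \<in> Pol t n" using TP[OF pE] x(1) by (intro Pol_add) simp_all
    moreover have "mless (?y p f) x" if f: "f \<in> ?S - {f0}" for f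
    proof -
      have "?y p f < x" unfolding p(2)[symmetric] dp using f0(3) f by simp
      moreover have "wt (?y p f) \<le> wt x" using wy[of p f] p(3) by simp
      ultimately show ?thesis unfolding mless_iff by auto
    qed
    ultimately show "?T (mon p) + mon x \<in> low t n x" unfolding e by (rule low_sum_mon)
    fix z assume z: "z \<in> Exps (Suc t) n" "mless z p"
    have "mless (?y z f) x" if f: "f \<in> surj_maps (dig (lookup z l)) (set M)" for f
    proof (cases "wt z < wt p")
      case True
      then show ?thesis using le_less_trans[OF wy[of z f]] p(3) unfolding mless_iff by simp
    next
      case False
      then have zp: "wt z = wt p" "z < p" using z(2) unfolding mless_iff by auto
      have "?y z f < x"
      proof -
        obtain k where k: "lookup z k < lookup p k" "\<And>j. j < k \<Longrightarrow> lookup z j = lookup p j"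
          using less_expoE[OF zp(2)] by blast
        consider "k < l" | "k = l" | "l < k" by linarith
        then show ?thesis
        proof cases
          \<comment> \<open>Positions before \<open>l\<close> are untouched both by the substitution
            and by the passage from \<open>p\<close> to \<open>x\<close>.\<close>
          case 1
          have c: "lookup (contrib (dig (lookup z l)) f) j = 0" if "j < l" for j
          proof -
            have "{i \<in> dig (lookup z l). f i = j} = {}"
              using f M(2) that by (fastforce simp: surj_maps_def)
            then show ?thesis by (simp only: lookup_contrib finite_dig sum.empty)
          qed
          have w: "lookup (wvec 0 r M) j = 0" if "j < l" for j
            using M(2) that by (intro wvec_lookup_zero) auto
          have y: "lookup (?y z f) j = lookup z j" if "j < l" for j
            using that c by (simp add: lookup_add lookup_del skip_def)
          have xx: "lookup x j = lookup p j" if "j < l" for j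
            unfolding p(2)[symmetric] using that w by (simp add: lookup_add lookup_del skip_def)
          show ?thesis by (rule less_expoI[of _ k]) (use k 1 y xx in auto)
        next
          case 2
          have "card (set M) \<le> card (dig (lookup z l))" using surj_maps_card[OF finite_dig f] .
          then have c: "r \<le> card (dig (lookup z l))" using dM M(3) by (simp add: distinct_card)
          have zl: "lookup z l < 2 ^ r" using k(1) 2 p(1) by simp
          have "dig (lookup z l) \<subseteq> {..<r}" using zl by (rule dig_subset)
          then have "dig (lookup z l) = {..<r}" using c by (intro card_seteq) auto
          then have "lookup z l = lookup p l" using dp by (metis dig_eq_iff)
          then show ?thesis using k(1) 2 by simp
        next
          \<comment> \<open>\<open>z\<close> and \<open>p\<close> have the same digits to
            distribute; the rest of \<open>z\<close> is smaller, and its contribution is at most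
            that of \<open>p\<close>.\<close>
          case 3
          then have zl: "lookup z l = lookup p l" using k(2) by blast
          have "del l z < del l p"
          proof (rule less_expoI[of _ "k - 1"])
            have "skip l (k - 1) = k" using 3 by (auto simp: skip_def)
            then show "lookup (del l z) (k - 1) < lookup (del l p) (k - 1)"
              using k(1) by (simp add: lookup_del)
            fix j assume "j < k - 1"
            then have "skip l j < k" by (auto simp: skip_def)
            then show "lookup (del l z) j = lookup (del l p) j" using k(2) by (simp add: lookup_del)
          qed
          moreover have "contrib (dig (lookup z l)) f \<le> wvec 0 r M"
            using cle f unfolding zl dp by blast
          ultimately show ?thesis unfolding p(2)[symmetric] by (rule add_less_le_mono)
        qed
      qed
      moreover have "wt (?y z f) \<le> wt x" using wy[of z f] p(3) zp(1) by simp
      ultimately show ?thesis unfolding mless_iff by auto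
    qed
    then show "?T (mon z) \<in> low t n x" using TP[OF z(1)] unfolding Tm by (intro low_sum_mon) auto
  qed
qed

section \<open>Admissibility of psi(x) in the case \<open>u = 2\<close>\<close>

lemma less_mask: "dig a \<subset> {..<r} \<Longrightarrow> a < 2 ^ r - 1"
proof -
  assume a: "dig a \<subset> {..<r}"
  obtain i where "i \<in> {..<r} - dig a" using a by blast
  then have "(\<Sum>i\<in>dig a. 2 ^ i) < (\<Sum>i\<in>{..<r}. 2 ^ i :: nat)"
    using a by (intro sum_strict_mono2[of "{..<r}" "dig a" i]) auto
  also have "(\<Sum>i\<in>{..<r}. 2 ^ i :: nat) = (\<Sum>i\<in>dig (2 ^ r - 1). 2 ^ i)" by (simp only: dig_mask)
  finally show ?thesis by (simp only: sum_dig)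
qed

text \<open>The contributions to \<open>X A\<close> of the substitution \<open>X l \<mapsto> \<Sum>M\<close> cancel against those of
  \<open>X l \<mapsto> X A\<close>, \<open>X (l\<^sub>1) \<mapsto> \<Sum>M'\<close>, except for the one that produces \<open>x\<close>.\<close>

lemma psi_second_terms:
  assumes l: "l \<in> {1..Suc t}" and M: "sorted_wrt (<) (A # M')" "set (A # M') \<subseteq> {l..t}"
      "length (A # M') = r" "M' \<noteq> []"
    and xA: "lookup x A = 2 ^ r - 1"
    and p: "lookup p l = 2 ^ r - 1" "del l p + wvec 1 r M' = x" "wt p = wt x"
    and z: "z = p \<or> mless z p"
  defines "\<tau> \<equiv> \<lambda>k. if k = l then A else unskip l k"
  defines "Good \<equiv> \<lambda>y. mless y x \<or> l < A \<and> lookup y A < 2 ^ r - 1 \<and> wt y \<le> wt x"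
  defines "F \<equiv> \<lambda>f. subsum (unskip l) l (set (A # M')) f + subsum \<tau> (skip l A) (set M') f"
  shows "\<forall>y\<in>keys (F (mon z) + (if z = p then mon x else 0)). Good y"
proof -
  let ?M = "set (A # M')"
  let ?l = "skip l A"
  let ?D1 = "dig (lookup z l)" and ?D2 = "dig (lookup z ?l)"
  let ?y1 = "\<lambda>f. del l z + contrib ?D1 f" and ?y2 = "\<lambda>f. relabel \<tau> ?l z + contrib ?D2 f"
  let ?S1 = "surj_maps ?D1 ?M" and ?S2 = "surj_maps ?D2 (set M')"
  \<comment> \<open>The cancellation below takes place between whole sums, so goodness is tracked
    for polynomials.\<close>
  define G where "G = {f :: mpol. \<forall>y\<in>keys f. Good y}"
  have G0: "0 \<in> G" by (simp add: G_def)
  have Gadd: "f + g \<in> G" if "f \<in> G" "g \<in> G" for f g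
    using that subsetD[OF Poly_Mapping.keys_add[of f g]] unfolding G_def by blast
  have Gsum: "(\<Sum>i\<in>I. mon (h i)) \<in> G" if "\<And>i. i \<in> I \<Longrightarrow> Good (h i)" for I and h :: "(nat \<Rightarrow> nat) \<Rightarrow> expo"
    using that
  proof (induction I rule: infinite_finite_induct)
    case (insert i I)
    then have "mon (h i) \<in> G" by (simp add: G_def)
    then show ?case using insert Gadd by simp
  qed (simp_all add: G0)
  have Fz: "F (mon z) = (\<Sum>f\<in>?S1. mon (?y1 f)) + (\<Sum>f\<in>?S2. mon (?y2 f))"
    unfolding F_def by (simp only: subsum_mon List.finite_set)
  have gt: "A < b" if "b \<in> set M'" for b using M(1) that by simp
  have lA: "l \<le> A" using M(2) by simp
  have AM': "A \<notin> set M'" using gt by blast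
  have l1: "?l = Suc A" using lA by (simp add: skip_def)
  have cM: "card ?M = r" using M(1,3) by (metis distinct_card strict_sorted_iff)
  have cM': "card (set M') = r - 1" using cM AM' by simp
  have r2: "2 \<le> r" using M(3,4) by (cases M') auto
  \<comment> \<open>In the second family position \<open>A\<close> inherits the exponent of
    \<open>X l\<close>, because \<open>X ?l\<close>, its usual source, is the variable whose digits
    are distributed.\<close>
  have b2: "lookup (relabel \<tau> ?l z) j = (if j = A then lookup z l else lookup z (skip l j))" for j
  proof -
    have inj: "inj_on \<tau> (K - {?l})" for K
    proof (rule inj_onI)
      fix a b assume a: "a \<in> K - {?l}" "b \<in> K - {?l}" "\<tau> a = \<tau> b"
      have A: "unskip l c = A \<longleftrightarrow> c = ?l" if "c \<noteq> l" for c
        using that lA by (auto simp: unskip_def skip_def)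
      have U: "unskip l a = unskip l b \<longleftrightarrow> a = b" if "a \<noteq> l" "b \<noteq> l"
        using that by (auto simp: unskip_def split: if_splits)
      show "a = b" using a A[of a] A[of b] U by (auto simp: \<tau>_def split: if_splits)
    qed
    show ?thesis
    proof (cases "j = A")
      case True
      have "lookup (relabel \<tau> ?l z) (\<tau> l) = lookup z l"
        using inj not_sym[OF skip_neq[of l A]] by (intro lookup_relabel_inj) auto
      then show ?thesis using True by (simp add: \<tau>_def)
    next
      case False
      then have ne: "skip l j \<noteq> ?l" by (metis unskip_skip)
      then have "lookup (relabel \<tau> ?l z) (\<tau> (skip l j)) = lookup z (skip l j)"
        using inj by (intro lookup_relabel_inj) auto
      then show ?thesis using False by (simp add: \<tau>_def)
    qed
  qed
  have fin: "finite ?S1" "finite ?S2" by simp_all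
  have w1: "wt (?y1 f) \<le> wt z" and w2: "wt (?y2 f) \<le> wt z" for f
    by (rule wt_relabel_contrib)+
  have c0: "lookup (contrib D f) j = 0" if "f \<in> surj_maps D K" "j \<notin> K" "finite D" for D f K j
  proof -
    have "{i \<in> D. f i = j} = {}" using that(1,2) unfolding surj_maps_def by blast
    then show ?thesis using that(3) by (simp only: lookup_contrib sum.empty)
  qed
  have nM: "j \<notin> ?M" "j \<notin> set M'" if "j < A" for j
    using that gt[of j] by auto
  have y1j: "lookup (?y1 f) j = lookup z (skip l j)" if "f \<in> ?S1" "j < A" for f j
    using c0[OF that(1) nM(1)[OF that(2)] finite_dig] by (simp add: lookup_add lookup_del)
  have y2j: "lookup (?y2 f) j = lookup z (skip l j)" if "f \<in> ?S2" "j < A" for f j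
    using c0[OF that(1) nM(2)[OF that(2)] finite_dig] that(2) by (simp add: lookup_add b2)
  have y2A: "lookup (?y2 f) A = lookup z l" if "f \<in> ?S2" for f
    using c0[OF that AM' finite_dig] by (simp add: lookup_add b2)
  have wv0: "lookup (wvec 1 r M') j = 0" if "j \<le> A" for j
    using that gt[of j] by (intro wvec_lookup_zero) auto
  have xj: "lookup x j = lookup p (skip l j)" if "j \<le> A" for j
    unfolding p(2)[symmetric] using wv0[OF that] by (simp add: lookup_add lookup_del)
  have "F (mon z) + (if z = p then mon x else 0) \<in> G"
  proof (cases "wt z < wt p")
    case True
    then have "z \<noteq> p" by auto
    have "Good (?y1 f)" "Good (?y2 f)" for f
      unfolding Good_def mless_iff using le_less_trans[OF w1 True] le_less_trans[OF w2 True] p(3) by simp_all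
    then show ?thesis using \<open>z \<noteq> p\<close> unfolding Fz by (simp add: Gadd Gsum)
  next
    case False
    then have zp: "wt z = wt p" "z = p \<or> z < p" using z unfolding mless_iff by auto
    have wx1: "wt (?y1 f) \<le> wt x" and wx2: "wt (?y2 f) \<le> wt x" for f
      using w1[of f] w2[of f] zp(1) p(3) by simp_all
    have good1: "Good (?y1 f)" if "?y1 f < x" for f
      using that wx1[of f] unfolding Good_def mless_iff by auto
    have good2: "Good (?y2 f)" if "?y2 f < x" for f
      using that wx2[of f] unfolding Good_def mless_iff by auto
    \<comment> \<open>A first difference before \<open>A\<close> and away from \<open>l\<close>
      persists in every term, since both families contribute only from \<open>A\<close> on.\<close>
    have early: ?thesis if j: "j < A" "lookup z (skip l j) < lookup p (skip l j)"
      "\<And>i. i < j \<Longrightarrow> lookup z (skip l i) = lookup p (skip l i)" for j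
    proof -
      have "z \<noteq> p" using j by auto
      have "Good (?y1 f)" if "f \<in> ?S1" for f
        using that j by (intro good1 less_expoI[of _ j]) (auto simp: y1j xj)
      moreover have "Good (?y2 f)" if "f \<in> ?S2" for f
        using that j by (intro good2 less_expoI[of _ j]) (auto simp: y2j xj)
      ultimately show ?thesis using \<open>z \<noteq> p\<close> unfolding Fz by (simp add: Gadd Gsum)
    qed
    show ?thesis
    proof (cases "lookup z l = lookup p l \<and> (\<forall>j<A. lookup z (skip l j) = lookup p (skip l j))")
      case False
      then have zlt: "z < p" using zp(2) by auto
      obtain k where k: "lookup z k < lookup p k" "\<And>j. j < k \<Longrightarrow> lookup z j = lookup p j"
        using less_expoE[OF zlt] by blast
      have kA: "k \<le> A"
      proof (rule ccontr)
        assume "\<not> k \<le> A"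
        then have "lookup z l = lookup p l \<and> (\<forall>j<A. lookup z (skip l j) = lookup p (skip l j))"
          using lA by (auto intro!: k(2) simp: skip_def)
        then show False using False by blast
      qed
      show ?thesis
      proof (cases "k = l")
        case True
        have zl: "lookup z l < 2 ^ r - 1" using k(1) True p(1) by simp
        \<comment> \<open>A number below \<open>2 ^ r - 1\<close> has fewer than \<open>r\<close>
          digits, too few to cover the \<open>r\<close> positions.\<close>
        have "?S1 = {}"
        proof (rule ccontr)
          assume "?S1 \<noteq> {}"
          then obtain f where "f \<in> ?S1" by blast
          then have "r \<le> card ?D1" using surj_maps_card[of ?D1 f ?M] cM by simp
          moreover have "?D1 \<subseteq> {..<r}" using zl by (intro dig_subset) simp
          ultimately have "?D1 = {..<r}" by (intro card_seteq) auto
          then have "lookup z l = 2 ^ r - 1" using dig_mask[of r] by (metis dig_eq_iff)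
          then show False using zl by simp
        qed
        moreover have "Good (?y2 f)" if f: "f \<in> ?S2" for f
        proof (cases "l < A")
          \<comment> \<open>The exceptional terms arise here: \<open>z\<close> is compared with
            \<open>p\<close> only up to \<open>l\<close>, so its exponents between \<open>l\<close>
            and \<open>?l\<close> may be larger, and only the small exponent at \<open>A\<close> is
            known.\<close>
          case True
          then show ?thesis unfolding Good_def using y2A[OF f] zl wx2[of f] by simp
        next
          \<comment> \<open>With \<open>l = A\<close> nothing lies in between, and the smaller
            exponent at \<open>A\<close> decides.\<close>
          case F: False
          then have "l = A" using lA by simp
          show ?thesis
          proof (intro good2 less_expoI[of _ A])
            show "lookup (?y2 f) A < lookup x A" using y2A[OF f] zl xA by simp
            fix j assume j: "j < A"
            then have "skip l j = j" "j < k" using \<open>l = A\<close> True by (simp_all add: skip_def)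
            then show "lookup (?y2 f) j = lookup x j" using y2j[OF f j] xj[of j] j k(2) by simp
          qed
        qed
        moreover have "z \<noteq> p" using zlt by auto
        ultimately show ?thesis unfolding Fz by (simp add: Gsum)
      next
        case False
        define j where "j = unskip l k"
        have sj: "skip l j = k" using False by (auto simp: j_def skip_def unskip_def)
        have "j < A" using kA False lA by (auto simp: j_def unskip_def)
        moreover have "lookup z (skip l i) = lookup p (skip l i)" if "i < j" for i
        proof -
          have "skip l i < skip l j" using that by (auto simp: skip_def)
          then show ?thesis using k(2) sj by simp
        qed
        ultimately show ?thesis using early[of j] k(1) sj by simp
      qed
    next
      case True
      then have zl: "lookup z l = 2 ^ r - 1" and zj: "\<And>j. j < A \<Longrightarrow> lookup z (skip l j) = lookup p (skip l j)"
        using p(1) by auto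
      have D1: "?D1 = {..<r}" unfolding zl by (rule dig_mask)
      have pl1: "lookup p ?l = 2 ^ r - 1" using xj[of A] xA by simp
      have zl1: "lookup z ?l \<le> 2 ^ r - 1"
      proof (cases "z = p")
        case False
        then obtain k where k: "lookup z k < lookup p k" "\<And>j. j < k \<Longrightarrow> lookup z j = lookup p j"
          using less_expoE zp(2) by blast
        have "k \<noteq> l" using k(1) True by auto
        then have sk: "skip l (unskip l k) = k" by (auto simp: skip_def unskip_def)
        have "\<not> unskip l k < A" using zj[of "unskip l k"] k(1) unfolding sk by auto
        then have "?l \<le> k" using \<open>k \<noteq> l\<close> lA unfolding l1 by (auto simp: unskip_def split: if_splits)
        then show ?thesis using k pl1 by (cases "k = ?l") auto
      qed (use pl1 in simp)
      have bij: "inj_on f {..<r}" if "f \<in> ?S1" for f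
      proof -
        have "f ` {..<r} = ?M" using that unfolding surj_maps_def D1 by blast
        then have "card (f ` {..<r}) = card {..<r}" using cM by simp
        then show ?thesis by (intro eq_card_imp_inj_on) auto
      qed
      have ex: "\<exists>i<r. f i = A" if "f \<in> ?S1" for f
      proof -
        have "A \<in> f ` {..<r}" using that unfolding surj_maps_def D1 by simp
        then show ?thesis by blast
      qed
      \<comment> \<open>A digit that arrives at \<open>A\<close> and is already present in the
        exponent there forces a carry.\<close>
      have overlap: "Good (?y1 f)" if "i < r" "f i = A" "i \<in> ?D2" for f i
      proof -
        have "i \<in> dig (lookup (del l z) A) \<inter> dig (lookup (contrib ?D1 f) A)"
          using that unfolding D1 by (simp add: dig_contrib lookup_del)
        then have "wt (?y1 f) < wt z" by (intro wt_relabel_contrib_overlap[of _ _ _ A]) blast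
        then show ?thesis unfolding Good_def mless_iff using zp(1) p(3) by simp
      qed
      show ?thesis
      proof (cases "lookup z ?l = 2 ^ r - 1")
        \<comment> \<open>\<open>A\<close> already has all \<open>r\<close> digits, so every term of
          the first family collides. The second family then acts as in the case
          \<open>u = 1\<close>, now with one surplus digit.\<close>
        case z1: True
        have D2: "?D2 = {..<r}" unfolding z1 by (rule dig_mask)
        have P: "(\<Sum>f\<in>?S1. mon (?y1 f)) \<in> G"
        proof (rule Gsum)
          fix f assume "f \<in> ?S1"
          then obtain i where "i < r" "f i = A" using ex by blast
          then show "Good (?y1 f)" using overlap[of i f] D2 by simp
        qed
        have b: "relabel \<tau> ?l z = del l z"
          by (rule poly_mapping_eqI) (simp add: b2 lookup_del zl z1)
        have M': "sorted_wrt (<) M'" "length M' + 1 = r" using M by auto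
        obtain f0 where f0: "f0 \<in> surj_maps {..<r} (set M')" "contrib {..<r} f0 = wvec 1 r M'"
          "\<And>f. f \<in> surj_maps {..<r} (set M') \<Longrightarrow> f \<noteq> f0 \<Longrightarrow> contrib {..<r} f < wvec 1 r M'"
          using contrib_le_wvec[OF M'] M(4) by auto
        show ?thesis
        proof (cases "z = p")
          case zp': True
          have "(\<Sum>f\<in>?S2. mon (?y2 f)) = mon (?y2 f0) + (\<Sum>f\<in>?S2 - {f0}. mon (?y2 f))"
            using f0(1) D2 by (intro sum.remove) auto
          also have "?y2 f0 = x" unfolding b D2 f0(2) using p(2) zp' by simp
          finally have "(\<Sum>f\<in>?S2. mon (?y2 f)) + mon x = (\<Sum>f\<in>?S2 - {f0}. mon (?y2 f))"
            by (simp only: mpol_add_cancel)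
          also have "\<dots> \<in> G"
          proof (rule Gsum)
            fix f assume f: "f \<in> ?S2 - {f0}"
            then have "contrib {..<r} f < wvec 1 r M'" using f0(3) D2 by simp
            then have "?y2 f < x" unfolding b D2 p(2)[symmetric] using zp' by simp
            then show "Good (?y2 f)" by (rule good2)
          qed
          finally show ?thesis using Gadd[OF P] zp' unfolding Fz by (simp add: add.assoc)
        next
          case False
          then have "z < p" using zp(2) by blast
          then obtain k where k: "lookup z k < lookup p k" "\<And>j. j < k \<Longrightarrow> lookup z j = lookup p j"
            using less_expoE by blast
          have "k \<noteq> l" using k(1) True by auto
          then have sk: "skip l (unskip l k) = k" by (auto simp: skip_def unskip_def)
          have dl: "del l z < del l p"
          proof (rule less_expoI[of _ "unskip l k"])
            show "lookup (del l z) (unskip l k) < lookup (del l p) (unskip l k)"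
              unfolding lookup_del sk by (rule k(1))
            fix j assume "j < unskip l k"
            then have "skip l j < skip l (unskip l k)" by (auto simp: skip_def)
            then show "lookup (del l z) j = lookup (del l p) j"
              unfolding lookup_del sk by (rule k(2))
          qed
          have "(\<Sum>f\<in>?S2. mon (?y2 f)) \<in> G"
          proof (rule Gsum)
            fix f assume f: "f \<in> ?S2"
            then have "contrib {..<r} f \<le> wvec 1 r M'"
              using f0 D2 by (cases "f = f0") (auto intro: less_imp_le)
            then have "?y2 f < x" unfolding b D2 p(2)[symmetric] using dl by (intro add_less_le_mono)
            then show "Good (?y2 f)" by (rule good2)
          qed
          then show ?thesis using P False unfolding Fz by (simp add: Gadd)
        qed
      next
        case z1: False
        then have z1': "lookup z ?l < 2 ^ r - 1" using zl1 by simp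
        have znp: "z \<noteq> p" using z1 pl1 by auto
        have D2s: "?D2 \<subseteq> {..<r}" using z1' by (intro dig_subset) simp
        have D2n: "?D2 \<noteq> {..<r}"
        proof
          assume "?D2 = {..<r}"
          then show False using z1 dig_mask[of r] by (metis dig_eq_iff)
        qed
        \<comment> \<open>Without a collision \<open>A\<close> gains exactly one digit. Unless this
          completes \<open>2 ^ r - 1\<close>, its exponent stays below that of \<open>x\<close>,
          while all earlier exponents agree.\<close>
        have good_if: "Good (?y1 f)" if f: "f \<in> ?S1" "i < r" "f i = A" "insert i ?D2 \<noteq> {..<r}" for f i
        proof (cases "i \<in> ?D2")
          case True
          then show ?thesis using overlap f by blast
        next
          case False
          have "{i' \<in> ?D1. f i' = A} = {i}"
            using bij[OF f(1)] f(2,3) unfolding D1 inj_on_def by blast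
          then have "dig (lookup (contrib ?D1 f) A) = {i}" by (simp add: dig_contrib)
          moreover have "dig (lookup (del l z) A) = ?D2" by (simp add: lookup_del)
          ultimately have "dig (lookup (?y1 f) A) = insert i ?D2"
            using False dig_add_disjoint[of "lookup (del l z) A" "lookup (contrib ?D1 f) A"]
            by (simp add: lookup_add)
          then have "dig (lookup (?y1 f) A) \<subset> {..<r}" using f(2,4) D2s by auto
          then have lt: "lookup (?y1 f) A < lookup x A" unfolding xA by (rule less_mask)
          show ?thesis
          proof (intro good1 less_expoI[of _ A] lt)
            fix j assume "j < A"
            then show "lookup (?y1 f) j = lookup x j" using y1j[OF f(1)] zj xj[of j] by simp
          qed
        qed
        show ?thesis
        proof (cases "card ?D2 = r - 1")
          \<comment> \<open>With fewer than \<open>r - 1\<close> digits the second family is empty,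
            and no single digit completes the exponent at \<open>A\<close>.\<close>
          case False
          have "card ?D2 < r"
            using psubset_card_mono[of "{..<r}" ?D2] D2s D2n by auto
          then have cD: "card ?D2 < r - 1" using False by simp
          then have "?S2 = {}" using surj_maps_card[of ?D2 _ "set M'"] cM' by fastforce
          moreover have "Good (?y1 f)" if f: "f \<in> ?S1" for f
          proof -
            obtain i where i: "i < r" "f i = A" using ex[OF f] by blast
            have "card (insert i ?D2) \<le> Suc (card ?D2)" by (rule card_insert_le_m1) auto
            then have "card (insert i ?D2) \<noteq> card {..<r}" using cD by simp
            then have "insert i ?D2 \<noteq> {..<r}" by metis
            then show ?thesis using good_if f i by blast
          qed
          ultimately show ?thesis using znp unfolding Fz by (simp add: Gsum)
        next
          case cD: True
          have "card ({..<r} - ?D2) = 1"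
            using card_Diff_subset[OF finite_dig D2s] cD r2 by simp
          then obtain i0 where i0: "{..<r} - ?D2 = {i0}" by (metis card_1_singletonE)
          have i0r: "i0 < r" "i0 \<notin> ?D2" using i0 by auto
          have Dr: "{..<r} = insert i0 ?D2" using i0 D2s by auto
          let ?Sa = "{f \<in> ?S1. f i0 = A}" and ?Sb = "{f \<in> ?S1. f i0 \<noteq> A}"
          have "?S1 = ?Sa \<union> ?Sb" by blast
          then have sp: "(\<Sum>f\<in>?S1. mon (?y1 f)) = (\<Sum>f\<in>?Sa. mon (?y1 f)) + (\<Sum>f\<in>?Sb. mon (?y1 f))"
            using sum.union_disjoint[of ?Sa ?Sb "\<lambda>f. mon (?y1 f)"] fin(1) by fastforce
          have notA: "f i \<noteq> A" if "f \<in> ?Sa" "i \<in> ?D2" for f i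
          proof
            assume "f i = A"
            moreover have "f \<in> ?S1" "f i0 = A" using that by auto
            ultimately have "i = i0" using bij[of f] that(2) i0r D2s unfolding inj_on_def by blast
            then show False using that i0r by blast
          qed
          \<comment> \<open>Sending the missing digit \<open>i0\<close> to \<open>A\<close>
            completes \<open>2 ^ r - 1\<close> there and leaves the digits in \<open>?D2\<close> for
            \<open>M'\<close>. This is a term of the second family, where \<open>A\<close> receives
            \<open>2 ^ r - 1\<close> from \<open>X l\<close>; restriction to \<open>?D2\<close> and
            extension by \<open>i0\<close> are mutually inverse.\<close>
          have eq: "(\<Sum>f\<in>?Sa. mon (?y1 f)) = (\<Sum>f\<in>?S2. mon (?y2 f))"
          proof (rule sum.reindex_bij_witness[of _ "\<lambda>g. g(i0 := A)" "\<lambda>f. restrict f ?D2"])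
            fix f assume f: "f \<in> ?Sa"
            have fE: "f \<in> {..<r} \<rightarrow>\<^sub>E ?M" "f ` {..<r} = ?M" using f unfolding surj_maps_def D1 by auto
            show "(restrict f ?D2)(i0 := A) = f"
            proof
              fix i
              show "((restrict f ?D2)(i0 := A)) i = f i"
              proof (cases "i \<in> {..<r}")
                case True
                then show ?thesis using f unfolding Dr by auto
              next
                case False
                then show ?thesis using fE(1) unfolding Dr by (auto simp: PiE_iff extensional_def)
              qed
            qed
            have "f ` ?D2 = set M'"
            proof -
              have "insert A (f ` ?D2) = insert A (set M')" using fE(2) f unfolding Dr by auto
              moreover have "A \<notin> f ` ?D2" using notA[OF f] by blast
              ultimately show ?thesis using AM' by (metis insert_ident)
            qed
            then show "restrict f ?D2 \<in> ?S2" unfolding surj_maps_def by auto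
            have "?y2 (restrict f ?D2) = ?y1 f"
            proof (rule poly_mapping_eqI)
              fix j
              show "lookup (?y2 (restrict f ?D2)) j = lookup (?y1 f) j"
              proof (cases "j = A")
                case True
                have "{i \<in> ?D2. restrict f ?D2 i = A} = {}" using notA[OF f] by auto
                then have "lookup (?y2 (restrict f ?D2)) A = 2 ^ r - 1"
                  using zl by (simp add: lookup_add b2 lookup_contrib)
                moreover have "{i \<in> ?D1. f i = A} = {i0}"
                  using notA[OF f] f unfolding D1 Dr by auto
                then have "lookup (?y1 f) A = lookup z ?l + 2 ^ i0"
                  by (simp add: lookup_add lookup_del lookup_contrib)
                moreover have "lookup z ?l + 2 ^ i0 = 2 ^ r - 1"
                proof -
                  have "(\<Sum>i\<in>dig (2 ^ r - 1). 2 ^ i) = (2::nat) ^ i0 + (\<Sum>i\<in>?D2. 2 ^ i)"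
                    unfolding dig_mask Dr using i0r by simp
                  then show ?thesis by (simp only: sum_dig add.commute)
                qed
                ultimately show ?thesis using True by simp
              next
                case False
                have "{i \<in> ?D2. restrict f ?D2 i = j} = {i \<in> ?D1. f i = j}"
                  using False f unfolding D1 Dr by auto
                then show ?thesis using False by (simp add: lookup_add b2 lookup_del lookup_contrib)
              qed
            qed
            then show "mon (?y2 (restrict f ?D2)) = mon (?y1 f)" by simp
          next
            fix g assume g: "g \<in> ?S2"
            have gE: "g \<in> ?D2 \<rightarrow>\<^sub>E set M'" "g ` ?D2 = set M'" using g unfolding surj_maps_def by auto
            show "restrict (g(i0 := A)) ?D2 = g"
              using gE(1) i0r by (auto simp: fun_eq_iff PiE_iff extensional_def restrict_def)
            have gi: "(g(i0 := A)) ` ?D2 = g ` ?D2" using i0r by (intro image_cong) auto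
            have "(g(i0 := A)) ` {..<r} = ?M" unfolding Dr image_insert gi gE(2) by simp
            moreover have "g(i0 := A) \<in> {..<r} \<rightarrow>\<^sub>E ?M"
            proof (rule PiE_I)
              fix i assume "i \<in> {..<r}"
              then show "(g(i0 := A)) i \<in> ?M" using PiE_mem[OF gE(1), of i] unfolding Dr by auto
            next
              fix i assume "i \<notin> {..<r}"
              then show "(g(i0 := A)) i = undefined" using PiE_arb[OF gE(1), of i] unfolding Dr by auto
            qed
            ultimately show "g(i0 := A) \<in> ?Sa" unfolding surj_maps_def D1 by simp
          qed
          have "(\<Sum>f\<in>?Sb. mon (?y1 f)) \<in> G"
          proof (rule Gsum)
            fix f assume f: "f \<in> ?Sb"
            then obtain i where i: "i < r" "f i = A" using ex[of f] by blast
            have "i \<noteq> i0" using f i(2) by blast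
            moreover have "i \<in> insert i0 ?D2" using i(1) unfolding Dr[symmetric] by simp
            ultimately have "i \<in> ?D2" by blast
            then show "Good (?y1 f)" using overlap i by blast
          qed
          then show ?thesis using znp unfolding Fz sp eq by (simp only: if_False add_0_right mpol_add_cancel)
        qed
      qed
    qed
  qed
  then show ?thesis unfolding G_def by blast
qed

text \<open>The transfer consists of both families, Kameko's map and a map \<open>pr\<close> that
  fixes \<open>b\<close> up to smaller monomials and takes care of the exceptional terms. Kameko's
  map kills every monomial with an even exponent; on the others the order and the bound at
  \<open>A\<close> pass to the halves.\<close>

lemma psi_admissible_second:
  assumes l: "l \<in> {1..Suc t}" and M: "sorted_wrt (<) (A # M')" "set (A # M') \<subseteq> {l..t}"
      "length (A # M') = r" "M' \<noteq> []"
    and b: "b \<in> Exps t d" "\<not> inadmissible t d b" "lookup b A = 2 ^ (r - 1) - 1"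
    and p: "lookup p l = 2 ^ r - 1" "del l p + wvec 1 r M' = dbl {1..t} b"
      "wt p = wt (dbl {1..t} b)" "edeg p = t + 2 * d"
    and pr: "\<And>f g. pr (f + g) = pr f + (pr g :: mpol)" "\<And>f. f \<in> hits t d \<Longrightarrow> pr f \<in> hits t d"
      "pr (mon b) + mon b \<in> low t d b"
      "\<And>c. c \<in> Exps t d \<Longrightarrow> mless c b \<Longrightarrow> pr (mon c) \<in> low t d b"
      "\<And>c. c \<in> Exps t d \<Longrightarrow> l < A \<Longrightarrow> lookup c A < 2 ^ (r - 1) - 1 \<Longrightarrow> wt c \<le> wt b \<Longrightarrow>
        pr (mon c) \<in> low t d b"
  shows "\<not> inadmissible (Suc t) (t + 2 * d) p"
proof -
  let ?x = "dbl {1..t} b" and ?n = "t + 2 * d"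
  let ?\<tau> = "\<lambda>k. if k = l then A else unskip l k"
  define F where "F f = subsum (unskip l) l (set (A # M')) f + subsum ?\<tau> (skip l A) (set M') f" for f
  have At: "A \<in> {1..t}" using M(2) l by auto
  have r1: "r = Suc (r - 1)" using M(3) by auto
  have mask: "2 * (2 ^ (r - 1) - 1) + 1 = (2 ^ r - 1 :: nat)"
  proof -
    have "(2::nat) ^ r = 2 * 2 ^ (r - 1)" using r1 by (metis power_Suc)
    moreover have "(1::nat) \<le> 2 ^ (r - 1)" by simp
    ultimately show ?thesis by linarith
  qed
  have xA: "lookup ?x A = 2 ^ r - 1" using At b(3) mask by (simp add: lookup_dbl)
  have hom: "steenrod_hom (Suc t) t F"
    unfolding F_def[abs_def]
  proof (intro steenrod_hom_add steenrod_hom_subsum)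
    show "set (A # M') \<subseteq> {1..t}" "set M' \<subseteq> {1..t}" using M(2) l by auto
    show "unskip l k \<in> {1..t}" if "k \<in> {1..Suc t}" "k \<noteq> l" for k
      using that l by (auto simp: unskip_def)
    then show "?\<tau> k \<in> {1..t}" if "k \<in> {1..Suc t}" "k \<noteq> skip l A" for k
      using that At by simp
  qed
  have FP: "F f \<in> Pol t ?n" if "f \<in> Pol (Suc t) ?n" for f
    using hom that unfolding steenrod_hom_def by blast
  have Fadd: "F (f + g) = F f + F g" for f g using hom unfolding steenrod_hom_def by blast
  have xE: "?x \<in> Exps t ?n" using dbl_Exps[of "{1..t}" t b d] b(1) by simp
  have pE: "p \<in> Exps (Suc t) ?n" using l xE p(2,4) by (rule Exps_of_del)
  have pr0: "pr 0 = 0" using pr(1)[of 0 0] by simp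
  have prsum: "pr (\<Sum>i\<in>I. g i) = (\<Sum>i\<in>I. pr (g i))" for g :: "expo \<Rightarrow> mpol" and I
    by (induction I rule: infinite_finite_induct) (simp_all add: pr0 pr(1))
  have main: "pr (kdown t g) \<in> low t d b"
    if g: "g \<in> Pol t ?n" "\<forall>y\<in>keys g. mless y ?x \<or> l < A \<and> lookup y A < 2 ^ r - 1 \<and> wt y \<le> wt ?x" for g
  proof -
    have one: "pr (kdown t (mon y)) \<in> low t d b" if y: "y \<in> keys g" for y
    proof (cases "\<exists>c. y = dbl {1..t} c")
      case False
      then have "kdown t (mon y) = 0" by (intro kdown_not_dbl) blast
      then show ?thesis by (simp add: pr0)
    next
      case True
      then obtain c where c: "y = dbl {1..t} c" by blast
      have "y \<in> Exps t ?n" using g(1) y by (auto simp: Pol_def)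
      then have cE: "c \<in> Exps t d" unfolding c Exps_def by (simp add: keys_dbl edeg_dbl)
      have "mless y ?x \<or> l < A \<and> lookup y A < 2 ^ r - 1 \<and> wt y \<le> wt ?x" using g(2) y by blast
      then have "mless c b \<or> l < A \<and> lookup c A < 2 ^ (r - 1) - 1 \<and> wt c \<le> wt b"
      proof
        assume "mless y ?x"
        then show ?thesis unfolding c by (simp add: mless_dbl)
      next
        assume a: "l < A \<and> lookup y A < 2 ^ r - 1 \<and> wt y \<le> wt ?x"
        have "lookup y A = 1 + 2 * lookup c A" unfolding c using At by (simp add: lookup_dbl)
        then have "lookup c A < 2 ^ (r - 1) - 1" using a mask by linarith
        moreover have "wt c \<le> wt b"
          using a unfolding c not_less[symmetric] by (simp add: wt_dbl_less)
        ultimately show ?thesis using a by simp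
      qed
      then show ?thesis using pr(4,5)[OF cE] unfolding c by (auto simp only: kdown_dbl)
    qed
    have "pr (kdown t (\<Sum>y\<in>keys g. mon y)) \<in> low t d b"
      unfolding kdown_sum prsum using one by (rule low_sum)
    then show ?thesis unfolding mpol_eq_sum_mon[of g, symmetric] .
  qed
  have terms: "\<forall>y\<in>keys (F (mon z) + (if z = p then mon ?x else 0)).
      mless y ?x \<or> l < A \<and> lookup y A < 2 ^ r - 1 \<and> wt y \<le> wt ?x" if "z = p \<or> mless z p" for z
    unfolding F_def by (rule psi_second_terms[OF l M xA p(1-3) that])
  show ?thesis
  proof (rule admissible_transfer[where T = "\<lambda>f. pr (kdown t (F f))", OF _ _ pE b(1,2)])
    show "pr (kdown t (F (f + g))) = pr (kdown t (F f)) + pr (kdown t (F g))" for f g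
      by (simp only: Fadd kdown_add pr(1))
    show "pr (kdown t (F f)) \<in> hits t d" if "f \<in> hits (Suc t) ?n" for f
      using steenrod_hom_hits[OF hom that] by (intro pr(2) kdown_hits)
    have "pr (kdown t (F (mon p) + mon ?x)) \<in> low t d b"
    proof (rule main)
      show "F (mon p) + mon ?x \<in> Pol t ?n" using FP[of "mon p"] pE xE by (intro Pol_add) simp_all
    qed (use terms[of p] in simp)
    then have "pr (kdown t (F (mon p) + mon ?x)) + (pr (mon b) + mon b) \<in> low t d b"
      using pr(3) by (rule low_add)
    moreover have "pr (kdown t (F (mon p) + mon ?x)) + (pr (mon b) + mon b) = pr (kdown t (F (mon p))) + mon b"
      by (simp only: kdown_add kdown_dbl pr(1) add.assoc mpol_add_self_left)
    ultimately show "pr (kdown t (F (mon p))) + mon b \<in> low t d b" by (simp only:)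
    show "pr (kdown t (F (mon z))) \<in> low t d b" if z: "z \<in> Exps (Suc t) ?n" "mless z p" for z
    proof (rule main)
      show "F (mon z) \<in> Pol t ?n" using FP[of "mon z"] z by simp
      have "z \<noteq> p" using z(2) unfolding mless_iff by auto
      then show "\<forall>y\<in>keys (F (mon z)). mless y ?x \<or> l < A \<and> lookup y A < 2 ^ r - 1 \<and> wt y \<le> wt ?x"
        using terms[of z] z(2) by simp
    qed
  qed
qed

text \<open>The empty sum puts 0 for \<open>X a\<close>. Complementarily,
  \<open>f + setzero a f\<close> keeps exactly the monomials divisible by \<open>X a\<close>; both
  serve as projections.\<close>

definition setzero :: "nat \<Rightarrow> mpol \<Rightarrow> mpol" where
  "setzero a = lsub (\<lambda>k. if k = a then {} else {k})"

lemma setzero_mon: "setzero a (mon b) = (if lookup b a = 0 then mon b else 0)"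
proof -
  have s: "setzero a (mon b) = (\<Prod>j\<in>insert a (keys b). (\<Sum>i\<in>(if j = a then {} else {j}). X i) ^ lookup b j)"
    unfolding setzero_def by (rule lsub_mon) auto
  also have "\<dots> = 0 ^ lookup b a * (\<Prod>j\<in>keys b - {a}. X j ^ lookup b j)"
    by (subst prod.insert_remove) simp_all
  also have "\<dots> = (if lookup b a = 0 then mon b else 0)"
  proof (cases "lookup b a = 0")
    case True
    then have "keys b - {a} = keys b" by (auto simp: in_keys_iff)
    then show ?thesis using True mon_eq_prod[of "keys b" b] by simp
  qed simp
  finally show ?thesis .
qed

lemma setzero_add: "setzero a (f + g) = setzero a f + setzero a g"
  by (simp add: setzero_def lsub_add)

lemma steenrod_hom_setzero: "steenrod_hom t t (setzero a)"
  unfolding setzero_def by (rule steenrod_hom_lsub) auto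

section \<open>Some inadmissible monomials\<close>

lemma Sq_1_mon: "Sq 1 (mon m) = (\<Sum>j\<in>keys m. of_nat (lookup m j) * mon (m + single j 1))"
proof -
  have I: "{i. keys i \<subseteq> keys m \<and> edeg i = 1} = (\<lambda>j. single j 1) ` keys m"
  proof
    show "{i. keys i \<subseteq> keys m \<and> edeg i = 1} \<subseteq> (\<lambda>j. single j 1) ` keys m"
    proof
      fix i :: expo assume i: "i \<in> {i. keys i \<subseteq> keys m \<and> edeg i = 1}"
      then have "i \<noteq> 0" by auto
      then obtain j where j: "j \<in> keys i" using keys_eq_empty by blast
      have "edeg i = lookup i j + (\<Sum>k\<in>keys i - {j}. lookup i k)"
        unfolding edeg_def using j by (simp add: sum.remove)
      moreover have "lookup i j > 0" using j by (simp add: in_keys_iff)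
      moreover have e1: "edeg i = 1" using i by simp
      ultimately have l: "lookup i j = 1" "(\<Sum>k\<in>keys i - {j}. lookup i k) = 0" by linarith+
      have z: "lookup i k = 0" if "k \<noteq> j" for k
      proof (rule ccontr)
        assume "lookup i k \<noteq> 0"
        then have "k \<in> keys i - {j}" using that by (simp add: in_keys_iff)
        then have "lookup i k \<le> (\<Sum>k\<in>keys i - {j}. lookup i k)" by (intro member_le_sum) auto
        then show False using l(2) \<open>lookup i k \<noteq> 0\<close> by linarith
      qed
      have "i = single j 1"
        by (rule poly_mapping_eqI) (use l z in \<open>auto simp: lookup_single when_def\<close>)
      then show "i \<in> (\<lambda>j. single j 1) ` keys m" using i j by blast
    qed
  qed auto
  have inj: "inj_on (\<lambda>j. single j (1::nat)) (keys m)"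
  proof (rule inj_onI)
    fix i j :: nat assume "single i (1::nat) = single j 1"
    then have "lookup (single i (1::nat)) i = lookup (single j 1) i" by simp
    then show "i = j" by (simp add: lookup_single when_def split: if_splits)
  qed
  have c: "(\<Prod>k\<in>keys m. lookup m k choose lookup (single j 1) k) = lookup m j" if "j \<in> keys m" for j
  proof -
    have "(\<Prod>k\<in>keys m. lookup m k choose lookup (single j 1) k) =
        (\<Prod>k\<in>keys m. if k = j then lookup m j else 1)"
      by (intro prod.cong) (auto simp: lookup_single when_def)
    then show ?thesis using that by (simp add: prod.delta)
  qed
  show ?thesis unfolding Sq_mon I using inj c by (simp add: sum.reindex del: of_nat_prod)
qed

text \<open>Raising an odd exponent by one removes its digit 0 and adds 2, which carries exactly if
  digit 1 is set, that is, if \<open>a mod 4 = 3\<close>. The additive form avoids differences of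
  weights.\<close>

lemma dgv_odd_step:
  assumes "odd a"
  shows "dgv (a + 1) + dgv 1 \<le> dgv a + dgv 2"
    and "a mod 4 = 3 \<Longrightarrow> dgv (a + 1) + dgv 1 < dgv a + dgv 2"
    and "a mod 4 = 1 \<Longrightarrow> dgv (a + 1) + dgv 1 = dgv a + dgv 2"
proof -
  obtain c where a: "a = 2 * c + 1" using assms by (elim oddE)
  have d1: "dig 1 = {0}" "dig 2 = {1}" using dig_power[of 0] dig_power[of 1] by simp_all
  have d0: "0 \<notin> dig (2 * c)" by (simp add: dig_def bit_0)
  have da: "dgv a = dgv (2 * c) + dgv 1"
    unfolding a using d0 d1 by (intro dgv_add_disjoint) auto
  have s: "a + 1 = 2 * c + 2" using a by simp
  show "dgv (a + 1) + dgv 1 \<le> dgv a + dgv 2"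
    unfolding s da using dgv_add_le[of "2 * c" 2] by (simp add: add.assoc add.left_commute add.commute add_left_mono)
  have bit1: "1 \<in> dig (2 * c) \<longleftrightarrow> odd c" by (simp add: dig_def bit_iff_odd One_nat_def)
  show "dgv (a + 1) + dgv 1 < dgv a + dgv 2" if "a mod 4 = 3"
  proof -
    have "odd c" using that a by presburger
    then have "dgv (2 * c + 2) < dgv (2 * c) + dgv 2" using bit1 d1 by (intro dgv_add_overlap) auto
    then have "dgv (2 * c + 2) + dgv 1 < dgv (2 * c) + dgv 2 + dgv 1" by (rule add_strict_right_mono)
    then show ?thesis unfolding s da by (simp only: add.assoc add.commute add.left_commute)
  qed
  show "dgv (a + 1) + dgv 1 = dgv a + dgv 2" if "a mod 4 = 1"
  proof -
    have "even c" using that a by presburger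
    then have "dgv (2 * c + 2) = dgv (2 * c) + dgv 2" using bit1 d1 by (intro dgv_add_disjoint) auto
    then show ?thesis unfolding s da by (simp only: add.assoc add.commute add.left_commute)
  qed
qed

lemma wt_bump:
  assumes "j \<in> keys m"
  shows "wt (m + single j 1) + dgv (lookup m j) = wt m + dgv (lookup m j + 1)"
proof -
  have k: "keys (m + single j 1) = keys m" using assms by (auto simp: keys_add_expo)
  have "wt (m + single j 1) = dgv (lookup m j + 1) +
      (\<Sum>i\<in>keys m - {j}. dgv (lookup m i))"
    unfolding wt_def k using assms
    by (simp add: sum.remove[of _ j] lookup_add lookup_single when_def)
  moreover have "wt m = dgv (lookup m j) + (\<Sum>i\<in>keys m - {j}. dgv (lookup m i))"
    unfolding wt_def using assms by (simp add: sum.remove)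
  ultimately show ?thesis by (simp add: add.commute add.left_commute)
qed

text \<open>The relation is \<open>Sq 1\<close> of the monomial with the exponent at \<open>a\<close> decreased by one.\<close>

lemma inadmissible_Sq_1:
  assumes v: "v \<in> Exps t n" and a: "lookup v a mod 4 = 2"
    and j: "\<And>j. j \<in> {1..t} \<Longrightarrow> j < a \<Longrightarrow> even (lookup v j) \<or> lookup v j mod 4 = 3"
  shows "inadmissible t n v"
proof -
  define m where "m = v - single a 1"
  have lm: "lookup m j = lookup v j - (if j = a then 1 else 0)" for j
    unfolding m_def by (simp add: lookup_minus lookup_single when_def)
  have "\<exists>c. lookup v a = c + 1 \<and> c mod 4 = 1" using a by presburger
  then obtain c where c: "lookup v a = c + 1" "c mod 4 = 1" by blast
  have mc: "lookup m a = c" unfolding lm using c(1) by simp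
  have va: "lookup v a = lookup m a + 1" "lookup m a mod 4 = 1" unfolding mc by (fact c)+
  have vm: "v = m + single a 1"
  proof (rule poly_mapping_eqI)
    fix i show "lookup v i = lookup (m + single a 1) i"
    proof (cases "i = a")
      case True
      then show ?thesis by (simp add: lookup_add c mc)
    next
      case False
      then show ?thesis by (simp add: lookup_add lookup_single lm)
    qed
  qed
  have ma: "odd (lookup m a)" using va(2) by presburger
  then have ma: "a \<in> keys m" "odd (lookup m a)" by (auto simp: in_keys_iff intro: odd_pos)
  have km: "keys m = keys v" using ma(1) vm by (auto simp: keys_add_expo)
  have mE: "keys m \<subseteq> {1..t}" "edeg m + 1 = n"
    using v km vm edeg_add[of m "single a 1"] by (auto simp: Exps_def)
  define f where "f = (\<Sum>j\<in>keys m - {a}. of_nat (lookup m j) * mon (m + single j 1))"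
  have "Sq 1 (mon m) = of_nat (lookup m a) * mon v + f"
    unfolding Sq_1_mon f_def vm using ma(1) by (simp add: sum.remove)
  also have "(of_nat (lookup m a) :: mpol) = 1" using ma(2) by (simp add: of_nat_mpol)
  finally have s: "mon v + f = Sq 1 (mon m)" by simp
  have "f \<in> low t n v"
    unfolding f_def
  proof (rule low_sum)
    fix i assume i: "i \<in> keys m - {a}"
    let ?y = "m + single i 1"
    show "of_nat (lookup m i) * mon ?y \<in> low t n v"
    proof (cases "even (lookup m i)")
      case False
      have yE: "?y \<in> Exps t n" using i mE by (auto simp: Exps_def keys_add_expo edeg_add)
      have wy: "wt ?y + dgv (lookup m i) = wt m + dgv (lookup m i + 1)" using i by (intro wt_bump) simp
      have wv: "wt v + dgv (lookup m a) = wt m + dgv (lookup m a + 1)" unfolding vm using ma(1) by (rule wt_bump)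
      have "wt v + dgv (lookup m a) + dgv 1 = wt m + dgv (lookup m a) + dgv 2"
        unfolding wv using dgv_odd_step(3)[OF ma(2) va(2)] by (simp only: add.assoc)
      then have "dgv (lookup m a) + (wt v + dgv 1) = dgv (lookup m a) + (wt m + dgv 2)"
        by (simp only: add.assoc add.commute add.left_commute)
      then have wv': "wt v + dgv 1 = wt m + dgv 2" by (simp only: add_left_cancel)
      have y1: "wt ?y + (dgv (lookup m i) + dgv 1) = wt m + (dgv (lookup m i + 1) + dgv 1)"
        using wy by (simp only: add.assoc[symmetric])
      have v1: "wt v + (dgv (lookup m i) + dgv 1) = wt m + (dgv (lookup m i) + dgv 2)"
      proof -
        have "wt v + (dgv (lookup m i) + dgv 1) = dgv (lookup m i) + (wt v + dgv 1)"
          by (simp only: add.commute add.left_commute)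
        also have "\<dots> = wt m + (dgv (lookup m i) + dgv 2)"
          unfolding wv' by (simp only: add.commute add.left_commute)
        finally show ?thesis .
      qed
      have le: "wt ?y \<le> wt v"
      proof -
        have "wt ?y + (dgv (lookup m i) + dgv 1) \<le> wt v + (dgv (lookup m i) + dgv 1)"
          unfolding y1 v1 using dgv_odd_step(1)[OF False] by (rule add_left_mono)
        then show ?thesis by (rule add_le_imp_le_right)
      qed
      \<comment> \<open>Before \<open>a\<close> the odd exponents are 3 modulo 4, and the carry
        lowers the weight. After \<open>a\<close> the weight does not rise, and the exponent at
        \<open>a\<close> is one less than in \<open>v\<close>.\<close>
      have "mless ?y v"
      proof (cases "i < a")
        case True
        have "lookup m i = lookup v i" using i vm by (simp add: lookup_add lookup_single)
        then have "lookup m i mod 4 = 3" using j[of i] i mE True False by auto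
        then have "wt ?y + (dgv (lookup m i) + dgv 1) < wt v + (dgv (lookup m i) + dgv 1)"
          unfolding y1 v1 using dgv_odd_step(2)[OF False] by (intro add_strict_left_mono)
        then have "wt ?y < wt v" by (rule add_less_imp_less_right)
        then show ?thesis unfolding mless_iff by blast
      next
        case False
        then have "?y < v" using i unfolding vm
          by (intro less_expoI[of _ a]) (auto simp: lookup_add lookup_single when_def)
        then show ?thesis using le unfolding mless_iff by auto
      qed
      then show ?thesis using yE False by (simp add: of_nat_mpol)
    qed (simp add: of_nat_mpol)
  qed
  moreover have "Sq 1 (mon m) \<in> hits t n"
    using mE by (intro hitsI[where m = "edeg m"]) (auto simp: Exps_def)
  ultimately show ?thesis using inadmissible_iff[OF v] s by metis
qed

lemma lookup_Exps: "m \<in> Exps t n \<Longrightarrow> j \<notin> {1..t} \<Longrightarrow> lookup m j = 0"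
proof (rule ccontr)
  assume m: "m \<in> Exps t n" "j \<notin> {1..t}" "lookup m j \<noteq> 0"
  then have "j \<in> keys m" by (simp add: in_keys_iff)
  then show False using m(1,2) by (auto simp: Exps_def)
qed

lemma Exps_dbl:
  assumes x: "x \<in> Exps t n"
  obtains U v where "finite U" "U \<subseteq> {1..t}" "x = dbl U v" "v \<in> Exps t (edeg v)" "card U + 2 * edeg v = n"
proof -
  define U where "U = {j \<in> {1..t}. odd (lookup x j)}"
  have fU: "finite U" "U \<subseteq> {1..t}" by (auto simp: U_def)
  have "odd (lookup x j) \<longleftrightarrow> j \<in> U" for j
  proof (cases "j \<in> {1..t}")
    case False
    then show ?thesis using lookup_Exps[OF x False] unfolding U_def by simp
  qed (simp add: U_def)
  then obtain v where v: "x = dbl U v" using dbl_eqI[OF fU(1), of x] by blast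
  have "keys x \<subseteq> {1..t}" "edeg x = n" using x by (simp_all add: Exps_def)
  then have "v \<in> Exps t (edeg v)" "card U + 2 * edeg v = n"
    unfolding v keys_dbl[OF fU(1)] edeg_dbl by (simp_all add: Exps_def)
  then show ?thesis using that fU v by blast
qed

text \<open>Position 1 has no predecessors, so \<open>inadmissible_Sq_1\<close> asks only for an
  exponent 2 modulo 4. Higher digits are reached by halving, and \<open>inadmissible_dbl\<close>
  leads back.\<close>

lemma inadmissible_first_exponent:
  assumes "v \<in> Exps t n" "(lookup v 1 div 2 ^ k) mod 4 = 2"
  shows "inadmissible t n v"
  using assms
proof (induction k arbitrary: v n)
  case 0
  then show ?case by (intro inadmissible_Sq_1[of v t n 1]) auto
next
  case (Suc k)
  obtain U w where w: "finite U" "U \<subseteq> {1..t}" "v = dbl U w" "w \<in> Exps t (edeg w)" "card U + 2 * edeg w = n"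
    using Exps_dbl[OF Suc.prems(1)] by blast
  have "lookup w 1 = lookup v 1 div 2" unfolding w(3) using w(1) by (simp add: lookup_dbl)
  then have "(lookup w 1 div 2 ^ k) mod 4 = 2" using Suc.prems(2) by (simp add: div_mult2_eq)
  with w(4) have "inadmissible t (edeg w) w" by (rule Suc.IH)
  then show ?case using inadmissible_dbl[OF _ w(4,2)] unfolding w(3,5) by blast
qed

text \<open>Unless the digits of \<open>a\<close> form a block of ones from the bottom, some digit 1
  stands directly above a digit 0; the second alternative says so at place \<open>k\<close>.\<close>

lemma mask_or_pattern:
  "(\<exists>k. (a::nat) = 2 ^ k - 1) \<or> (\<exists>k. (a div 2 ^ k) mod 4 = 2)"
proof (induction a rule: less_induct)
  case (less a)
  show ?case
  proof (cases "a = 0 \<or> a mod 4 = 2")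
    case True
    then show ?thesis
    proof
      assume "a = 0"
      then have "a = 2 ^ 0 - 1" by simp
      then show ?thesis by blast
    next
      assume "a mod 4 = 2"
      then have "(a div 2 ^ 0) mod 4 = 2" by simp
      then show ?thesis by blast
    qed
  next
    case False
    then have "a div 2 < a" by auto
    from less.IH[OF this] show ?thesis
    proof
      assume "\<exists>k. a div 2 = 2 ^ k - 1"
      then obtain k where k: "a div 2 = 2 ^ k - 1" by blast
      have "odd a"
      proof (rule ccontr)
        assume "\<not> odd a"
        then have "a mod 4 = 0" using False by presburger
        then have "even (a div 2)" by presburger
        then have "k = 0" unfolding k by (cases k) simp_all
        then have "a div 2 = 0" using k by simp
        then have "a = 0" using \<open>\<not> odd a\<close> by presburger
        then show False using False by simp
      qed
      then have "a = 2 * (a div 2) + 1" by presburger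
      then have "a = 2 * (2 ^ k - 1) + 1" unfolding k .
      moreover have "(1::nat) \<le> 2 ^ k" by simp
      ultimately have "a = 2 ^ Suc k - 1" unfolding power_Suc by linarith
      then show ?thesis by blast
    next
      assume "\<exists>k. (a div 2 div 2 ^ k) mod 4 = 2"
      then obtain k where "(a div 2 div 2 ^ k) mod 4 = 2" by blast
      then have "(a div 2 ^ Suc k) mod 4 = 2" by (simp add: div_mult2_eq)
      then show ?thesis by blast
    qed
  qed
qed

section \<open>Sums of powers of two\<close>

text \<open>The binary digit sum. It serves to refute \<open>psum\<close>, since a sum of
  \<open>e\<close> powers of two has at most \<open>e\<close> ones.\<close>

fun popc :: "nat \<Rightarrow> nat" where
  "popc n = (if n = 0 then 0 else n mod 2 + popc (n div 2))"

declare popc.simps [simp del]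

lemma popc_double: "popc (2 * n) = popc n" "popc (Suc (2 * n)) = Suc (popc n)"
  by (subst popc.simps, simp add: popc.simps[of 0], subst popc.simps, simp)

text \<open>Only carries can interfere, and they clear ones. The induction on \<open>p\<close> moves
  the new digit to the bottom, where a second induction follows the carry.\<close>

lemma popc_add_power: "popc (n + 2 ^ p) \<le> Suc (popc n)"
proof (induction p arbitrary: n)
  case 0
  show ?case
  proof (induction n rule: less_induct)
    case (less n)
    show ?case
    proof (cases "even n")
      case True
      then obtain c where "n = 2 * c" by blast
      then show ?thesis by (simp add: popc_double)
    next
      case False
      then obtain c where c: "n = 2 * c + 1" by (elim oddE)
      then have "n + 2 ^ 0 = 2 * (c + 1)" by simp
      moreover have "popc (c + 1) \<le> Suc (popc c)" using less[of c] c by simp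
      ultimately show ?thesis unfolding c by (simp only: popc_double Suc_eq_plus1[symmetric])
    qed
  qed
next
  case (Suc p)
  show ?case
  proof (cases "even n")
    case True
    then obtain c where c: "n = 2 * c" by blast
    then have "n + 2 ^ Suc p = 2 * (c + 2 ^ p)" by simp
    then show ?thesis using Suc[of c] c by (simp only: popc_double)
  next
    case False
    then obtain c where c: "n = Suc (2 * c)" by (metis oddE Suc_eq_plus1)
    then have "n + 2 ^ Suc p = Suc (2 * (c + 2 ^ p))" by simp
    then show ?thesis using Suc[of c] c by (simp only: popc_double Suc_le_mono)
  qed
qed

lemma psum_popc: "psum e n \<Longrightarrow> popc n \<le> e"
proof (induction e arbitrary: n)
  case 0
  then show ?case by (simp add: popc.simps)
next
  case (Suc e)
  then obtain p where p: "2 ^ p \<le> n" "psum e (n - 2 ^ p)" by auto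
  have "popc n = popc (n - 2 ^ p + 2 ^ p)" using p(1) by simp
  also have "\<dots> \<le> Suc (popc (n - 2 ^ p))" by (rule popc_add_power)
  also have "\<dots> \<le> Suc e" using Suc.IH[OF p(2)] by simp
  finally show ?case .
qed

text \<open>47 is 5 + 42, since \<open>n + 5 = 47 * 2 ^ s\<close>. For \<open>s = k + 1\<close>,
  three or one odd exponents give the degrees \<open>47 * 2 ^ k - 1\<close> and
  \<open>47 * 2 ^ k - 2\<close>. As 46 is 101110 in binary, the former has \<open>4 + k\<close>
  ones.\<close>

lemma popc_47: "popc (47 * 2 ^ k - 1) = 4 + k" "4 \<le> popc (47 * 2 ^ k - 2)"
proof -
  have p: "popc (47 * 2 ^ k - 1) = 4 + k" for k
  proof (induction k)
    case (Suc k)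
    have "(1::nat) \<le> 2 ^ k" by simp
    then have "(47 * 2 ^ Suc k - 1 :: nat) = Suc (2 * (47 * 2 ^ k - 1))" unfolding power_Suc by linarith
    then show ?case using Suc by (simp only: popc_double add_Suc_right)
  qed (simp add: popc.simps)
  show "popc (47 * 2 ^ k - 1) = 4 + k" by (rule p)
  show "4 \<le> popc (47 * 2 ^ k - 2)"
  proof (cases k)
    case 0
    then show ?thesis by (simp add: popc.simps)
  next
    case (Suc j)
    have "47 * 2 ^ Suc j - 2 = (2 * (47 * 2 ^ j - 1) :: nat)" unfolding power_Suc by linarith
    then show ?thesis unfolding Suc using p[of j] by (simp only: popc_double)
  qed
qed

text \<open>The number \<open>e\<close> of odd exponents has the parity of \<open>n\<close>. For
  \<open>s > 0\<close> this leaves 1 and 3, refuted by at least four ones. For \<open>s = 0\<close>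
  the values 0 and 2 lead to 21 and 22, with three ones each, so 4 remains.\<close>

lemma psum_degree:
  assumes n: "n = 5 * (2 ^ s - 1) + 42 * 2 ^ s" and e: "e \<le> 4" "e + 2 * d = n" "psum e (d + e)"
  shows "s = 0 \<and> e = 4"
proof (cases s)
  case 0
  then have n42: "e + 2 * d = 42" using n e(2) by simp
  have pc: "popc (d + e) \<le> e" using e(3) by (rule psum_popc)
  have "e = 0 \<or> e = 2 \<or> e = 4" using n42 e(1) by presburger
  moreover have "e \<noteq> 0"
  proof
    assume "e = 0"
    then have "d + e = 21" using n42 by simp
    then show False using pc \<open>e = 0\<close> by (simp add: popc.simps)
  qed
  moreover have "e \<noteq> 2"
  proof
    assume "e = 2"
    then have "d + e = 22" using n42 by simp
    then show False using pc \<open>e = 2\<close> by (simp add: popc.simps)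
  qed
  ultimately show ?thesis using 0 by simp
next
  case (Suc k)
  have k1: "(1::nat) \<le> 2 ^ k" by simp
  have n': "e + 2 * d + 5 = 2 * (47 * 2 ^ k)"
    using e(2) n k1 unfolding Suc power_Suc by linarith
  have pc: "popc (d + e) \<le> e" using e(3) by (rule psum_popc)
  have "e = 1 \<or> e = 3" using n' e(1) by presburger
  then show ?thesis
  proof
    assume "e = 1"
    then have "d + e = 47 * 2 ^ k - 2" using n' by linarith
    then show ?thesis using pc popc_47(2)[of k] \<open>e = 1\<close> by simp
  next
    assume "e = 3"
    then have "d + e = 47 * 2 ^ k - 1" using n' by linarith
    then show ?thesis using pc popc_47(1)[of k] \<open>e = 3\<close> by simp
  qed
qed

lemma admissible_all_odd:
  assumes n: "n = 5 * (2 ^ s - 1) + 42 * 2 ^ s" and x: "x \<in> Exps 4 n" "\<not> inadmissible 4 n x"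
  obtains b where "s = 0" "x = dbl {1..4} b" "b \<in> Exps 4 19"
proof -
  obtain U v where fU: "finite U" "U \<subseteq> {1..4}" and v: "x = dbl U v" and vE: "v \<in> Exps 4 (edeg v)"
    and en: "card U + 2 * edeg v = n"
    using Exps_dbl[OF x(1)] by blast
  have c4: "card U \<le> 4" using card_mono[OF _ fU(2)] by simp
  have ps: "psum (card U) (edeg v + card U)"
  proof (rule ccontr)
    assume "\<not> psum (card U) (edeg v + card U)"
    then have "mon x \<in> hits 4 n" using hit_if_not_psum[OF fU(2) vE] unfolding v en by simp
    then show False using inadmissible_hit[OF x(1)] x(2) by blast
  qed
  have s: "s = 0" "card U = 4" using psum_degree[OF n c4 en ps] by simp_all
  then have "U = {1..4}" using card_subset_eq[OF _ fU(2)] by simp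
  moreover have "edeg v = 19" using s en n by simp
  ultimately show ?thesis using that[of v] s v vE by simp
qed

section \<open>An endomorphism of the polynomials in four variables\<close>

text \<open>On \<open>X 1 * X 2 ^ 3 * w\<close>, with \<open>w\<close> free of both variables, the
  two surjections of the digits of 3 give the monomial itself and
  \<open>X 1 ^ 2 * X 2 ^ 2 * w\<close>, of smaller weight. An exponent of \<open>X 2\<close> below 3
  has at most one digit and gives 0.\<close>

definition swapE :: "mpol \<Rightarrow> mpol" where
  "swapE = subsum (\<lambda>k. if k = 1 then 2 else k) 2 {1, 2}"

lemma steenrod_hom_swapE: "steenrod_hom 4 4 swapE"
  unfolding swapE_def by (rule steenrod_hom_subsum) auto

lemma swapE_single_digit: "lookup c 2 < 3 \<Longrightarrow> swapE (mon c) = 0"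
proof -
  assume a: "lookup c 2 < 3"
  then have "lookup c 2 = 0 \<or> lookup c 2 = 2 ^ 0 \<or> lookup c 2 = 2 ^ 1" by auto
  then have "card (dig (lookup c 2)) \<le> 1" using dig_power[of 0] dig_power[of 1] by (elim disjE) simp_all
  then have "f \<notin> surj_maps (dig (lookup c 2)) {1, 2}" for f
    using surj_maps_card[of "dig (lookup c 2)" f "{1, 2}"] by auto
  then have "surj_maps (dig (lookup c 2)) {1, 2} = {}" by blast
  then show ?thesis unfolding swapE_def by (subst subsum_mon) simp_all
qed

lemma swapE_three:
  assumes c: "c \<in> Exps 4 d" "lookup c 1 = 1" "lookup c 2 = 3"
  shows "swapE (mon c) + mon c \<in> Pol 4 d" "\<forall>y\<in>keys (swapE (mon c) + mon c). wt y < wt c"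
proof -
  let ?t = "\<lambda>k. if k = 1 then 2 else k :: nat"
  let ?S = "surj_maps {..<2} {1, 2 :: nat}"
  let ?y = "\<lambda>f. relabel ?t 2 c + contrib {..<2} f"
  have D: "dig (lookup c 2) = {..<2}" using dig_mask[of 2] c(3) by simp
  have E: "swapE (mon c) = (\<Sum>f\<in>?S. mon (?y f))"
    unfolding swapE_def using subsum_mon[of "{1, 2}" ?t 2 c] D by simp
  have inj: "inj_on ?t (K - {2})" for K
    by (rule inj_onI) (auto split: if_splits)
  have r2: "lookup (relabel ?t 2 c) 2 = 1"
    using lookup_relabel_inj[of ?t 1 c 2] inj c(2) by simp
  have rj: "lookup (relabel ?t 2 c) j = lookup c j" if "j \<noteq> 1" "j \<noteq> 2" for j
    using lookup_relabel_inj[of ?t j c 2] inj that by simp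
  have r1: "lookup (relabel ?t 2 c) 1 = 0"
    unfolding relabel_def lookup_sum by (intro sum.neutral) (auto simp: lookup_single)
  \<comment> \<open>Digit 0 of the exponent 3 goes to \<open>X 1\<close>; digit 1 goes to
    \<open>X 2\<close>, which has already received the exponent 1 of the old
    \<open>X 1\<close>.\<close>
  define f1 where "f1 = (\<lambda>i::nat. if i = 0 then 1 else if i = 1 then 2 else undefined :: nat)"
  have l2: "{..<2::nat} = {0, 1}" by auto
  have f1: "f1 \<in> ?S" unfolding surj_maps_def l2 by (auto simp: f1_def PiE_iff extensional_def)
  have cy: "?y f1 = c"
  proof (rule poly_mapping_eqI)
    fix j
    have cf: "lookup (contrib {..<2} f1) j = (if j = 1 then 1 else if j = 2 then 2 else 0)"
      unfolding contrib_def l2 by (simp add: lookup_add lookup_single f1_def)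
    show "lookup (?y f1) j = lookup c j"
      unfolding lookup_add cf using r1 r2 rj[of j] c by auto
  qed
  have "(\<Sum>f\<in>?S. mon (?y f)) = mon (?y f1) + (\<Sum>f\<in>?S - {f1}. mon (?y f))"
    using f1 by (intro sum.remove) simp_all
  then have e: "swapE (mon c) + mon c = (\<Sum>f\<in>?S - {f1}. mon (?y f))"
    unfolding E cy by (simp only: mpol_add_cancel)
  have "swapE (mon c) \<in> Pol 4 d"
    using steenrod_hom_swapE c(1) unfolding steenrod_hom_def by (metis Pol_mon)
  then show "swapE (mon c) + mon c \<in> Pol 4 d" using c(1) by (intro Pol_add) simp_all
  have lt: "wt (?y f) < wt c" if f: "f \<in> ?S - {f1}" for f
  proof -
    have fE: "f ` {0, 1} = {1, 2}" "f \<in> {0, 1} \<rightarrow>\<^sub>E {1, 2}" using f unfolding surj_maps_def l2 by auto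
    have "f 0 = 2"
    proof (rule ccontr)
      assume n2: "f 0 \<noteq> 2"
      have "f 0 \<in> {1, 2}" using PiE_mem[OF fE(2), of 0] by simp
      then have f0: "f 0 = 1" using n2 by simp
      have "2 \<in> f ` {0, 1}" unfolding fE(1) by simp
      then have "f 1 = 2" using n2 by auto
      have "f i = f1 i" for i
        using f0 \<open>f 1 = 2\<close> PiE_arb[OF fE(2), of i] by (simp add: f1_def)
      then show False using f by blast
    qed
    then have "0 \<in> dig (lookup (contrib (dig (lookup c 2)) f) 2)"
      unfolding D by (simp add: dig_contrib)
    moreover have "0 \<in> dig (lookup (relabel ?t 2 c) 2)"
      unfolding r2 using dig_power[of 0] by simp
    ultimately have "wt (relabel ?t 2 c + contrib (dig (lookup c 2)) f) < wt c"
      by (intro wt_relabel_contrib_overlap[of _ _ _ 2]) blast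
    then show ?thesis unfolding D .
  qed
  show "\<forall>y\<in>keys (swapE (mon c) + mon c). wt y < wt c"
  proof
    fix y assume "y \<in> keys (swapE (mon c) + mon c)"
    then have "y \<in> (\<Union>f\<in>?S - {f1}. keys (mon (?y f)))"
      unfolding e using Poly_Mapping.keys_sum by (rule subsetD[rotated])
    then obtain f where "f \<in> ?S - {f1}" "y \<in> keys (mon (?y f))" by (rule UN_E)
    then show "wt y < wt c" using lt by simp
  qed
qed

text \<open>For equal weights \<open>lookup c 1\<close> must be 1. Then \<open>lookup c 2\<close> is
  below 3 and the image is 0, or it is 3 and \<open>c\<close> is reproduced up to smaller
  weight.\<close>

lemma swapE_low:
  assumes b: "b \<in> Exps 4 d" "lookup b 1 = 1" "lookup b 2 = 3" and c: "c \<in> Exps 4 d" "mless c b" "lookup c 1 \<noteq> 0"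
  shows "swapE (mon c) \<in> low 4 d b"
proof (cases "wt c < wt b")
  case True
  have P: "swapE (mon c) \<in> Pol 4 d"
    using steenrod_hom_swapE c(1) unfolding steenrod_hom_def by (metis Pol_mon)
  have E: "swapE (mon c) = (\<Sum>f\<in>surj_maps (dig (lookup c 2)) {1, 2}.
      mon (relabel (\<lambda>k. if k = 1 then 2 else k) 2 c + contrib (dig (lookup c 2)) f))"
    unfolding swapE_def by (rule subsum_mon) simp
  show ?thesis using P unfolding E
  proof (rule low_sum_mon)
    fix f
    show "mless (relabel (\<lambda>k. if k = 1 then 2 else k) 2 c + contrib (dig (lookup c 2)) f) b"
      unfolding mless_iff using le_less_trans[OF wt_relabel_contrib True] by blast
  qed
next
  case False
  then have w: "wt c = wt b" "c < b" using c(2) unfolding mless_iff by auto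
  obtain k where k: "lookup c k < lookup b k" "\<And>j. j < k \<Longrightarrow> lookup c j = lookup b j"
    using less_expoE[OF w(2)] by blast
  have "k \<noteq> 0"
  proof
    assume "k = 0"
    then show False using k(1) lookup_Exps[OF b(1), of 0] by simp
  qed
  moreover have "k \<noteq> 1" using k(1) b(2) c(3) by auto
  ultimately have k2: "2 \<le> k" by linarith
  then have c1: "lookup c 1 = 1" using k(2)[of 1] b(2) by simp
  show ?thesis
  proof (cases "k = 2")
    case True
    then show ?thesis using k(1) b(3) by (simp add: swapE_single_digit)
  next
    case False
    then have c2: "lookup c 2 = 3" using k(2)[of 2] k2 b(3) by simp
    have "swapE (mon c) + mon c \<in> low 4 d b"
      using swapE_three[OF c(1) c1 c2] w(1) unfolding low_def mless_iff by simp
    moreover have "mon c \<in> low 4 d b" using c by simp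
    ultimately have "swapE (mon c) + mon c + mon c \<in> low 4 d b" by (rule low_add)
    then show ?thesis by (simp only: add.assoc mpol_add_self add_0_right)
  qed
qed

section \<open>Images of admissible monomials\<close>

lemma edeg_four: "m \<in> Exps 4 n \<Longrightarrow> lookup m 1 + lookup m 2 + lookup m 3 + lookup m 4 = n"
proof -
  assume m: "m \<in> Exps 4 n"
  have "edeg m = (\<Sum>j\<in>{1..4}. lookup m j)" using m by (intro edeg_superset) (auto simp: Exps_def)
  moreover have "{1..4::nat} = {1, 2, 3, 4}" by auto
  ultimately show ?thesis using m by (simp add: Exps_def)
qed

lemma edeg_sub: "m \<in> Exps t n \<Longrightarrow> I \<subseteq> {1..t} \<Longrightarrow> (\<Sum>j\<in>I. lookup m j) \<le> n"
proof -
  assume m: "m \<in> Exps t n" and I: "I \<subseteq> {1..t}"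
  have "(\<Sum>j\<in>I. lookup m j) \<le> (\<Sum>j\<in>{1..t}. lookup m j)" using I by (intro sum_mono2) auto
  also have "\<dots> = edeg m" using m by (intro edeg_superset[symmetric]) (auto simp: Exps_def)
  finally show ?thesis using m by (simp add: Exps_def)
qed

lemma digit_one_mod: "digit 1 a = 1 \<Longrightarrow> a mod 4 \<ge> 2" "digit 0 a = 1 \<Longrightarrow> odd a"
  "digit 2 a = 1 \<Longrightarrow> a mod 8 \<ge> 4" "digit 3 a = 1 \<Longrightarrow> a mod 16 \<ge> 8"
  unfolding digit_def by (simp_all, presburger+)

text \<open>For \<open>r = 3\<close> and \<open>l < A\<close>, the exponent of \<open>X 1\<close> in \<open>b\<close> is at most one, since an
  admissible monomial has first exponent of the form \<open>2 ^ k - 1\<close>.\<close>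

lemma psi_admissible_42:
  assumes NN: "(l, L) \<in> NN 5" and st: "star L u (dbl {1..4} b)" and u: "u \<ge> 2"
    and b: "b \<in> Exps 4 19" "\<not> inadmissible 4 19 b"
    and p: "lookup p l = 2 ^ length L - 1"
      "del l p + wvec (u - 1) (length L) (drop (u - 1) (map (\<lambda>j. j - 1) L)) = dbl {1..4} b"
      "wt p = wt (dbl {1..4} b)" "edeg p = 42"
  shows "\<not> inadmissible 5 42 p"
proof -
  let ?x = "dbl {1..4} b"
  define r where "r = length L"
  have xE: "?x \<in> Exps 4 42" using dbl_Exps[of "{1..4}" 4 b 19] b(1) by simp
  have lx: "lookup ?x j = 1 + 2 * lookup b j" if "j \<in> {1..4}" for j
    using that by (simp add: lookup_dbl)
  have ur: "1 \<le> u" "u \<le> r" using st by (auto simp: star_def Let_def r_def)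
  have S1: "lookup ?x (ell L d - 1) = 2 ^ r - 1" if "1 \<le> d" "d < u" for d
    using st that unfolding star_def Let_def r_def by simp
  have S2: "lookup ?x (ell L u - 1) > 2 ^ r - 1"
    using st unfolding star_def Let_def r_def by blast
  have S3: "digit (r - d) (lookup ?x (ell L u - 1)) = 1" if "1 \<le> d" "d \<le> u" for d
    using st that unfolding star_def Let_def r_def by simp
  have l: "l \<in> {1..5}" and srt: "sorted_wrt (<) (l # L)" and sub: "set L \<subseteq> {1..5}"
    using NN by (auto simp: NN_def)
  have r2: "2 \<le> r" using ur u by simp
  obtain l1 l2 L2 where L: "L = l1 # l2 # L2" using r2 unfolding r_def by (cases L; cases "tl L") auto
  define A M' where "A = l1 - 1" and "M' = map (\<lambda>j. j - 1) (l2 # L2)"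
  have M: "map (\<lambda>j. j - 1) L = A # M'" by (simp add: L A_def M'_def)
  have sM: "sorted_wrt (<) (A # M')" using sorted_dec[OF srt] unfolding M .
  have gtl: "l < j" if "j \<in> set L" for j using srt that by simp
  have lM: "length (A # M') = r" unfolding M[symmetric] r_def by simp
  have setM: "set (A # M') \<subseteq> {l..4}"
  proof
    fix a assume "a \<in> set (A # M')"
    then obtain j where "j \<in> set L" "a = j - 1" unfolding M[symmetric] by auto
    then show "a \<in> {l..4}" using gtl[of j] subsetD[OF sub, of j] by auto
  qed
  have setM1: "set (A # M') \<subseteq> {1..4}" using setM l by auto
  have xA: "lookup ?x A = 2 ^ r - 1" using S1[of 1] u by (simp add: ell_def L A_def)
  have A4: "A \<in> {1..4}" using setM1 by simp
  have eM: "ell L d - 1 = ell (A # M') d" if "1 \<le> d" "d \<le> r" for d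
    using that unfolding M[symmetric] by (simp add: ell_def r_def)
  have r4: "r \<le> 4"
  proof -
    have "distinct (A # M')" using sM unfolding strict_sorted_iff by blast
    then have "r = card (set (A # M'))" using lM distinct_card by metis
    also have "\<dots> \<le> card {1..4::nat}" using setM1 by (intro card_mono) auto
    finally show ?thesis by simp
  qed
  have bA: "lookup b A = 2 ^ (r - 1) - 1"
  proof -
    have "(2::nat) ^ r = 2 * 2 ^ (r - 1)" using r2 by (metis One_nat_def Suc_pred less_le_trans pos2 power_Suc)
    then show ?thesis using xA lx[OF A4] by linarith
  qed
  have second: ?thesis if u2: "u = 2"
    and pr: "\<And>f g. pr (f + g) = pr f + (pr g :: mpol)" "\<And>f. f \<in> hits 4 19 \<Longrightarrow> pr f \<in> hits 4 19"
      "pr (mon b) + mon b \<in> low 4 19 b"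
      "\<And>c. c \<in> Exps 4 19 \<Longrightarrow> mless c b \<Longrightarrow> pr (mon c) \<in> low 4 19 b"
      "\<And>c. c \<in> Exps 4 19 \<Longrightarrow> l < A \<Longrightarrow> lookup c A < 2 ^ (r - 1) - 1 \<Longrightarrow> wt c \<le> wt b \<Longrightarrow>
        pr (mon c) \<in> low 4 19 b" for pr
  proof -
    have d: "drop (u - 1) (map (\<lambda>j. j - 1) L) = M'" unfolding M u2 by (simp add: numeral_2_eq_2 One_nat_def)
    have "\<not> inadmissible (Suc 4) (4 + 2 * 19) p"
    proof (rule psi_admissible_second[where pr = pr and A = A and M' = M' and r = r and l = l and b = b])
      show "l \<in> {1..Suc 4}" using l by simp
      show "M' \<noteq> []" by (simp add: M'_def)
      show "del l p + wvec 1 r M' = ?x" using p(2) unfolding d using u2 by (simp add: r_def)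
    qed (use sM setM lM b bA p pr in \<open>simp_all add: r_def\<close>)
    then show ?thesis by simp
  qed
  consider "r = 2" | "r = 3" | "r = 4" using r2 r4 by linarith
  then show ?thesis
  proof cases
    case 1
    then have u2: "u = 2" using u ur by simp
    have b1: "lookup b A = 1" using bA 1 by simp
    \<comment> \<open>An exceptional term has exponent 0 at \<open>A\<close>, where \<open>b\<close>
      has 1; the projection keeps the multiples of \<open>X A\<close>.\<close>
    show ?thesis
    proof (rule second[of "\<lambda>f. f + setzero A f", OF u2])
      show "f + setzero A f \<in> hits 4 19" if "f \<in> hits 4 19" for f
        using that steenrod_hom_hits[OF steenrod_hom_setzero[of 4 A] that] by (rule hits_add)
      show "mon b + setzero A (mon b) + mon b \<in> low 4 19 b" by (simp add: setzero_mon b1)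
      show "mon c + setzero A (mon c) \<in> low 4 19 b" if "c \<in> Exps 4 19" "mless c b" for c
        using that by (simp add: setzero_mon)
      show "mon c + setzero A (mon c) \<in> low 4 19 b" if "lookup c A < 2 ^ (r - 1) - 1" for c
        using that 1 by (simp add: setzero_mon)
    qed (simp add: setzero_add ac_simps)
  next
    case 2
    obtain B C where M2: "A # M' = [A, B, C]"
      using lM 2 by (cases M'; cases "tl M'") (auto simp: One_nat_def)
    have ABC: "A < B" "B < C" "C \<le> 4" "l \<le> A" "1 \<le> A" using sM setM l unfolding M2 by auto
    have eABC: "ell (A # M') 1 = A" "ell (A # M') 2 = B" "ell (A # M') 3 = C"
      unfolding M2 by (simp_all add: ell_def eval_nat_numeral One_nat_def)
    have bA3: "lookup b A = 3" using bA 2 by simp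
    have u23: "u = 2 \<or> u = 3" using u ur 2 by linarith
    \<comment> \<open>The digits 2 and 1 that \<open>star\<close> requires, or the full value 7,
      move down by one place when \<open>?x\<close> is halved.\<close>
    have bB: "lookup b B mod 4 = 3"
    proof (cases "u = 2")
      case True
      have "digit 2 (lookup ?x B) = 1" "digit 1 (lookup ?x B) = 1"
        using S3[of 1] S3[of 2] eM[of 2] eABC True 2 by simp_all
      then have "lookup ?x B mod 8 \<ge> 4" "lookup ?x B mod 4 \<ge> 2" using digit_one_mod by blast+
      then show ?thesis using lx[of B] ABC by (simp, presburger)
    next
      case False
      then have "lookup ?x B = 7" using u23 S1[of 2] eM[of 2] eABC 2 by simp
      then show ?thesis using lx[of B] ABC by simp
    qed
    have pattern: "inadmissible 4 19 b" if a: "a \<in> {1..4}" "lookup b a mod 4 = 2"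
      "\<And>j. j \<in> {1..4} \<Longrightarrow> j \<noteq> a \<Longrightarrow> lookup b j mod 4 = 3" for a
      using a by (intro inadmissible_Sq_1[OF b(1), of a]) auto
    show ?thesis
    proof (cases "u = 2")
      case u2: True
      show ?thesis
      proof (cases "l < A")
        case False
        show ?thesis
          by (rule second[of "\<lambda>f. f", OF u2]) (use False in auto)
      next
        case True
        \<comment> \<open>Three positions beyond \<open>l\<close> fit into \<open>{1..4}\<close> in
          one way only.\<close>
        then have pos: "A = 2" "B = 3" "C = 4" "l = 1" using ABC l by auto
        have b2: "lookup b 2 = 3" "lookup b 3 mod 4 = 3" using bA3 bB pos by simp_all
        \<comment> \<open>A first exponent \<open>2 ^ k - 1\<close> with \<open>k \<ge> 2\<close> is
          3 modulo 4. Then degree 19 leaves 2 modulo 4 for the last variable, and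
          \<open>Sq 1\<close> applies.\<close>
        have b1: "lookup b 1 = 0 \<or> lookup b 1 = 1"
        proof (rule ccontr)
          assume n: "\<not> ?thesis"
          from mask_or_pattern[of "lookup b 1"] show False
          proof
            assume "\<exists>k. lookup b 1 = 2 ^ k - 1"
            then obtain k where k: "lookup b 1 = 2 ^ k - 1" by blast
            obtain i where i: "k = Suc (Suc i)"
            proof (cases k)
              case 0
              then show ?thesis using k n by simp
            next
              case (Suc k')
              then show ?thesis using k n that by (cases k') simp_all
            qed
            have "(1::nat) \<le> 2 ^ i" by simp
            then have "lookup b 1 = 4 * (2 ^ i - 1) + 3" unfolding k i power_Suc by linarith
            then have b13: "lookup b 1 mod 4 = 3" by simp
            then have "lookup b 4 mod 4 = 2"
              using edeg_four[OF b(1)] b2 by presburger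
            moreover have "lookup b j mod 4 = 3" if "j \<in> {1..4}" "j \<noteq> 4" for j
            proof -
              have "j = 1 \<or> j = 2 \<or> j = 3" using that by auto
              then show ?thesis using b13 b2 by auto
            qed
            ultimately show False using pattern[of 4] b(2) by auto
          next
            assume "\<exists>k. (lookup b 1 div 2 ^ k) mod 4 = 2"
            then show False using inadmissible_first_exponent[OF b(1)] b(2) by blast
          qed
        qed
        show ?thesis
        proof (cases "lookup b 1 = 0")
          case b10: True
          \<comment> \<open>Exceptional terms divisible by \<open>X 1\<close> vanish; the others
            agree with \<open>b\<close> at position 1 and are smaller at position 2.\<close>
          show ?thesis
          proof (rule second[of "setzero 1", OF u2])
            show "setzero 1 f \<in> hits 4 19" if "f \<in> hits 4 19" for f
              using steenrod_hom_hits[OF steenrod_hom_setzero that] .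
            show "setzero 1 (mon b) + mon b \<in> low 4 19 b"
              using b10 by (simp add: setzero_mon)
            show "setzero 1 (mon c) \<in> low 4 19 b" if "c \<in> Exps 4 19" "mless c b" for c
              using that by (simp add: setzero_mon)
            show "setzero 1 (mon c) \<in> low 4 19 b"
              if c: "c \<in> Exps 4 19" "lookup c A < 2 ^ (r - 1) - 1" "wt c \<le> wt b" for c
            proof (cases "lookup c 1 = 0")
              case True
              have c2: "lookup c 2 < 3" using c(2) pos 2 by simp
              have "c < b"
              proof (rule less_expoI[of _ 2])
                show "lookup c 2 < lookup b 2" using c2 b2 by simp
                fix j :: nat assume "j < 2"
                then have "j = 0 \<or> j = 1" by auto
                then show "lookup c j = lookup b j"
                  using True b10 lookup_Exps[OF c(1), of 0] lookup_Exps[OF b(1), of 0] by auto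
              qed
              then show ?thesis using c(1,3) True by (auto simp: setzero_mon mless_iff)
            qed (simp add: setzero_mon)
          qed (rule setzero_add)
        next
          case False
          then have b11: "lookup b 1 = 1" using b1 by simp
          have hom: "steenrod_hom 4 4 swapE" by (rule steenrod_hom_swapE)
          have sadd: "swapE (f + g) = swapE f + swapE g" for f g
            using hom unfolding steenrod_hom_def by blast
          have s0: "swapE 0 = 0" using sadd[of 0 0] by simp
          \<comment> \<open>\<open>swapE\<close> kills the exceptional terms, whose exponent at
            position 2 is below 3. The inner projection removes the monomials without
            \<open>X 1\<close>, which \<open>swapE\<close> could send above
            \<open>b\<close>.\<close>
          show ?thesis
          proof (rule second[of "\<lambda>f. swapE (f + setzero 1 f)", OF u2])
            show "swapE (f + g + setzero 1 (f + g)) = swapE (f + setzero 1 f) + swapE (g + setzero 1 g)" for f g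
              by (simp add: setzero_add sadd ac_simps)
            show "swapE (f + setzero 1 f) \<in> hits 4 19" if "f \<in> hits 4 19" for f
              using that steenrod_hom_hits[OF steenrod_hom_setzero[of 4 1] that]
              by (intro steenrod_hom_hits[OF hom] hits_add)
            show "swapE (mon b + setzero 1 (mon b)) + mon b \<in> low 4 19 b"
              using swapE_three[OF b(1) b11 b2(1)] b11 by (simp add: setzero_mon low_def mless_iff)
            show "swapE (mon c + setzero 1 (mon c)) \<in> low 4 19 b" if "c \<in> Exps 4 19" "mless c b" for c
              using swapE_low[OF b(1) b11 b2(1) that] by (simp add: setzero_mon s0)
            show "swapE (mon c + setzero 1 (mon c)) \<in> low 4 19 b"
              if "lookup c A < 2 ^ (r - 1) - 1" for c
              using that pos 2 swapE_single_digit[of c] by (simp add: setzero_mon s0)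
          qed
        qed
      qed
    next
      \<comment> \<open>This case contradicts admissibility: three exponents of \<open>b\<close> are
        3 modulo 4 and all four add up to 19, so the fourth is 2 modulo 4.\<close>
      case False
      then have u3: "u = 3" using u23 by simp
      have "digit 1 (lookup ?x C) = 1" "digit 2 (lookup ?x C) = 1"
        using S3[of 1] S3[of 2] eM[of 3] eABC u3 2 by simp_all
      then have "lookup ?x C mod 8 \<ge> 4" "lookup ?x C mod 4 \<ge> 2" using digit_one_mod by blast+
      then have bC: "lookup b C mod 4 = 3" using lx[of C] ABC by (simp, presburger)
      \<comment> \<open>The position left over, as 1 + 2 + 3 + 4 = 10.\<close>
      define D where "D = 10 - A - B - C"
      have "A = 1 \<and> B = 2 \<and> C = 3 \<or> A = 1 \<and> B = 2 \<and> C = 4 \<or> A = 1 \<and> B = 3 \<and> C = 4 \<or> A = 2 \<and> B = 3 \<and> C = 4"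
        using ABC by linarith
      moreover have "{1..4::nat} = {1, 2, 3, 4}" by auto
      ultimately have D: "D \<in> {1..4}" "D \<noteq> A" "D \<noteq> B" "D \<noteq> C" "{1..4} = {A, B, C, D}"
        unfolding D_def by (elim disjE conjE; force)+
      have "(\<Sum>j\<in>{A, B, C, D}. lookup b j) = 19"
        using b(1) edeg_superset[of "{1..4}" b] unfolding D(5)[symmetric] Exps_def by simp
      then have "lookup b A + lookup b B + lookup b C + lookup b D = 19" using ABC D(2-4) by simp
      moreover obtain q q' where "lookup b B = 4 * q + 3" "lookup b C = 4 * q' + 3"
        using bB bC by (metis mult_div_mod_eq)
      ultimately have "lookup b D + 4 * (q + q') = 10" using bA3 by simp
      then have "(lookup b D + 4 * (q + q')) mod 4 = 10 mod 4" by (rule arg_cong)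
      then have "lookup b D mod 4 = 10 mod 4" by (simp only: mod_mult_self2)
      then have "lookup b D mod 4 = 2" by simp
      moreover have "lookup b j mod 4 = 3" if "j \<in> {1..4}" "j \<noteq> D" for j
      proof -
        have "j = A \<or> j = B \<or> j = C" using that unfolding D(5) by blast
        then show ?thesis by (elim disjE) (simp_all add: bA3 bB bC)
      qed
      ultimately show ?thesis using pattern[OF D(1)] b(2) by blast
    qed
  next
    \<comment> \<open>For \<open>r = 4\<close> the degree 42 is exceeded: by 15 + 28 if
      \<open>u = 2\<close>, because a number above 15 with digits 3 and 2 set is at least 28, and by
      15 + 15 + 16 if \<open>u \<ge> 3\<close>.\<close>
    case 3
    define e where "e d = ell (A # M') d" for d
    have eu: "e u \<in> {1..4}" "e 1 = A"
    proof -
      have "(A # M') ! (u - 1) \<in> set (A # M')" using ur lM by (intro nth_mem) simp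
      then show "e u \<in> {1..4}" unfolding e_def ell_def using setM1 by (rule subsetD[rotated])
      show "e 1 = A" by (simp add: e_def ell_def)
    qed
    have dist: "e i \<noteq> e j" if "1 \<le> i" "i < j" "j \<le> r" for i j
    proof -
      have "(A # M') ! (i - 1) < (A # M') ! (j - 1)"
        using that lM by (intro sorted_wrt_nth_less[OF sM]) auto
      then show ?thesis by (simp add: e_def ell_def)
    qed
    have xu: "lookup ?x (e u) > 15" using S2 eM[of u] ur 3 by (simp add: e_def)
    have False
    proof (cases "u = 2")
      case True
      have "digit 3 (lookup ?x (e u)) = 1" "digit 2 (lookup ?x (e u)) = 1"
        using S3[of 1] S3[of 2] eM[of u] ur True 3 by (simp_all add: e_def)
      then have "lookup ?x (e u) mod 16 \<ge> 8" "lookup ?x (e u) mod 8 \<ge> 4" using digit_one_mod by blast+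
      then have "lookup ?x (e u) \<ge> 28" using xu by presburger
      moreover have "(\<Sum>j\<in>{A, e u}. lookup ?x j) \<le> 42" using edeg_sub[OF xE, of "{A, e u}"] A4 eu by simp
      moreover have "A \<noteq> e u" using dist[of 1 u] eu True ur by simp
      ultimately show False using xA 3 by simp
    next
      case False
      then have u3: "3 \<le> u" using u by simp
      have "(A # M') ! (2 - 1) \<in> set (A # M')" using lM 3 by (intro nth_mem) simp
      then have e2: "e 2 \<in> {1..4}" unfolding e_def ell_def using setM1 by (rule subsetD[rotated])
      have x2: "lookup ?x (e 2) = 15" using S1[of 2] eM[of 2] u3 3 by (simp add: e_def)
      have "A \<noteq> e u" "A \<noteq> e 2" "e 2 \<noteq> e u"
        using dist[of 1 u] dist[of 1 2] dist[of 2 u] eu(2) u3 ur 3 by simp_all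
      moreover have "(\<Sum>j\<in>{A, e 2, e u}. lookup ?x j) \<le> 42"
        using edeg_sub[OF xE, of "{A, e 2, e u}"] A4 eu e2 by simp
      ultimately show False using xA 3 x2 xu by simp
    qed
    then show ?thesis ..
  qed
qed

text \<open>The argument for \<open>u = 1\<close> works in any degree. For \<open>u \<ge> 2\<close>
  the mere existence of an admissible \<open>x\<close> forces \<open>s = 0\<close> and odd
  exponents.\<close>

lemma psi_admissible:
  assumes n: "n = 5 * (2 ^ s - 1) + 42 * 2 ^ s" and NN: "(l, L) \<in> NN 5" and st: "star L u x"
    and x: "x \<in> Exps 4 n" "\<not> inadmissible 4 n x"
  obtains p where "psi l L (mon x) = mon p" "p \<in> Exps 5 n" "\<not> inadmissible 5 n p" "wt p = wt x"
proof -
  let ?r = "length L" and ?M = "map (\<lambda>j. j - 1) L"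
  obtain p where p: "psi l L (mon x) = mon p" "lookup p l = 2 ^ ?r - 1"
    "del l p + wvec (u - 1) ?r (drop (u - 1) ?M) = x" "wt p = wt x" "edeg p = edeg x"
    using psi_exponent[OF NN st] by blast
  have en: "edeg p = n" using p(5) x(1) by (simp add: Exps_def)
  have l: "l \<in> {1..Suc 4}" and srt: "sorted_wrt (<) (l # L)" and sub: "set L \<subseteq> {1..5}"
    using NN by (auto simp: NN_def)
  have pE: "p \<in> Exps 5 n" using Exps_of_del[OF l x(1) p(3) en] by simp
  have u1: "1 \<le> u" using st by (simp add: star_def Let_def)
  have "\<not> inadmissible 5 n p"
  proof (cases "u = 1")
    case True
    have "\<not> inadmissible (Suc 4) n p"
    proof (rule psi_admissible_first[OF l sorted_dec[OF srt] _ _ x p(2) _ p(4) en])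
      show "set ?M \<subseteq> {l..4}"
      proof
        fix a assume "a \<in> set ?M"
        then obtain j where j: "j \<in> set L" "a = j - 1" by auto
        then have "l < j" using srt by simp
        then show "a \<in> {l..4}" using j subsetD[OF sub j(1)] by auto
      qed
      show "del l p + wvec 0 ?r ?M = x" using p(3) True by simp
    qed simp
    then show ?thesis by simp
  next
    case False
    obtain b where b: "s = 0" "x = dbl {1..4} b" "b \<in> Exps 4 19"
      using admissible_all_odd[OF n x] by blast
    have n42: "n = 42" using n b(1) by simp
    have bi: "\<not> inadmissible 4 19 b"
    proof
      assume "inadmissible 4 19 b"
      then have "inadmissible 4 (card {1..4::nat} + 2 * 19) (dbl {1..4} b)"
        using b(3) by (rule inadmissible_dbl) simp
      then show False using x(2) b(2) n42 by simp
    qed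
    show ?thesis unfolding n42
    proof (rule psi_admissible_42[OF NN _ _ b(3) bi p(2)])
      show "star L u (dbl {1..4} b)" using st b(2) by simp
      show "2 \<le> u" using u1 False by simp
    qed (use p en b(2) n42 in simp_all)
  qed
  then show ?thesis using that p(1,4) pE by blast
qed

section \<open>Assembling the two statements\<close>

lemma mon_inject: "mon x = mon y \<longleftrightarrow> x = y"
proof
  assume "mon x = mon y"
  then have "keys (mon x) = keys (mon y)" by (rule arg_cong)
  then show "x = y" by simp
qed simp

lemma mon_Adm: "mon x \<in> Adm t n \<longleftrightarrow> x \<in> Exps t n \<and> \<not> inadmissible t n x"
  by (auto simp: Adm_def mon_inject)

lemma mon_Adm_weight: "mon x \<in> Adm_weight t n \<omega> \<longleftrightarrow> mon x \<in> Adm t n \<and> weight_of x = \<omega>"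
  by (auto simp: Adm_weight_def mon_inject)

text \<open>The case \<open>r = 0\<close> of \<open>psi_admissible_first\<close>: the empty set of
  positions has only the empty subset, so the substitution puts 0 for \<open>X l\<close>.\<close>

lemma qexp_admissible:
  assumes l: "l \<in> {1..Suc t}" and x: "x \<in> Exps t n" "\<not> inadmissible t n x"
  shows "qexp l x \<in> Exps (Suc t) n" "\<not> inadmissible (Suc t) n (qexp l x)" "wt (qexp l x) = wt x"
proof -
  have d: "del l (qexp l x) = x"
    by (rule poly_mapping_eqI) (simp only: lookup_del lookup_qexp_skip)
  have z: "lookup (qexp l x) l = 0"
    unfolding qexp_def lookup_sum by (intro sum.neutral) (simp add: lookup_single)
  show w: "wt (qexp l x) = wt x" using wt_del[of l "qexp l x"] d z by simp
  have e: "edeg (qexp l x) = n"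
    using edeg_relabel[of "unskip l" l "qexp l x"] d z x(1) by (simp add: Exps_def)
  have "keys (qexp l x) \<subseteq> {1..Suc t}" using x(1) by (intro keys_del[OF _ l]) (simp add: d Exps_def)
  then show "qexp l x \<in> Exps (Suc t) n" using e by (simp add: Exps_def)
  show "\<not> inadmissible (Suc t) n (qexp l x)"
    by (rule psi_admissible_first[OF l _ _ _ x _ _ w e, of "[]" 0]) (simp_all add: d z)
qed

theorem mainTheorem4:
  fixes s n :: nat
  assumes "n = 5 * (2 ^ s - 1) + 42 * 2 ^ s"
  shows "(\<forall>(l, L) \<in> NN 5. 1 \<le> length L \<and> length L \<le> 4 \<longrightarrow>
            (\<forall>x. mon x \<in> Adm 4 n \<and> (\<exists>u. star L u x) \<longrightarrow> psi l L (mon x) \<in> Adm 5 n))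
       \<and> (\<forall>\<omega>. weight_vector \<omega> \<and> wdeg \<omega> = n \<longrightarrow>
            Phi_star 5 n (Adm_weight 4 n \<omega>) \<subseteq> Adm_weight 5 n \<omega>)"
proof (intro conjI allI impI)
  show "\<forall>(l, L) \<in> NN 5. 1 \<le> length L \<and> length L \<le> 4 \<longrightarrow>
      (\<forall>x. mon x \<in> Adm 4 n \<and> (\<exists>u. star L u x) \<longrightarrow> psi l L (mon x) \<in> Adm 5 n)"
  proof (clarify)
    fix l L x u
    assume NN: "(l, L) \<in> NN 5" and "mon x \<in> Adm 4 n" and st: "star L u x"
    then have x: "x \<in> Exps 4 n" "\<not> inadmissible 4 n x" unfolding mon_Adm by blast+
    obtain p where "psi l L (mon x) = mon p" "p \<in> Exps 5 n" "\<not> inadmissible 5 n p"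
      using psi_admissible[OF assms NN st x] by blast
    then show "psi l L (mon x) \<in> Adm 5 n" by (simp only: mon_Adm simp_thms)
  qed
next
  fix \<omega> :: weight
  show "Phi_star 5 n (Adm_weight 4 n \<omega>) \<subseteq> Adm_weight 5 n \<omega>"
  proof
    fix f assume f: "f \<in> Phi_star 5 n (Adm_weight 4 n \<omega>)"
    have elem: "\<exists>x. g = mon x \<and> x \<in> Exps 4 n \<and> \<not> inadmissible 4 n x \<and> weight_of x = \<omega>"
      if "g \<in> Adm_weight 4 n \<omega>" for g
      using that unfolding Adm_weight_def mon_Adm by blast
    from f consider (q) l g where "l \<in> {1..5}" "g \<in> Adm_weight 4 n \<omega>" "f = qmap l g"
      | (pos) l L g where "(l, L) \<in> NN 5" "1 \<le> length L" "g \<in> Adm_weight 4 n \<omega>" "f = psi l L g" "f \<notin> Pol0 5 n"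
      unfolding Phi_star_def Phi0_def Phi_pos_def by blast
    then show "f \<in> Adm_weight 5 n \<omega>"
    proof cases
      case q
      obtain x where x: "g = mon x" "x \<in> Exps 4 n" "\<not> inadmissible 4 n x" "weight_of x = \<omega>"
        using elem[OF q(2)] by blast
      have "l \<in> {1..Suc 4}" using q(1) by simp
      from qexp_admissible[OF this x(2,3)] show ?thesis
        unfolding q(3) x(1) qmap_mon mon_Adm_weight mon_Adm using x(4) by (simp add: weight_of_eq_iff[symmetric])
    next
      case pos
      obtain x where x: "g = mon x" "x \<in> Exps 4 n" "\<not> inadmissible 4 n x" "weight_of x = \<omega>"
        using elem[OF pos(3)] by blast
      \<comment> \<open>Where no \<open>u\<close> exists, psi gives 0, which lies in
        \<open>Pol0\<close> and is therefore excluded from \<open>Phi_pos\<close>.\<close>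
      have "\<exists>u. star L u x"
      proof (rule ccontr)
        assume "\<not> (\<exists>u. star L u x)"
        then have "f = 0" using pos(2) unfolding pos(4) x(1) psi_def psi_mono_def by auto
        then show False using pos(5) by (simp add: Pol0_def)
      qed
      then obtain u where st: "star L u x" by blast
      obtain p where p: "psi l L (mon x) = mon p" "p \<in> Exps 5 n" "\<not> inadmissible 5 n p" "wt p = wt x"
        using psi_admissible[OF assms pos(1) st x(2,3)] by blast
      have "weight_of p = \<omega>" using p(4) x(4) by (simp add: weight_of_eq_iff[symmetric])
      then show ?thesis unfolding pos(4) x(1) p(1) mon_Adm_weight mon_Adm using p(2,3) by blast
    qed
  qed
qed

end
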